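(* Let $p\geq 2$ and $k\geq 1$ be integers. Let $\check{A}=A^{(2)}_{p-1}$ if $p$ is odd and $\check{A}=D^{(2)}_{1+p/2}$ if $p$ is even, and consider the level $k+1$ weight $\check{\Lambda}=(k+1)\check{\Lambda}_0$ of $\mathfrak{g}(\check{A})$. Then for every integer $\ell$ with $1\leq \ell\leq\lfloor p/2\rfloor$: (a) $\gamma_{\ell}:=\check{\Lambda}-\ell\check{\alpha}_0-(\ell-1)\check{\alpha}_1-\cdots-\check{\alpha}_{\ell-1}$ is a dominant maximal weight of $V(\check{\Lambda})$, i.e. $\gamma_\ell\in\max_{\check{A}}(\check{\Lambda})\cap\mathcal{P}^+_{\check{A}}$; (b) the multiplicity $\dim V(\check{\Lambda})_{\gamma_\ell}$ is equal to the number of $((k+2),(k+1),k,\dots,1)$-avoiding involutions of $\ell$.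
   Context: For an affine generalized Cartan matrix $A$ with Kac-Moody Lie algebra $\mathfrak{g}(A)$ and null root $\delta$, $\mathcal{P}^+_A$ denotes the set of dominant integral weights, $V(\Lambda)$ the integrable irreducible highest weight module of highest weight $\Lambda\in\mathcal{P}^+_A$, $V(\Lambda)_\mu$ its $\mu$-weight space, $P_A(\Lambda)=\{\mu\mid V(\Lambda)_\mu\neq0\}$, and $\max_A(\Lambda)=\{\lambda\in P_A(\Lambda)\mid \lambda+\delta\notin P_A(\Lambda)\}$ the set of maximal weights. Symbols with a check refer to $\check{A}$: $\check{\alpha}_i$ are the simple roots and $\check{\Lambda}_0$ is the fundamental weight attached to the vertex $0$. The labelling is as follows; $a_{ij}$ denotes the value of the $i$-th simple coroot on $\check{\alpha}_j$, with $a_{ii}=2$ and all unlisted off-diagonal entries zero. - $p=2n+1$ odd, $\check{A}=A^{(2)}_{2n}$, vertices $0,1,\dots,n$. If $n=1$: $a_{01}=-4$, $a_{10}=-1$. If $n\geq2$: $a_{01}=-2$, $a_{10}=-1$, $a_{n-1,n}=-2$, $a_{n,n-1}=-1$, and $a_{i,i+1}=a_{i+1,i}=-1$ for $1\leq i\leq n-2$. Here the null root is $2\check{\alpha}_0+\cdots+2\check{\alpha}_{n-1}+\check{\alpha}_n$. - $p=2n$ even, $\check{A}=D^{(2)}_{n+1}$, vertices $0,1,\dots,n$. If $n=1$ (where $D^{(2)}_2=A^{(1)}_1$): $a_{01}=a_{10}=-2$. If $n\geq2$: $a_{01}=-2$, $a_{10}=-1$, $a_{n-1,n}=-1$, $a_{n,n-1}=-2$,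 and $a_{i,i+1}=a_{i+1,i}=-1$ for $1\leq i\leq n-2$. Here the null root is $\check{\alpha}_0+\cdots+\check{\alpha}_n$. A $((k+2),(k+1),k,\dots,1)$-avoiding involution of $\ell$ is a permutation $w$ of $\{1,\dots,\ell\}$ with $w^2=\mathrm{id}$ such that there are no $i_1<i_2<\cdots<i_{k+2}$ with $w(i_1)>w(i_2)>\cdots>w(i_{k+2})$. *)

theory Defs
  imports
    "HOL-Combinatorics.Permutations"
    "Jordan_Normal_Form.DL_Rank"
begin

section \<open>Complex Lie algebras and their modules\<close>

locale lie_algebra = vector_space gscale
  for gscale :: "complex \<Rightarrow> 'g::ab_group_add \<Rightarrow> 'g" +
  fixes bracket :: "'g \<Rightarrow> 'g \<Rightarrow> 'g"
  assumes bracket_add_left: "bracket (x + y) z = bracket x z + bracket y z"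
    and bracket_add_right: "bracket x (y + z) = bracket x y + bracket x z"
    and bracket_scale_left: "bracket (gscale c x) y = gscale c (bracket x y)"
    and bracket_scale_right: "bracket x (gscale c y) = gscale c (bracket x y)"
    and bracket_self: "bracket x x = 0"
    and jacobi: "bracket x (bracket y z) + bracket y (bracket z x) + bracket z (bracket x y) = 0"
begin

definition subalgebra :: "'g set \<Rightarrow> bool" where
  "subalgebra L \<longleftrightarrow> subspace L \<and> (\<forall>x\<in>L. \<forall>y\<in>L. bracket x y \<in> L)"

definition lie_ideal :: "'g set \<Rightarrow> bool" where
  "lie_ideal J \<longleftrightarrow> subspace J \<and> (\<forall>x. \<forall>y\<in>J. bracket x y \<in> J)"

end

locale lie_module = lie_algebra gscale bracket + V: vector_space vscale
  for gscale :: "complex \<Rightarrow> 'g::ab_group_add \<Rightarrow> 'g"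
    and bracket :: "'g \<Rightarrow> 'g \<Rightarrow> 'g"
    and vscale :: "complex \<Rightarrow> 'v::ab_group_add \<Rightarrow> 'v" +
  fixes act :: "'g \<Rightarrow> 'v \<Rightarrow> 'v"
  assumes act_add_left: "act (x + y) v = act x v + act y v"
    and act_add_right: "act x (v + w) = act x v + act x w"
    and act_scale_left: "act (gscale c x) v = vscale c (act x v)"
    and act_scale_right: "act x (vscale c v) = vscale c (act x v)"
    and act_bracket: "act (bracket x y) v = act x (act y v) - act y (act x v)"
begin

definition submodule :: "'v set \<Rightarrow> bool" where
  "submodule W \<longleftrightarrow> V.subspace W \<and> (\<forall>x. \<forall>w\<in>W. act x w \<in> W)"

end


section \<open>Kac--Moody algebras\<close>

text \<open>
  The vertices are \<open>0, \<dots>, m - 1\<close>, and \<open>A i j\<close> is the value of the \<open>i\<close>-th simple coroot on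
  the \<open>j\<close>-th simple root. A realization of \<open>A\<close> is a complex vector space \<open>\<hh>\<close> (the type \<open>'h\<close>)
  of dimension \<open>2m - rank A\<close> with linearly independent families of coroots in \<open>\<hh>\<close> and
  roots in \<open>\<hh>\<^sup>*\<close>; elements of \<open>\<hh>\<^sup>*\<close> are the linear functions \<open>'h \<Rightarrow> complex\<close>.
\<close>

definition dual_space :: "(complex \<Rightarrow> 'h::ab_group_add \<Rightarrow> 'h) \<Rightarrow> ('h \<Rightarrow> complex) set" where
  "dual_space hscale = {\<mu>. Vector_Spaces.linear hscale (*) \<mu>}"

locale realization = vector_space hscale
  for hscale :: "complex \<Rightarrow> 'h::ab_group_add \<Rightarrow> 'h" +
  fixes m :: nat and A :: "nat \<Rightarrow> nat \<Rightarrow> int"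
    and coroot :: "nat \<Rightarrow> 'h" and \<alpha> :: "nat \<Rightarrow> 'h \<Rightarrow> complex"
  assumes dim_cartan: "\<exists>B. finite B \<and> independent B \<and> span B = UNIV \<and>
      card B + vec_space.rank m (mat m m (\<lambda>(i, j). complex_of_int (A i j))) = 2 * m"
    and coroot_independent: "inj_on coroot {..<m}" "independent (coroot ` {..<m})"
    and root_linear: "i < m \<Longrightarrow> \<alpha> i \<in> dual_space hscale"
    and root_independent:
      "(\<And>h. (\<Sum>i<m. c i * \<alpha> i h) = 0) \<Longrightarrow> i < m \<Longrightarrow> c i = 0"
    and root_coroot: "i < m \<Longrightarrow> j < m \<Longrightarrow> \<alpha> j (coroot i) = of_int (A i j)"

text \<open>
  Kac's definition of \<open>\<gg>(A)\<close>: the Lie algebra with generators \<open>\<hh>, e\<^sub>i, f\<^sub>i\<close> and the relations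
  \<open>cartan_cartan\<close>, \<open>e_f\<close>, \<open>cartan_e\<close>, \<open>cartan_f\<close>, modulo its largest ideal meeting \<open>\<hh>\<close>
  trivially. That the ideal divided out meets \<open>\<hh>\<close> trivially is \<open>cartan_inj\<close>, that it is the
  largest such ideal is \<open>no_ideal\<close>. This fixes \<open>\<gg>(A)\<close>, with its generators, up to isomorphism.
\<close>

locale kac_moody_algebra =
  R: realization hscale m A coroot \<alpha> + lie_algebra gscale bracket
  for hscale :: "complex \<Rightarrow> 'h::ab_group_add \<Rightarrow> 'h"
    and m :: nat and A :: "nat \<Rightarrow> nat \<Rightarrow> int"
    and coroot :: "nat \<Rightarrow> 'h" and \<alpha> :: "nat \<Rightarrow> 'h \<Rightarrow> complex"
    and gscale :: "complex \<Rightarrow> 'g::ab_group_add \<Rightarrow> 'g"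
    and bracket :: "'g \<Rightarrow> 'g \<Rightarrow> 'g" +
  fixes cartan :: "'h \<Rightarrow> 'g" and e f :: "nat \<Rightarrow> 'g"
  assumes cartan_linear: "Vector_Spaces.linear hscale gscale cartan"
    and cartan_inj: "inj cartan"
    and cartan_cartan: "bracket (cartan h) (cartan h') = 0"
    and e_f: "i < m \<Longrightarrow> j < m \<Longrightarrow>
      bracket (e i) (f j) = (if i = j then cartan (coroot i) else 0)"
    and cartan_e: "i < m \<Longrightarrow> bracket (cartan h) (e i) = gscale (\<alpha> i h) (e i)"
    and cartan_f: "i < m \<Longrightarrow> bracket (cartan h) (f i) = gscale (- \<alpha> i h) (f i)"
    and generated: "subalgebra hull (range cartan \<union> e ` {..<m} \<union> f ` {..<m}) = UNIV"
    and no_ideal: "lie_ideal J \<Longrightarrow> J \<inter> range cartan = {0} \<Longrightarrow> J = {0}"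


section \<open>Irreducible highest weight modules and weights\<close>

text \<open>
  The module \<open>V(\<Lambda>)\<close>, up to isomorphism. It is integrable as soon as \<open>\<Lambda>\<close> is dominant integral.
\<close>

locale irreducible_highest_weight_module =
  kac_moody_algebra hscale m A coroot \<alpha> gscale bracket cartan e f +
  lie_module gscale bracket vscale act
  for hscale :: "complex \<Rightarrow> 'h::ab_group_add \<Rightarrow> 'h"
    and m :: nat and A :: "nat \<Rightarrow> nat \<Rightarrow> int"
    and coroot :: "nat \<Rightarrow> 'h" and \<alpha> :: "nat \<Rightarrow> 'h \<Rightarrow> complex"
    and gscale :: "complex \<Rightarrow> 'g::ab_group_add \<Rightarrow> 'g"
    and bracket :: "'g \<Rightarrow> 'g \<Rightarrow> 'g"
    and cartan :: "'h \<Rightarrow> 'g" and e f :: "nat \<Rightarrow> 'g"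
    and vscale :: "complex \<Rightarrow> 'v::ab_group_add \<Rightarrow> 'v"
    and act :: "'g \<Rightarrow> 'v \<Rightarrow> 'v" +
  fixes \<Lambda> :: "'h \<Rightarrow> complex"
  assumes highest_weight_vector: "\<exists>v. v \<noteq> 0 \<and>
      (\<forall>x \<in> subalgebra hull (e ` {..<m}). act x v = 0) \<and>
      (\<forall>h. act (cartan h) v = vscale (\<Lambda> h) v) \<and>
      submodule hull {v} = UNIV"
    and irreducible: "submodule W \<Longrightarrow> W = {0} \<or> W = UNIV"

definition weight_space ::
    "('h \<Rightarrow> 'g) \<Rightarrow> (complex \<Rightarrow> 'v \<Rightarrow> 'v) \<Rightarrow> ('g \<Rightarrow> 'v \<Rightarrow> 'v) \<Rightarrow> ('h \<Rightarrow> complex) \<Rightarrow> 'v set" where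
  "weight_space cartan vscale act \<mu> = {v. \<forall>h. act (cartan h) v = vscale (\<mu> h) v}"

definition weights ::
    "(complex \<Rightarrow> 'h::ab_group_add \<Rightarrow> 'h) \<Rightarrow> ('h \<Rightarrow> 'g) \<Rightarrow> (complex \<Rightarrow> 'v::ab_group_add \<Rightarrow> 'v) \<Rightarrow>
      ('g \<Rightarrow> 'v \<Rightarrow> 'v) \<Rightarrow> ('h \<Rightarrow> complex) set" where
  "weights hscale cartan vscale act =
    {\<mu> \<in> dual_space hscale. weight_space cartan vscale act \<mu> \<noteq> {0}}"

definition maximal_weights ::
    "(complex \<Rightarrow> 'h::ab_group_add \<Rightarrow> 'h) \<Rightarrow> ('h \<Rightarrow> 'g) \<Rightarrow> (complex \<Rightarrow> 'v::ab_group_add \<Rightarrow> 'v) \<Rightarrow>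
      ('g \<Rightarrow> 'v \<Rightarrow> 'v) \<Rightarrow> ('h \<Rightarrow> complex) \<Rightarrow> ('h \<Rightarrow> complex) set" where
  "maximal_weights hscale cartan vscale act \<delta> =
    {\<mu> \<in> weights hscale cartan vscale act.
      (\<lambda>h. \<mu> h + \<delta> h) \<notin> weights hscale cartan vscale act}"

definition dominant_integral ::
    "(complex \<Rightarrow> 'h::ab_group_add \<Rightarrow> 'h) \<Rightarrow> nat \<Rightarrow> (nat \<Rightarrow> 'h) \<Rightarrow> ('h \<Rightarrow> complex) set" where
  "dominant_integral hscale m coroot =
    {\<mu> \<in> dual_space hscale. \<forall>i<m. \<mu> (coroot i) \<in> \<nat>}"

text \<open>
  If the coroots do not span \<open>\<hh>\<close>, the values on the coroots determine a fundamental weight only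
  up to functionals vanishing on all coroots (in affine type, up to multiples of \<open>\<delta>\<close>); any
  choice is admitted.
\<close>

definition fundamental_weight ::
    "(complex \<Rightarrow> 'h::ab_group_add \<Rightarrow> 'h) \<Rightarrow> nat \<Rightarrow> (nat \<Rightarrow> 'h) \<Rightarrow> nat \<Rightarrow> ('h \<Rightarrow> complex) \<Rightarrow> bool" where
  "fundamental_weight hscale m coroot i \<mu> \<longleftrightarrow>
    \<mu> \<in> dual_space hscale \<and> (\<forall>j<m. \<mu> (coroot j) = (if j = i then 1 else 0))"


section \<open>The affine types \<open>A\<^sup>(\<^sup>2\<^sup>)\<^sub>p\<^sub>-\<^sub>1\<close> (odd \<open>p\<close>) and \<open>D\<^sup>(\<^sup>2\<^sup>)\<^sub>1\<^sub>+\<^sub>p\<^sub>/\<^sub>2\<close> (even \<open>p\<close>)\<close>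

text \<open>
  With \<open>n = p div 2\<close> the vertices are \<open>0, \<dots>, n\<close>.
\<close>

definition check_cartan :: "nat \<Rightarrow> nat \<Rightarrow> nat \<Rightarrow> int" where
  "check_cartan p i j =
    (let n = p div 2 in
      if i = j then 2
      else if n = 1 then
        (if odd p then (if (i, j) = (0, 1) then -4 else if (i, j) = (1, 0) then -1 else 0)
         else (if (i, j) = (0, 1) \<or> (i, j) = (1, 0) then -2 else 0))
      else if (i, j) = (0, 1) then -2
      else if (i, j) = (1, 0) then -1
      else if (i, j) = (n - 1, n) then (if odd p then -2 else -1)
      else if (i, j) = (n, n - 1) then (if odd p then -1 else -2)
      else if j = i + 1 \<or> i = j + 1 then -1
      else 0)"

definition check_null_root :: "nat \<Rightarrow> (nat \<Rightarrow> 'h \<Rightarrow> complex) \<Rightarrow> 'h \<Rightarrow> complex" where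
  "check_null_root p \<alpha> h =
    (\<Sum>i\<le>p div 2. (if odd p \<and> i < p div 2 then 2 else 1) * \<alpha> i h)"


section \<open>Pattern avoiding involutions\<close>

text \<open>
  Involutions of \<open>{1, \<dots>, l}\<close> avoiding the decreasing pattern \<open>r, r - 1, \<dots>, 1\<close>.
\<close>

definition avoiding_involutions :: "nat \<Rightarrow> nat \<Rightarrow> (nat \<Rightarrow> nat) set" where
  "avoiding_involutions r l =
    {w. w permutes {1..l} \<and> w \<circ> w = id \<and>
      \<not> (\<exists>i. i \<in> {1..r} \<rightarrow> {1..l} \<and> strict_mono_on {1..r} i \<and>
            strict_antimono_on {1..r} (\<lambda>a. w (i a)))}"

end

theory Submission
  imports Defs "HOL-Library.Function_Algebras"
begin

text \<open>
  The weight \<open>\<gamma> l\<close> only involves the simple roots at the vertices \<open>0, \<dots>, l - 1\<close>. There the Cartan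
  matrix is that of \<open>B\<^sub>l\<close>, with the short simple root at \<open>0\<close>, and \<open>\<Lambda>\<close> is \<open>m = k + 1\<close> times the weight
  of the spin representation. Part (b) is therefore a statement about the irreducible
  \<open>B\<^sub>l\<close>-module generated by the highest weight vector of the \<open>m\<close>-th tensor power of the spin
  representation.

  \<^emph>\<open>From the abstract module to a concrete one.\<close> A raising word applied to a lowering word of the
  same length gives a multiple of the highest weight vector that is computed from the Cartan
  integers and the highest weight alone (\<open>eword_fword_pairing\<close>). In an irreducible module these
  multiples decide which combinations of lowering words vanish (\<open>fword_relation\<close>); in a module
  with a positive definite form for which lowering and raising operators are adjoint they do so as
  well (\<open>fock_relation\<close>). So the weight space has the dimension of the span of the same words in a
  concrete model of the tensor power: \<open>m\<close> layers of particles on the sites \<open>1, \<dots>, l\<close>, where \<open>f\<^sub>0\<close>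
  creates a particle at site \<open>1\<close> and \<open>f\<^sub>i\<close> moves one from site \<open>i\<close> to site \<open>i + 1\<close>.

  \<^emph>\<open>From words to signs.\<close> In the model that span is also spanned by the products
  \<open>X\<^sub>y\<^sub>1 \<cdots> X\<^sub>y\<^sub>l\<close> of creation operators, the short root vectors, over all arrangements \<open>y\<close> of the
  sites (\<open>span_hop_words_creation_words\<close>). Such a product is a function of the layer \<open>w j\<close> in which
  the particle at site \<open>j\<close> sits, and up to normalization it is the sign in the product
  \<open>e\<^bsub>w y1\<^esub> \<cdots> e\<^bsub>w yl\<^esub>\<close> of Clifford generators \<open>e\<^sub>0, \<dots>, e\<^bsub>m - 1\<^esub>\<close>. What remains is the dimension of the
  space spanned by these \<open>l!\<close> sign functions (\<open>dim_arrangements\<close>).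

  \<^emph>\<open>Upper bound.\<close> Reordering with the Clifford relation writes every product through normal forms
  indexed by involutions: a \<open>2\<close>-cycle is a contracted pair, and the fixed points are multiplied in
  increasing order. If an involution has a decreasing subsequence of length greater than \<open>m\<close>, it
  also has a symmetric one. The antisymmetrized product of the letters of that subsequence vanishes,
  as there are only \<open>m\<close> colours, and the normal form of the involution is the lexicographically
  largest one in the expansion of this relation (\<open>nesting.normal_form_lower\<close>). Hence the avoiding
  involutions suffice.

  \<^emph>\<open>Lower bound.\<close> Viennot's shadow lines send the avoiding involutions injectively to the row words
  of tableaux with at most \<open>m\<close> rows (\<open>row_word_tableau\<close>, \<open>row_word_inj\<close>). For every tableau the product
  of the antisymmetrized columns lies in the span, and evaluation at the row words of the tableaux
  is triangular for the lexicographic order (\<open>tableau_vector\<close>).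

  For part (a), \<open>\<gamma> l\<close> is a weight because the identity is an avoiding involution, \<open>\<gamma> l + \<delta>\<close> is none
  because the coefficient of the last simple root in \<open>\<gamma> l + \<delta> - \<Lambda>\<close> is positive, and dominance is a
  calculation with Cartan integers (\<open>staircase_coroot\<close>).
\<close>

section \<open>Involutions and Viennot's shadow lines\<close>

definition involution_on :: "'a set \<Rightarrow> ('a \<Rightarrow> 'a) \<Rightarrow> bool" where
  "involution_on X \<iota> \<longleftrightarrow> (\<forall>x\<in>X. \<iota> x \<in> X \<and> \<iota> (\<iota> x) = x) \<and> (\<forall>x. x \<notin> X \<longrightarrow> \<iota> x = x)"

definition decreasing_on :: "nat set \<Rightarrow> (nat \<Rightarrow> nat) \<Rightarrow> bool" where
  "decreasing_on D \<iota> \<longleftrightarrow> (\<forall>x\<in>D. \<forall>y\<in>D. x < y \<longrightarrow> \<iota> y < \<iota> x)"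

lemma involution_onD:
  assumes "involution_on X \<iota>"
  shows "x \<in> X \<Longrightarrow> \<iota> x \<in> X" "\<iota> (\<iota> x) = x" "x \<notin> X \<Longrightarrow> \<iota> x = x"
  using assms by (auto simp: involution_on_def)

lemma decreasing_on_insert:
  assumes "decreasing_on E \<iota>" "\<And>x. x \<in> E \<Longrightarrow> x < b \<and> \<iota> b < \<iota> x"
  shows "decreasing_on (insert b E) \<iota>"
  unfolding decreasing_on_def
proof (intro ballI impI)
  fix x y assume "x \<in> insert b E" "y \<in> insert b E" "x < y"
  then show "\<iota> y < \<iota> x" using assms(2)[of x] assms(2)[of y] assms(1)
    by (auto simp: decreasing_on_def)
qed

lemma involution_on_inj: "involution_on X \<iota> \<Longrightarrow> \<iota> x = \<iota> y \<longleftrightarrow> x = y"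
  by (metis involution_onD(2))

text \<open>
  The points \<open>(x, \<iota> x)\<close> of the graph are ordered by \<open>x < y \<and> \<iota> x < \<iota> y\<close>. As the graph of an
  involution is symmetric about the diagonal, so is everything derived from this order. In terms of
  tableaux: the two Robinson--Schensted tableaux of an involution agree.
\<close>

locale finite_involution =
  fixes X :: "nat set" and \<iota> :: "nat \<Rightarrow> nat"
  assumes finite_X: "finite X" and inv: "involution_on X \<iota>"
begin

lemmas inv_in = involution_onD(1)[OF inv]
lemmas inv_inv = involution_onD(2)[OF inv]
lemmas inv_inj = involution_on_inj[OF inv]

text \<open>
  The rank of \<open>x\<close> is the length of the longest increasing chain of points strictly before
  \<open>(x, \<iota> x)\<close>. The points of a given rank form a \<^emph>\<open>shadow line\<close>, along which \<open>\<iota>\<close> decreases.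
\<close>

function rk :: "nat \<Rightarrow> nat" where
  "rk x = Max (insert 0 ((\<lambda>y. Suc (rk y)) ` {y\<in>X. y < x \<and> \<iota> y < \<iota> x}))"
  by auto
termination by (relation "measure id") auto

declare rk.simps [simp del]

lemma rk_less:
  assumes "y \<in> X" "y < x" "\<iota> y < \<iota> x" shows "rk y < rk x"
proof -
  have "Suc (rk y) \<le> rk x"
    using assms finite_X by (subst rk.simps[of x]) (intro Max_ge, auto)
  then show ?thesis by simp
qed

lemma rk_pred:
  assumes "rk x = Suc k"
  shows "\<exists>y\<in>X. y < x \<and> \<iota> y < \<iota> x \<and> rk y = k"
proof -
  have "Max (insert 0 ((\<lambda>y. Suc (rk y)) ` {y\<in>X. y < x \<and> \<iota> y < \<iota> x})) \<in>
      insert 0 ((\<lambda>y. Suc (rk y)) ` {y\<in>X. y < x \<and> \<iota> y < \<iota> x})"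
    using finite_X by (intro Max_in) auto
  then have "rk x \<in> insert 0 ((\<lambda>y. Suc (rk y)) ` {y\<in>X. y < x \<and> \<iota> y < \<iota> x})"
    by (subst (1) rk.simps)
  then show ?thesis using assms by auto
qed

lemma rk_witness:
  "k < rk x \<Longrightarrow> \<exists>y\<in>X. y < x \<and> \<iota> y < \<iota> x \<and> rk y = k"
proof (induction "rk x - k" arbitrary: k)
  case (Suc d)
  show ?case
  proof (cases "rk x = Suc k")
    case True then show ?thesis using rk_pred by blast
  next
    case False
    then have "\<exists>y\<in>X. y < x \<and> \<iota> y < \<iota> x \<and> rk y = Suc k"
      using Suc by (intro Suc.hyps(1)) auto
    then obtain y where y: "y\<in>X" "y < x" "\<iota> y < \<iota> x" "rk y = Suc k" by blast
    obtain z where z: "z\<in>X" "z < y" "\<iota> z < \<iota> y" "rk z = k" using rk_pred[OF y(4)] by blast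
    then have "z < x" "\<iota> z < \<iota> x" using y by simp_all
    then show ?thesis using z by blast
  qed
qed auto

text \<open>
  Reflection about the diagonal maps chains to chains, so it preserves each shadow line.
\<close>

lemma rk_inv: "rk (\<iota> x) = rk x"
proof (induction x rule: less_induct)
  case (less x)
  have "{y\<in>X. y < \<iota> x \<and> \<iota> y < \<iota> (\<iota> x)} = \<iota> ` {z\<in>X. z < x \<and> \<iota> z < \<iota> x}"
  proof (intro Set.set_eqI iffI)
    fix y assume "y \<in> {y\<in>X. y < \<iota> x \<and> \<iota> y < \<iota> (\<iota> x)}"
    then show "y \<in> \<iota> ` {z\<in>X. z < x \<and> \<iota> z < \<iota> x}"
      using inv_in[of y] inv_inv by (intro image_eqI[of _ _ "\<iota> y"]) auto
  qed (use inv_in inv_inv in auto)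
  then have "(\<lambda>y. Suc (rk y)) ` {y\<in>X. y < \<iota> x \<and> \<iota> y < \<iota> (\<iota> x)}
      = (\<lambda>z. Suc (rk (\<iota> z))) ` {z\<in>X. z < x \<and> \<iota> z < \<iota> x}"
    by (simp add: image_image)
  also have "\<dots> = (\<lambda>z. Suc (rk z)) ` {z\<in>X. z < x \<and> \<iota> z < \<iota> x}"
    using less by (intro image_cong) auto
  finally show ?case by (simp add: rk.simps[of "\<iota> x"] rk.simps[of x])
qed

lemma line_decreasing:
  assumes "x \<in> X" "x < y" "rk x = rk y" shows "\<iota> y < \<iota> x"
proof (rule ccontr)
  assume "\<not> \<iota> y < \<iota> x"
  then have "\<iota> x < \<iota> y" using inv_inj[of x y] assms(2) by auto
  then show False using rk_less[OF assms(1,2)] assms(3) by simp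
qed

definition firsts :: "nat set" where
  "firsts = {x\<in>X. \<forall>y\<in>X. y < x \<longrightarrow> rk y \<noteq> rk x}"

abbreviation "rest \<equiv> X - firsts"

definition prev :: "nat \<Rightarrow> nat" where
  "prev x = Max {y\<in>X. y < x \<and> rk y = rk x}"

lemma prev:
  assumes "x \<in> X - firsts"
  shows "prev x \<in> X" "prev x < x" "rk (prev x) = rk x"
    "\<And>y. y \<in> X \<Longrightarrow> y < x \<Longrightarrow> rk y = rk x \<Longrightarrow> y \<le> prev x"
proof -
  have fin: "finite {y\<in>X. y < x \<and> rk y = rk x}" and ne: "{y\<in>X. y < x \<and> rk y = rk x} \<noteq> {}"
    using assms finite_X by (auto simp: firsts_def)
  show "prev x \<in> X" "prev x < x" "rk (prev x) = rk x"
    using Max_in[OF fin ne] unfolding prev_def by auto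
  show "\<And>y. y \<in> X \<Longrightarrow> y < x \<Longrightarrow> rk y = rk x \<Longrightarrow> y \<le> prev x"
    using fin unfolding prev_def by (intro Max_ge) auto
qed

lemma prev_value:
  assumes "x \<in> X - firsts" "z \<in> X" "z < x" "rk z = rk x" shows "\<iota> (prev x) \<le> \<iota> z"
proof -
  have "z \<le> prev x" using prev(4) assms by blast
  then show ?thesis using line_decreasing[of z "prev x"] prev(3)[OF assms(1)] assms
    by (cases "z = prev x") auto
qed

text \<open>
  Viennot's skeleton: its points are the outer corners \<open>(x, \<iota> (prev x))\<close> between consecutive points
  \<open>prev x < x\<close> of a shadow line. A line with \<open>s\<close> points gives \<open>s - 1\<close> corners, and the abscissae
  that get lost are the first points of the lines.
\<close>

definition skel :: "nat \<Rightarrow> nat" where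
  "skel x = (if x \<in> X - firsts then \<iota> (prev x) else x)"

lemma skel_above: "x \<in> X - firsts \<Longrightarrow> \<iota> x < skel x"
  using prev[of x] line_decreasing[of "prev x" x] by (auto simp: skel_def)

text \<open>
  Reflection maps a line to itself and reverses the order of its points, hence maps the corner
  between two consecutive points to the corner between their mirror images.
\<close>

lemma skel_involution: "involution_on (X - firsts) skel"
proof -
  have *: "skel x \<in> X - firsts \<and> skel (skel x) = x" if x: "x \<in> X - firsts" for x
  proof -
    let ?p = "prev x"
    have sk: "skel x = \<iota> ?p" using x by (simp add: skel_def)
    note p = prev[OF x]
    have lt: "\<iota> x < \<iota> ?p" using p line_decreasing[of ?p x] by auto
    have r: "rk (\<iota> x) = rk (\<iota> ?p)" using p by (simp add: rk_inv)
    have nf: "\<iota> ?p \<in> X - firsts"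
      using p(1) x lt r inv_in[of x] inv_in[of ?p] unfolding firsts_def by blast
    note q = prev[OF nf]
    have "prev (\<iota> ?p) = \<iota> x"
    proof (rule ccontr)
      assume ne: "prev (\<iota> ?p) \<noteq> \<iota> x"
      have "\<iota> x \<le> prev (\<iota> ?p)" using q(4)[of "\<iota> x"] lt r x inv_in by auto
      then have "\<iota> x < prev (\<iota> ?p)" using ne by simp
      then have "\<iota> (prev (\<iota> ?p)) < x"
        using line_decreasing[of "\<iota> x" "prev (\<iota> ?p)"] q(3) r x inv_in inv_inv by auto
      moreover have "?p < \<iota> (prev (\<iota> ?p))"
        using line_decreasing[of "prev (\<iota> ?p)" "\<iota> ?p"] q inv_inv by auto
      moreover have "\<iota> (prev (\<iota> ?p)) \<le> ?p"
        using p(4)[of "\<iota> (prev (\<iota> ?p))"] calculation q p inv_in by (auto simp: rk_inv)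
      ultimately show False by simp
    qed
    then show ?thesis using sk nf inv_inv by (simp add: skel_def)
  qed
  show ?thesis unfolding involution_on_def
  proof (intro conjI ballI allI impI)
    fix x assume "x \<notin> X - firsts" then show "skel x = x" by (simp only: skel_def if_False)
  qed (use * in blast)+
qed

text \<open>
  Two corners in decreasing position span a rectangle that contains a point of \<open>\<iota>\<close>. Candidates
  are the lower end of the first corner and the left end of the second one. If both lie outside the
  rectangle, comparing the ranks of the two lines yields a point of one of the lines strictly below
  its own corner, where there is none.
\<close>

lemma skel_rectangle:
  assumes a: "a \<in> X - firsts" and b: "b \<in> X - firsts" and "a < b" "skel b < skel a"
  shows "\<exists>z\<in>X. a \<le> z \<and> z \<le> b \<and> skel b \<le> \<iota> z \<and> \<iota> z \<le> skel a"
proof (rule ccontr)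
  assume none: "\<not> ?thesis"
  have sa: "skel a = \<iota> (prev a)" and sb: "skel b = \<iota> (prev b)" using a b by (auto simp: skel_def)
  have "\<iota> a < skel a" using skel_above a by auto
  then have 1: "\<iota> a < skel b"
    using none a assms(3) by (meson DiffD1 less_imp_le not_le order_refl)
  have 2: "prev b < a"
  proof (rule ccontr)
    assume "\<not> prev b < a"
    then have "prev b\<in>X \<and> a \<le> prev b \<and> prev b \<le> b \<and> skel b \<le> \<iota> (prev b) \<and> \<iota> (prev b) \<le> skel a"
      using prev[OF b] sb assms by auto
    then show False using none by blast
  qed
  note pa = prev[OF a] and pb = prev[OF b]
  consider "rk b < rk a" | "rk a < rk b" | "rk a = rk b" by linarith
  then show False
  proof cases
    case 1
    then obtain z where z: "z\<in>X" "z < a" "\<iota> z < \<iota> a" "rk z = rk b" using rk_witness by blast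
    then have "\<iota> (prev b) \<le> \<iota> z" using prev_value[OF b] assms(3) by auto
    then show False using z \<open>\<iota> a < skel b\<close> sb by simp
  next
    case 2
    then obtain z where z: "z\<in>X" "z < prev b" "\<iota> z < \<iota> (prev b)" "rk z = rk a"
      using rk_witness[of "rk a" "prev b"] pb by auto
    then have "\<iota> (prev a) \<le> \<iota> z" using prev_value[OF a] \<open>prev b < a\<close> by auto
    then show False using z assms(4) sa sb by simp
  next
    case 3
    then have "\<iota> (prev a) \<le> \<iota> (prev b)" using prev_value[OF a, of "prev b"] pb \<open>prev b < a\<close> by auto
    then show False using assms(4) sa sb by simp
  qed
qed

text \<open>
  The points that \<open>skel_rectangle\<close> provides between consecutive corners of a decreasing chain of the
  skeleton form, with one more point at the beginning, a decreasing chain of \<open>\<iota>\<close>. The bounds by the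
  last corner allow one to continue the chain.
\<close>

lemma skel_chain:
  assumes "finite D" "D \<noteq> {}" "D \<subseteq> X - firsts" "decreasing_on D skel"
  shows "\<exists>E\<subseteq>X. card E = card D \<and> decreasing_on E \<iota> \<and>
           (\<forall>x\<in>E. x < Max D \<and> skel (Max D) \<le> \<iota> x)"
  using assms
proof (induction D rule: finite_linorder_max_induct)
  case empty then show ?case by simp
next
  case (insert b A)
  have Mb: "Max (insert b A) = b" using insert.hyps by (intro Max_eqI) auto
  have b: "b \<in> X - firsts" using insert by auto
  have nb: "b \<notin> A" using insert.hyps by auto
  show ?case
  proof (cases "A = {}")
    case True
    have "decreasing_on {prev b} \<iota>" by (simp add: decreasing_on_def)
    moreover have "skel b \<le> \<iota> (prev b)" using b by (simp add: skel_def)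
    ultimately show ?thesis using prev[OF b] True
      by (intro exI[of _ "{prev b}"]) auto
  next
    case False
    let ?a = "Max A"
    have aA: "?a \<in> A" using False insert.hyps by simp
    then have a: "?a \<in> X - firsts" and ab: "?a < b" and lt: "skel b < skel ?a"
      using insert by (auto simp: decreasing_on_def)
    have "decreasing_on A skel" using insert.prems by (auto simp: decreasing_on_def)
    then obtain E where E: "E \<subseteq> X" "card E = card A" "decreasing_on E \<iota>"
      "\<And>x. x \<in> E \<Longrightarrow> x < ?a \<and> skel ?a \<le> \<iota> x"
      using insert.IH[OF False] insert.prems by blast
    obtain z where z: "z \<in> X" "?a \<le> z" "z \<le> b" "skel b \<le> \<iota> z" "\<iota> z \<le> skel ?a"
      using skel_rectangle[OF a b ab lt] by blast
    have zE: "z \<notin> E" using E(4)[of z] z by auto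
    have finE: "finite E" using E(1) finite_X finite_subset by blast
    have "z \<noteq> b" using skel_above[OF b] z by auto
    then have zb: "z < b" using z by simp
    have *: "x < z \<and> \<iota> z < \<iota> x" if "x \<in> E" for x
    proof -
      have "x < z" using E(4)[OF that] z by simp
      moreover have "\<iota> z \<le> \<iota> x" using E(4)[OF that] z by simp
      ultimately show ?thesis using inv_inj[of x z] by auto
    qed
    have "decreasing_on (insert z E) \<iota>" by (rule decreasing_on_insert[OF E(3) *])
    moreover have "card (insert z E) = card (insert b A)"
      using zE finE nb insert.hyps E(2) by simp
    moreover have "x < b \<and> skel b \<le> \<iota> x" if "x \<in> insert z E" for x
      using that z(4) zb E(4)[of x] ab lt by auto
    ultimately show ?thesis
      using E(1) z(1) unfolding Mb by (intro exI[of _ "insert z E"]) blast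
  qed
qed

text \<open>
  Passing to the skeleton shortens the longest decreasing subsequence: the point below the last
  corner prolongs the chain of \<open>skel_chain\<close>.
\<close>

lemma skel_decreasing:
  assumes "D \<subseteq> X - firsts" "decreasing_on D skel" "D \<noteq> {}"
  shows "\<exists>E\<subseteq>X. card E = Suc (card D) \<and> decreasing_on E \<iota>"
proof -
  have fin: "finite D" using assms finite_X by (meson finite_Diff finite_subset)
  obtain E where E: "E\<subseteq>X" "card E = card D" "decreasing_on E \<iota>"
    "\<And>x. x \<in> E \<Longrightarrow> x < Max D \<and> skel (Max D) \<le> \<iota> x"
    using skel_chain[OF fin assms(3,1,2)] by blast
  let ?b = "Max D"
  have b: "?b \<in> X - firsts" using fin assms Max_in by blast
  have finE: "finite E" using E(1) finite_X finite_subset by blast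
  have "decreasing_on (insert ?b E) \<iota>"
    using skel_above[OF b] E(4) by (intro decreasing_on_insert[OF E(3)]) force
  moreover have "?b \<notin> E" using E(4) by blast
  ultimately show ?thesis using E b finE by (intro exI[of _ "insert ?b E"]) auto
qed

text \<open>
  Corners in increasing position lie on different shadow lines, in the same order.
\<close>

lemma skel_increasing_rk:
  assumes x: "x \<in> X - firsts" and y: "y \<in> X - firsts" and "y < x" "skel y < skel x"
  shows "rk y < rk x"
proof (rule ccontr)
  assume "\<not> rk y < rk x"
  then consider "rk x < rk y" | "rk x = rk y" by linarith
  then show False
  proof cases
    case 1
    then obtain z where z: "z\<in>X" "z < prev y" "\<iota> z < \<iota> (prev y)" "rk z = rk x"
      using rk_witness[of "rk x" "prev y"] prev[OF y] by auto
    then have "\<iota> (prev x) \<le> \<iota> z" using prev_value[OF x] prev(2)[OF y] assms(3) by auto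
    then show False using z assms x y by (simp add: skel_def)
  next
    case 2
    then have "\<iota> (prev x) \<le> \<iota> (prev y)"
      using prev_value[OF x, of "prev y"] prev[OF y] assms(3) by auto
    then show False using assms x y by (simp add: skel_def)
  qed
qed

lemma firsts_sub: "firsts \<subseteq> X" by (auto simp: firsts_def)

lemma firsts_of_line:
  assumes "x \<in> X" obtains y where "y \<in> firsts" "y \<le> x" "rk y = rk x"
proof -
  let ?S = "{y\<in>X. y \<le> x \<and> rk y = rk x}"
  have fin: "finite ?S" "?S \<noteq> {}" using finite_X assms by auto
  have "Min ?S \<in> ?S" using Min_in[OF fin] .
  moreover have "Min ?S \<le> y" if "y \<in> ?S" for y using fin that by (intro Min_le)
  moreover have "rk y \<noteq> rk (Min ?S)" if "y \<in> X" "y < Min ?S" for y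
  proof
    assume "rk y = rk (Min ?S)"
    then have "y \<in> ?S" using calculation(1) that by simp
    then have "Min ?S \<le> y" by (rule calculation(2))
    then show False using that by linarith
  qed
  ultimately have "Min ?S \<in> firsts" unfolding firsts_def by blast
  then show ?thesis using that \<open>Min ?S \<in> ?S\<close> by blast
qed

lemma firsts_rk_inj: "inj_on rk firsts"
proof (rule inj_onI)
  fix x y assume "x \<in> firsts" "y \<in> firsts" "rk x = rk y"
  then show "x = y" using linorder_neqE_nat[of x y] by (auto simp: firsts_def)
qed

text \<open>
  When the points are read from left to right, \<open>ends x\<close> consists of the last points at time \<open>x\<close>
  of the shadow lines met so far; their values form the first row of the insertion tableau. A point
  is no longer an end as soon as its value has become the ordinate of a corner.
\<close>

definition ends :: "nat \<Rightarrow> nat set" where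
  "ends x = {e\<in>X. e \<le> x \<and> (\<forall>y\<in>X - firsts. y \<le> x \<longrightarrow> skel y \<noteq> \<iota> e)}"

lemma ends_last:
  assumes e: "e \<in> ends x" and z: "z \<in> X" "rk z = rk e" "z \<le> x" shows "z \<le> e"
proof (rule ccontr)
  assume "\<not> z \<le> e"
  let ?S = "{y\<in>X. e < y \<and> rk y = rk e}"
  have "z \<in> ?S" using z \<open>\<not> z \<le> e\<close> by simp
  then have fin: "finite ?S" "?S \<noteq> {}" using finite_X by (simp, blast)
  let ?n = "Min ?S"
  have n: "?n \<in> ?S" using Min_in[OF fin] .
  have least: "?n \<le> y" if "y \<in> ?S" for y using fin that by (intro Min_le)
  have eX: "e \<in> X" using e by (simp add: ends_def)
  have nf: "?n \<in> X - firsts" using n eX by (auto simp: firsts_def)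
  note p = prev[OF nf]
  have "e \<le> prev ?n" using p(4)[OF eX] n by simp
  moreover have "\<not> e < prev ?n" using least[of "prev ?n"] p(1-3) n by auto
  ultimately have "skel ?n = \<iota> e" using nf by (simp add: skel_def)
  moreover have "?n \<le> x" using least[of z] z \<open>\<not> z \<le> e\<close> by simp
  ultimately show False using e nf by (simp add: ends_def)
qed

lemma ends_self: "x \<in> X \<Longrightarrow> x \<in> ends x"
  unfolding ends_def
proof (intro CollectI conjI ballI impI)
  fix y assume "x \<in> X" and y: "y \<in> rest" "y \<le> x"
  have "prev y \<noteq> x" using prev(2)[OF y(1)] y(2) by auto
  then show "skel y \<noteq> \<iota> x" using y inv_inj by (simp add: skel_def)
qed auto

lemma ends_value_less:
  assumes "e \<in> ends x" "x \<in> X" "rk e < rk x" shows "\<iota> e < \<iota> x"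
proof -
  obtain z where z: "z\<in>X" "z < x" "\<iota> z < \<iota> x" "rk z = rk e" using rk_witness[OF assms(3)] by blast
  then have "z \<le> e" using ends_last[OF assms(1)] by simp
  then have "\<iota> e \<le> \<iota> z" using line_decreasing[of z e] z assms by (cases "z = e") auto
  then show ?thesis using z by simp
qed

text \<open>
  A point that starts a line is inserted at the end of the row of end values. Otherwise, by
  \<open>ends_value_nonfirst\<close>, it bumps \<open>skel x\<close>, the next larger value of the row. Both say how to undo
  an insertion step.
\<close>

lemma ends_value_first:
  assumes "x \<in> firsts" "e \<in> ends x" shows "\<iota> e \<le> \<iota> x"
proof (cases "e = x")
  case False
  have x: "x \<in> X" using assms firsts_sub by blast
  have e: "e \<in> X" "e < x" using assms False by (auto simp: ends_def)
  \<comment> \<open>A line with a point before \<open>x\<close> and rank larger than \<open>rk x\<close> would have a point of rank \<open>rk x\<close> below it, before \<open>x\<close>.\<close>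
  have "rk e < rk x"
  proof (rule ccontr)
    assume "\<not> rk e < rk x"
    moreover have "rk e \<noteq> rk x" using assms(1) e by (simp add: firsts_def)
    ultimately have "rk x < rk e" by simp
    then obtain z where "z\<in>X" "z < e" "rk z = rk x" using rk_witness by blast
    then show False using assms(1) e by (auto simp: firsts_def)
  qed
  then show ?thesis using ends_value_less[OF assms(2) x] by simp
qed simp

lemma ends_value_nonfirst:
  assumes x: "x \<in> X - firsts" and e: "e \<in> ends x" and lt: "\<iota> e < skel x"
  shows "\<iota> e \<le> \<iota> x"
proof (cases "e = x")
  case False
  have eX: "e \<in> X" "e < x" using e False by (auto simp: ends_def)
  consider "rk e < rk x" | "rk e = rk x" | "rk x < rk e" by linarith
  then show ?thesis
  proof cases
    case 1 then show ?thesis using ends_value_less[OF e] x by simp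
  next
    case 2
    then show ?thesis using ends_last[OF e, of x] x eX by simp
  next
    case 3
    then obtain z where z: "z\<in>X" "z < e" "\<iota> z < \<iota> e" "rk z = rk x" using rk_witness by blast
    then have "\<iota> (prev x) \<le> \<iota> z" using prev_value[OF x] eX by simp
    then show ?thesis using z lt x by (simp add: skel_def)
  qed
qed simp

text \<open>
  The end values at time \<open>x\<close> can be read off from the skeleton and from the part of \<open>\<iota>\<close> to the right
  of \<open>x\<close>.
\<close>

lemma ends_values: "\<iota> ` ends x = X - \<iota> ` {z\<in>X. x < z} - skel ` {y\<in>X - firsts. y \<le> x}"
proof (intro Set.set_eqI iffI)
  fix v assume "v \<in> \<iota> ` ends x"
  then show "v \<in> X - \<iota> ` {z\<in>X. x < z} - skel ` {y\<in>X - firsts. y \<le> x}"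
    using inv_in inv_inj by (auto simp: ends_def)
next
  fix v assume v: "v \<in> X - \<iota> ` {z\<in>X. x < z} - skel ` {y\<in>X - firsts. y \<le> x}"
  then have "\<iota> v \<in> ends x" using inv_in[of v] inv_inv[of v] unfolding ends_def
    by (auto simp: image_iff) (metis leI)
  then show "v \<in> \<iota> ` ends x" using inv_inv[of v] by (metis imageI)
qed

end

text \<open>
  Reverse insertion: going from right to left, the value at \<open>x\<close> is the largest end value,
  respectively the largest end value below \<open>skel x\<close>.
\<close>

lemma involution_determined_by_skeleton:
  assumes "finite_involution X \<iota>" "finite_involution X \<iota>'"
    and F: "finite_involution.firsts X \<iota> = finite_involution.firsts X \<iota>'"
    and S: "finite_involution.skel X \<iota> = finite_involution.skel X \<iota>'"
  shows "\<iota> = \<iota>'"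
proof (rule ccontr)
  interpret I: finite_involution X \<iota> by fact
  interpret J: finite_involution X \<iota>' by fact
  assume "\<iota> \<noteq> \<iota>'"
  let ?B = "{x\<in>X. \<iota> x \<noteq> \<iota>' x}"
  have ne: "finite ?B" "?B \<noteq> {}"
    using \<open>\<iota> \<noteq> \<iota>'\<close> I.finite_X involution_onD(3)[OF I.inv] involution_onD(3)[OF J.inv] by (auto simp: fun_eq_iff) metis
  let ?x = "Max ?B"
  have x: "?x \<in> ?B" using Max_in[OF ne] .
  have above: "\<iota> z = \<iota>' z" if "z \<in> X" "?x < z" for z
    using Max_ge[OF ne(1), of z] that by fastforce
  then have V: "\<iota> ` I.ends ?x = \<iota>' ` J.ends ?x"
    unfolding I.ends_values J.ends_values F S by auto
  have 1: "\<iota>' ?x \<in> \<iota> ` I.ends ?x" "\<iota> ?x \<in> \<iota>' ` J.ends ?x"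
    using V x I.ends_self[of ?x] J.ends_self[of ?x] by (metis (mono_tags, lifting) imageI mem_Collect_eq)+
  have "\<iota> ?x = \<iota>' ?x"
  proof (cases "?x \<in> I.firsts")
    case True
    then show ?thesis using 1 I.ends_value_first[of ?x] J.ends_value_first[of ?x] F
      by (intro antisym) auto
  next
    case False
    then have f: "?x \<in> X - I.firsts" "?x \<in> X - J.firsts" using x F by auto
    have "\<iota> ?x < J.skel ?x" "\<iota>' ?x < I.skel ?x"
      using I.skel_above[OF f(1)] J.skel_above[OF f(2)] S by simp_all
    then show ?thesis using 1 I.ends_value_nonfirst[OF f(1)] J.ends_value_nonfirst[OF f(2)]
      by (intro antisym) auto
  qed
  then show False using x by simp
qed

definition short_decreasing :: "nat \<Rightarrow> nat set \<Rightarrow> (nat \<Rightarrow> nat) \<Rightarrow> bool" where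
  "short_decreasing m X \<iota> \<longleftrightarrow> (\<forall>D\<subseteq>X. decreasing_on D \<iota> \<longrightarrow> card D \<le> m)"

context finite_involution begin

lemma finite_involution_skel: "finite_involution rest skel"
  using finite_X skel_involution by unfold_locales auto

interpretation sk: finite_involution rest skel
  by (rule finite_involution_skel)

text \<open>
  In the language of tableaux, an entry of the second row has an entry above it.
\<close>

lemma rk_skel_le: "x \<in> rest \<Longrightarrow> sk.rk x \<le> rk x"
proof (induction x rule: less_induct)
  case (less x)
  show ?case
  proof (cases "sk.rk x")
    case (Suc k)
    then obtain y where y: "y\<in>rest" "y < x" "skel y < skel x" "sk.rk y = k" using sk.rk_pred by blast
    then have "rk y < rk x" using skel_increasing_rk less.prems by blast
    then show ?thesis using less.IH[OF y(2,1)] y Suc by simp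
  qed simp
qed

lemma short_skel:
  assumes "short_decreasing (Suc m) X \<iota>" shows "short_decreasing m rest skel"
  unfolding short_decreasing_def
proof (intro allI impI)
  fix D assume D: "D \<subseteq> rest" "decreasing_on D skel"
  show "card D \<le> m"
  proof (cases "D = {}")
    case False
    then obtain E where "E\<subseteq>X" "card E = Suc (card D)" "decreasing_on E \<iota>"
      using skel_decreasing D by blast
    then show ?thesis using assms by (auto simp: short_decreasing_def)
  qed simp
qed

end

text \<open>
  The abscissae of the first points of the lines form the first row of the tableau, and the skeleton
  yields the remaining rows. An entry of a row gets as its column the number of its line. The first
  argument bounds the number of rows.
\<close>

fun row_word :: "nat \<Rightarrow> nat set \<Rightarrow> (nat \<Rightarrow> nat) \<Rightarrow> nat \<Rightarrow> nat" where
  "row_word 0 X \<iota> x = 0"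
| "row_word (Suc m) X \<iota> x =
    (if x \<in> X - finite_involution.firsts X \<iota>
     then Suc (row_word m (X - finite_involution.firsts X \<iota>) (finite_involution.skel X \<iota>) x) else 0)"

fun column :: "nat \<Rightarrow> nat set \<Rightarrow> (nat \<Rightarrow> nat) \<Rightarrow> nat \<Rightarrow> nat" where
  "column 0 X \<iota> x = 0"
| "column (Suc m) X \<iota> x =
    (if x \<in> X - finite_involution.firsts X \<iota>
     then column m (X - finite_involution.firsts X \<iota>) (finite_involution.skel X \<iota>) x
     else finite_involution.rk X \<iota> x)"

text \<open>
  The entry \<open>x\<close> occupies the cell in row \<open>r x\<close> and column \<open>c x\<close>. As in a standard tableau, the columns
  start in row \<open>0\<close>, have no gaps and increase downwards.
\<close>

definition tableau :: "nat \<Rightarrow> nat set \<Rightarrow> (nat \<Rightarrow> nat) \<Rightarrow> (nat \<Rightarrow> nat) \<Rightarrow> bool" where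
  "tableau m X r c \<longleftrightarrow> (\<forall>x\<in>X. r x < m) \<and> (\<forall>x. x \<notin> X \<longrightarrow> r x = 0) \<and>
     (\<forall>x\<in>X. \<forall>y\<in>X. r x = r y \<and> c x = c y \<longrightarrow> x = y) \<and>
     (\<forall>x\<in>X. \<forall>a. r x = Suc a \<longrightarrow> (\<exists>y\<in>X. y < x \<and> r y = a \<and> c y = c x))"

lemma short_decreasing_0:
  assumes "short_decreasing 0 X \<iota>" shows "X = {}"
proof (rule ccontr)
  assume "X \<noteq> {}"
  then obtain x where "x \<in> X" by blast
  moreover have "decreasing_on {x} \<iota>" by (simp add: decreasing_on_def)
  ultimately show False using assms by (auto simp: short_decreasing_def)
qed

text \<open>
  Each passage to the skeleton shortens the longest decreasing subsequence, so \<open>m\<close> rows suffice. The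
  entry above one in row \<open>1\<close> exists by \<open>rk_skel_le\<close>, and for the other rows by induction.
\<close>

lemma row_word_tableau:
  assumes "finite_involution X \<iota>" "short_decreasing m X \<iota>"
  shows "tableau m X (row_word m X \<iota>) (column m X \<iota>)"
  using assms
proof (induction m arbitrary: X \<iota>)
  case 0
  then have "X = {}" using short_decreasing_0 by blast
  then show ?case by (simp add: tableau_def)
next
  case (Suc m)
  interpret finite_involution X \<iota> by (rule Suc.prems)
  interpret sk: finite_involution rest skel by (rule finite_involution_skel)
  have IH: "tableau m rest (row_word m rest skel) (column m rest skel)"
    using Suc.IH[OF finite_involution_skel short_skel[OF Suc.prems(2)]] .
  let ?r = "row_word (Suc m) X \<iota>" and ?c = "column (Suc m) X \<iota>"
  have 1: "\<forall>x\<in>X. ?r x < Suc m" using IH by (auto simp: tableau_def)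
  have 2: "\<forall>x. x \<notin> X \<longrightarrow> ?r x = 0" by simp
  have 3: "\<forall>x\<in>X. \<forall>y\<in>X. ?r x = ?r y \<and> ?c x = ?c y \<longrightarrow> x = y"
  proof (intro ballI impI, elim conjE)
    fix x y assume xy: "x \<in> X" "y \<in> X" "?r x = ?r y" "?c x = ?c y"
    show "x = y"
    proof (cases "x \<in> firsts")
      case True
      then have "y \<in> firsts" using xy by (auto split: if_splits)
      then show ?thesis using True xy firsts_rk_inj by (auto simp: inj_on_def)
    next
      case False
      then have "y \<notin> firsts" using xy by (auto split: if_splits)
      then show ?thesis using False xy IH by (auto simp: tableau_def)
    qed
  qed
  have 4: "\<exists>y\<in>X. y < x \<and> ?r y = a \<and> ?c y = ?c x" if x: "x \<in> X" "?r x = Suc a" for x a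
  proof -
    have nf: "x \<in> rest" and a: "row_word m rest skel x = a" using x by (auto split: if_splits)
    have cx: "?c x = column m rest skel x" using nf by simp
    show ?thesis
    proof (cases a)
      case (Suc b)
      then obtain y where y: "y\<in>rest" "y < x" "row_word m rest skel y = b" "column m rest skel y = column m rest skel x"
        using IH nf a unfolding tableau_def by blast
      then show ?thesis using cx Suc by (intro bexI[of _ y]) auto
    next
      case 0
      have "m \<noteq> 0"
      proof
        assume "m = 0"
        then have "rest = {}" using short_decreasing_0[of rest skel] short_skel[OF Suc.prems(2)] by blast
        then show False using nf by blast
      qed
      then obtain n where n: "m = Suc n" by (cases m) auto
      then have "x \<in> sk.firsts" using a 0 nf by (auto split: if_splits)
      then have "?c x = sk.rk x" using cx n by simp
      moreover have "sk.rk x \<le> rk x" using rk_skel_le nf .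
      ultimately obtain z where z: "z \<in> X" "z \<le> x" "rk z = ?c x"
        using rk_witness[of "?c x" x] x nf by (cases "sk.rk x = rk x") auto
      then obtain y where y: "y \<in> firsts" "y \<le> z" "rk y = rk z" using firsts_of_line by blast
      then have "y \<noteq> x" using nf by auto
      then show ?thesis using y z 0 firsts_sub by (intro bexI[of _ y]) auto
    qed
  qed
  show ?case unfolding tableau_def using 1 2 3 4 by blast
qed

text \<open>
  The entries in row \<open>0\<close> are the first points of the lines; the other letters, lowered by one, are
  the word of the skeleton. By induction both determine the involution.
\<close>

lemma row_word_inj:
  assumes "finite_involution X \<iota>" "short_decreasing m X \<iota>"
    "finite_involution X \<iota>'" "short_decreasing m X \<iota>'"
    "row_word m X \<iota> = row_word m X \<iota>'"
  shows "\<iota> = \<iota>'"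
  using assms
proof (induction m arbitrary: X \<iota> \<iota>')
  case 0
  then have "X = {}" using short_decreasing_0 by blast
  then show ?case using 0 by (auto simp: finite_involution_def involution_on_def fun_eq_iff)
next
  case (Suc m)
  interpret I: finite_involution X \<iota> by (rule Suc.prems)
  interpret J: finite_involution X \<iota>' by (rule Suc.prems)
  note eq = fun_cong[OF Suc.prems(5)]
  have F: "I.firsts = J.firsts"
  proof (intro Set.set_eqI)
    fix x show "x \<in> I.firsts \<longleftrightarrow> x \<in> J.firsts"
      using eq[of x] I.firsts_sub J.firsts_sub by (auto split: if_splits)
  qed
  have "row_word m I.rest I.skel x = row_word m J.rest J.skel x" for x
  proof (cases "x \<in> I.rest")
    case True then show ?thesis using eq[of x] F by simp
  next
    case False
    then show ?thesis
      using row_word_tableau[OF I.finite_involution_skel I.short_skel[OF Suc.prems(2)]]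
        row_word_tableau[OF J.finite_involution_skel J.short_skel[OF Suc.prems(4)]] F
      by (auto simp: tableau_def)
  qed
  then have "I.skel = J.skel"
    using Suc.IH[OF I.finite_involution_skel I.short_skel[OF Suc.prems(2)], of J.skel]
      J.finite_involution_skel J.short_skel[OF Suc.prems(4)] F by (auto simp: fun_eq_iff)
  then show ?case using involution_determined_by_skeleton[OF Suc.prems(1,3)] F by blast
qed

section \<open>Signs of colour words and contractions\<close>

interpretation fun_space: vector_space "\<lambda>(c::complex) (f::'a \<Rightarrow> complex) x. c * f x"
  by unfold_locales (auto simp: fun_eq_iff algebra_simps)

text \<open>
  The colour sign. For Clifford generators, that is for \<open>e\<^sub>c\<close> with \<open>e\<^sub>c\<^sup>2 = 1\<close> that anticommute for
  different \<open>c\<close>, it occurs when the product of the \<open>e\<^sub>c\<close> over a list of colours is sorted.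
\<close>

fun csgn :: "nat list \<Rightarrow> complex" where
  "csgn [] = 1"
| "csgn (c # cs) = (-1) ^ length (filter (\<lambda>d. d < c) cs) * csgn cs"

lemma csgn_swap: "a \<noteq> b \<Longrightarrow> csgn (as @ a # b # bs) = - csgn (as @ b # a # bs)"
  by (induction as) (auto simp: power_add)

lemma csgn_pair: "csgn (as @ a # a # bs) = csgn (as @ bs)"
  by (induction as) (auto simp flip: power_add simp: mult.assoc[symmetric])

lemma csgn_move:
  "csgn (as @ a # cs @ bs) = (-1) ^ length (filter (\<lambda>c. c \<noteq> a) cs) * csgn (as @ cs @ a # bs)"
proof (induction cs arbitrary: as)
  case (Cons c cs)
  have "csgn (as @ a # (c # cs) @ bs) = (if c = a then 1 else -1) * csgn ((as @ [c]) @ a # cs @ bs)"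
    using csgn_swap[of a c as "cs @ bs"] by auto
  then show ?case by (simp only: Cons.IH) auto
qed simp

lemma csgn_nonzero: "csgn cs \<noteq> 0"
  by (induction cs) auto

text \<open>
  Clifford algebra: the exterior product of \<open>\<omega>\<close> with a vector \<open>v\<close> is
  \<open>(\<omega> v + (-1)\<^bsup>deg \<omega>\<^esup> v \<omega>) / 2\<close>. With basis vectors it is the product if the colours are distinct, and
  \<open>0\<close> otherwise. This recursion antisymmetrizes without a sum over permutations.
\<close>

lemma csgn_wedge:
  "(if distinct (cs @ [c]) then csgn (as @ cs @ c # bs) else 0) =
    ((if distinct cs then csgn (as @ cs @ c # bs) else 0)
      + (-1) ^ length cs * (if distinct cs then csgn (as @ c # cs @ bs) else 0)) / 2"
proof (cases "distinct cs")
  case True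
  show ?thesis
  proof (cases "c \<in> set cs")
    case False
    then have "filter (\<lambda>d. d \<noteq> c) cs = cs" by (auto simp: filter_id_conv)
    then show ?thesis using True False csgn_move[of as c cs bs]
      by (simp flip: power_add)
  next
    case c: True
    have "filter (\<lambda>d. d \<noteq> c) cs = removeAll c cs"
      unfolding removeAll_filter_not_eq by (rule filter_cong) auto
    also have "\<dots> = remove1 c cs" using distinct_remove1_removeAll[OF True] by simp
    finally have "length (filter (\<lambda>d. d \<noteq> c) cs) = length cs - 1"
      using c by (simp add: length_remove1)
    moreover have "length cs \<noteq> 0" using c by auto
    then obtain n where "length cs = Suc n" by (cases "length cs") auto
    ultimately show ?thesis using True c csgn_move[of as c cs bs]
      by (simp flip: power_add)
  qed
qed auto

fun inversions :: "nat list \<Rightarrow> (nat \<times> nat) set" where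
  "inversions [] = {}"
| "inversions (x # xs) = {(x, y) | y. y \<in> set xs \<and> y < x} \<union> inversions xs"

lemma inversions_append: "inversions (xs @ ys) = inversions xs \<union> inversions ys \<union> {(x, y). x \<in> set xs \<and> y \<in> set ys \<and> y < x}"
  by (induction xs) auto

lemma inversionsD: "(x, y) \<in> inversions xs \<Longrightarrow> x \<in> set xs \<and> y \<in> set xs \<and> y < x"
  by (induction xs) auto

lemma finite_inversions: "finite (inversions xs)"
  by (rule finite_subset[of _ "set xs \<times> set xs"]) (auto dest: inversionsD)

lemma sorted_no_inversions: "sorted xs \<longleftrightarrow> inversions xs = {}"
  by (induction xs) (auto simp: not_less)

lemma not_sorted_descent:
  "\<not> sorted xs \<Longrightarrow> \<exists>as i j bs. xs = as @ i # j # bs \<and> (j::nat) < i"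
proof (induction xs)
  case (Cons x xs)
  show ?case
  proof (cases "sorted xs")
    case False
    then obtain as i j bs where "xs = as @ i # j # bs" "j < i" using Cons by blast
    then show ?thesis by (intro exI[of _ "x # as"]) auto
  next
    case True
    then obtain y ys where "xs = y # ys" "y < x" using Cons.prems
      by (cases xs) (auto simp: not_le)
    then show ?thesis by (intro exI[of _ "[]"]) auto
  qed
qed simp

text \<open>
  A function of the colouring \<open>w\<close> of the sites. The \<open>2\<close>-cycles of \<open>\<kappa>\<close> are contracted pairs, which
  contribute the factor \<open>1\<close> if both sites have the same colour and \<open>0\<close> otherwise; the sites in \<open>ys\<close>
  are multiplied in the given order.
\<close>

definition contraction :: "nat \<Rightarrow> nat set \<Rightarrow> (nat \<Rightarrow> nat) \<Rightarrow> nat list \<Rightarrow> (nat \<Rightarrow> nat) \<Rightarrow> complex" where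
  "contraction m X \<kappa> ys = (\<lambda>w. if (\<forall>x. w x < m) \<and> (\<forall>x\<in>X. w (\<kappa> x) = w x) then csgn (map w ys) else 0)"

abbreviation fixed_points :: "nat set \<Rightarrow> (nat \<Rightarrow> nat) \<Rightarrow> nat set" where
  "fixed_points X \<kappa> \<equiv> {x\<in>X. \<kappa> x = x}"

definition normal_form :: "nat \<Rightarrow> nat set \<Rightarrow> (nat \<Rightarrow> nat) \<Rightarrow> (nat \<Rightarrow> nat) \<Rightarrow> complex" where
  "normal_form m X \<kappa> = contraction m X \<kappa> (sorted_list_of_set (fixed_points X \<kappa>))"

text \<open>
  The Clifford relation \<open>e\<^sub>a e\<^sub>b = - e\<^sub>b e\<^sub>a + 2 \<delta>\<^sub>a\<^sub>b\<close>.
\<close>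

lemma contraction_swap:
  assumes "i \<in> X" "j \<in> X" "i \<noteq> j" "\<kappa> i = i" "\<kappa> j = j" "involution_on X \<kappa>"
  shows "contraction m X \<kappa> (as @ i # j # bs) =
    (\<lambda>w. (-1) * contraction m X \<kappa> (as @ j # i # bs) w)
     + (\<lambda>w. 2 * contraction m X (\<kappa>(i := j, j := i)) (as @ bs) w)"
proof
  fix w :: "nat \<Rightarrow> nat"
  have *: "(\<forall>x\<in>X. w ((\<kappa>(i := j, j := i)) x) = w x) \<longleftrightarrow> (\<forall>x\<in>X. w (\<kappa> x) = w x) \<and> w i = w j"
  proof
    assume L: "\<forall>x\<in>X. w ((\<kappa>(i := j, j := i)) x) = w x"
    have "w i = w j" using bspec[OF L assms(2)] by simp
    moreover have "w (\<kappa> x) = w x" if "x \<in> X" for x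
      using bspec[OF L that] assms by (cases "x = i \<or> x = j") auto
    ultimately show "(\<forall>x\<in>X. w (\<kappa> x) = w x) \<and> w i = w j" by blast
  qed auto
  show "contraction m X \<kappa> (as @ i # j # bs) w = ((\<lambda>w. (-1) * contraction m X \<kappa> (as @ j # i # bs) w)
     + (\<lambda>w. 2 * contraction m X (\<kappa>(i := j, j := i)) (as @ bs) w)) w"
  proof (cases "(\<forall>x. w x < m) \<and> (\<forall>x\<in>X. w (\<kappa> x) = w x)")
    case True
    then show ?thesis
      using csgn_swap[of "w i" "w j" "map w as" "map w bs"] csgn_pair[of "map w as" "w i" "map w bs"]
      unfolding contraction_def * plus_fun_apply by (cases "w i = w j") simp_all
  next
    case False
    then show ?thesis unfolding contraction_def * plus_fun_apply by auto
  qed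
qed

lemma involution_on_link:
  assumes "i \<in> X" "j \<in> X" "\<kappa> i = i" "\<kappa> j = j" "involution_on X \<kappa>"
  shows "involution_on X (\<kappa>(i := j, j := i))"
proof -
  have "\<kappa> x \<noteq> i \<and> \<kappa> x \<noteq> j" if "x \<noteq> i" "x \<noteq> j" for x
    using that assms involution_on_inj[OF assms(5)] by metis
  then show ?thesis using assms unfolding involution_on_def by auto
qed

text \<open>
  Only inverted pairs can be contracted while \<open>ys\<close> is being sorted.
\<close>

definition extensions :: "nat set \<Rightarrow> (nat \<Rightarrow> nat) \<Rightarrow> nat list \<Rightarrow> (nat \<Rightarrow> nat) set" where
  "extensions X \<kappa> ys = {\<kappa>'. involution_on X \<kappa>' \<and>
     (\<forall>x\<in>X. \<kappa>' x \<noteq> \<kappa> x \<longrightarrow> (x, \<kappa>' x) \<in> inversions ys \<or> (\<kappa>' x, x) \<in> inversions ys)}"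

text \<open>
  Each step of bubble sort replaces a product by one with fewer inversions and by one with an
  additional contracted pair, which was an inversion.
\<close>

lemma contraction_normal_form:
  assumes "finite X" "involution_on X \<kappa>" "distinct ys" "set ys = fixed_points X \<kappa>"
  shows "contraction m X \<kappa> ys \<in> fun_space.span (normal_form m X ` extensions X \<kappa> ys)"
  using assms
proof (induction "card (inversions ys)" arbitrary: ys \<kappa> rule: less_induct)
  case less
  show ?case
  proof (cases "sorted ys")
    case True
    have "ys = sorted_list_of_set (set ys)"
      using True less.prems(3) by (simp add: sorted_list_of_set.idem_if_sorted_distinct)
    then have "contraction m X \<kappa> ys = normal_form m X \<kappa>" using less.prems(4) by (simp add: normal_form_def)
    moreover have "\<kappa> \<in> extensions X \<kappa> ys" using less.prems(2) by (simp add: extensions_def)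
    ultimately show ?thesis by (simp add: fun_space.span_base)
  next
    case False
    then obtain as i j bs where ys: "ys = as @ i # j # bs" and ji: "j < i"
      using not_sorted_descent by blast
    have ij: "i \<in> X" "j \<in> X" "\<kappa> i = i" "\<kappa> j = j" "i \<noteq> j" using less.prems(4) ys ji by auto
    let ?ys1 = "as @ j # i # bs" and ?ys2 = "as @ bs" and ?k = "\<kappa>(i := j, j := i)"
    have s1: "inversions ys = insert (i, j) (inversions ?ys1)" and n1: "(i, j) \<notin> inversions ?ys1"
      using ji less.prems(3) unfolding ys inversions_append by (auto dest: inversionsD)
    have s2: "insert (i, j) (inversions ?ys2) \<subseteq> inversions ys" and n2: "(i, j) \<notin> inversions ?ys2"
      using ji less.prems(3) unfolding ys inversions_append by (auto dest: inversionsD)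
    have c1: "card (inversions ?ys1) < card (inversions ys)" using s1 n1 finite_inversions by simp
    have "card (insert (i, j) (inversions ?ys2)) \<le> card (inversions ys)"
      using s2 by (rule card_mono[OF finite_inversions])
    then have c2: "card (inversions ?ys2) < card (inversions ys)" using n2 finite_inversions by simp
    have k: "involution_on X ?k" by (rule involution_on_link[OF ij(1-4) less.prems(2)])
    have 1: "contraction m X \<kappa> ?ys1 \<in> fun_space.span (normal_form m X ` extensions X \<kappa> ?ys1)"
      using less.prems ys by (intro less.hyps[OF c1]) auto
    have "set ?ys2 = fixed_points X ?k" using less.prems(3,4) ys ij by auto
    then have 2: "contraction m X ?k ?ys2 \<in> fun_space.span (normal_form m X ` extensions X ?k ?ys2)"
      using less.prems ys by (intro less.hyps[OF c2 _ k]) auto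
    have e1: "extensions X \<kappa> ?ys1 \<subseteq> extensions X \<kappa> ys" using s1 by (auto simp: extensions_def)
    have e2: "extensions X ?k ?ys2 \<subseteq> extensions X \<kappa> ys"
    proof
      fix \<kappa>' assume a: "\<kappa>' \<in> extensions X ?k ?ys2"
      have "(x, \<kappa>' x) \<in> inversions ys \<or> (\<kappa>' x, x) \<in> inversions ys" if "x \<in> X" "\<kappa>' x \<noteq> \<kappa> x" for x
      proof (cases "\<kappa>' x = ?k x")
        case True
        then have "(x, \<kappa>' x) = (i, j) \<or> (\<kappa>' x, x) = (i, j)" using that(2) by (auto split: if_splits)
        then show ?thesis using s1 by auto
      next
        case False
        then show ?thesis using a that(1) s2 by (auto simp: extensions_def)
      qed
      then show "\<kappa>' \<in> extensions X \<kappa> ys" using a by (simp add: extensions_def)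
    qed
    have "contraction m X \<kappa> ?ys1 \<in> fun_space.span (normal_form m X ` extensions X \<kappa> ys)"
      using 1 fun_space.span_mono[OF image_mono[OF e1]] by blast
    moreover have "contraction m X ?k ?ys2 \<in> fun_space.span (normal_form m X ` extensions X \<kappa> ys)"
      using 2 fun_space.span_mono[OF image_mono[OF e2]] by blast
    ultimately show ?thesis
      unfolding ys contraction_swap[OF ij(1,2,5,3,4) less.prems(2)]
      by (intro fun_space.span_add fun_space.span_scale) (simp_all only: ys)
  qed
qed

definition lexless :: "(nat \<Rightarrow> nat) \<Rightarrow> (nat \<Rightarrow> nat) \<Rightarrow> bool" where
  "lexless f g \<longleftrightarrow> (\<exists>x. (\<forall>y<x. f y = g y) \<and> f x < g x)"

section \<open>Upper bound: reduction of nested arcs\<close>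

text \<open>
  A set \<open>I\<close> stable under \<open>\<iota>\<close> on which \<open>\<iota>\<close> is decreasing consists of nested arcs, with at most one
  fixed point in the centre of the nest. More than \<open>m\<close> sites cannot have distinct colours, so the
  antisymmetrized product over \<open>I\<close> vanishes. Expanded with the right order of the factors, this
  relation expresses the normal form of \<open>\<iota>\<close> through normal forms of lexicographically smaller
  involutions.
\<close>

locale nesting =
  fixes m :: nat and X I :: "nat set" and \<iota> :: "nat \<Rightarrow> nat"
  assumes finite_X: "finite X" and inv: "involution_on X \<iota>" and I_sub: "I \<subseteq> X"
    and I_closed: "\<And>x. x \<in> I \<Longrightarrow> \<iota> x \<in> I" and I_decreasing: "decreasing_on I \<iota>"
    and I_large: "m < card I"
begin

lemmas inv_inv = involution_onD(2)[OF inv]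
lemmas inv_inj = involution_on_inj[OF inv]

text \<open>
  The last opening site of \<open>I\<close>, or the fixed point in its centre.
\<close>

definition mid :: nat where "mid = Max {x\<in>I. x \<le> \<iota> x}"

lemma finite_I: "finite I" using finite_X I_sub finite_subset by blast

lemma antitone: "x \<in> I \<Longrightarrow> y \<in> I \<Longrightarrow> x < y \<Longrightarrow> \<iota> y < \<iota> x"
  using I_decreasing by (auto simp: decreasing_on_def)

lemma mid: "mid \<in> I" "mid \<le> \<iota> mid" "\<And>x. x \<in> I \<Longrightarrow> x \<le> \<iota> x \<Longrightarrow> x \<le> mid"
proof -
  have "I \<noteq> {}" using I_large by auto
  then obtain x where x: "x \<in> I" by blast
  have "x \<le> \<iota> x \<or> \<iota> x \<le> \<iota> (\<iota> x)" using inv_inv by auto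
  then have ne: "{x\<in>I. x \<le> \<iota> x} \<noteq> {}" using x I_closed by blast
  have fin: "finite {x\<in>I. x \<le> \<iota> x}" using finite_I by simp
  show "mid \<in> I" "mid \<le> \<iota> mid" using Max_in[OF fin ne] by (auto simp: mid_def)
  show "\<And>x. x \<in> I \<Longrightarrow> x \<le> \<iota> x \<Longrightarrow> x \<le> mid" using fin by (auto simp: mid_def)
qed

lemma mid_less:
  assumes "x \<in> I" "\<iota> x < x" shows "mid < x" "\<iota> x \<le> mid"
proof -
  show "\<iota> x \<le> mid" using mid(3)[of "\<iota> x"] I_closed assms inv_inv by auto
  show "mid < x"
  proof (rule ccontr)
    assume "\<not> mid < x"
    then have "x = mid \<or> x < mid" by auto
    then show False using antitone[OF assms(1) mid(1)] mid(2) assms(2) by auto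
  qed
qed

definition others :: "nat set" where "others = {x\<in>X. x \<notin> I \<and> \<iota> x = x}"
text \<open>
  The fixed points outside \<open>I\<close> are multiplied to the left or to the right of the letters of \<open>I\<close>,
  according to their position. So a fixed point can only be contracted with a site of \<open>I\<close> on the far
  side of it, seen from the centre, and never reaches across the centre.
\<close>

definition left :: "nat list" where "left = sorted_list_of_set {x\<in>others. x < mid}"
definition right :: "nat list" where "right = sorted_list_of_set {x\<in>others. mid < x}"

lemma set_left: "set left = {x\<in>others. x < mid}" and set_right: "set right = {x\<in>others. mid < x}"
  and distinct_left: "distinct left" and distinct_right: "distinct right"
  and sorted_left: "sorted left" and sorted_right: "sorted right"
  using finite_X by (auto simp: left_def right_def others_def)

lemma others_sides: "x \<in> others \<Longrightarrow> x < mid \<or> mid < x"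
  using mid(1) by (cases x mid rule: linorder_cases) (auto simp: others_def)

text \<open>
  At the first site where \<open>\<kappa>\<close> and \<open>\<iota>\<close> differ, all outer arcs of the nest are still intact. So this
  site opens an arc of the nest, and the sites available to \<open>\<kappa>\<close> lie before the closing site
  of that arc.
\<close>

lemma lexless_if_broken:
  assumes k: "involution_on X \<kappa>"
    and outside: "\<And>x. x \<in> X \<Longrightarrow> x \<notin> I \<Longrightarrow> x \<notin> others \<Longrightarrow> \<kappa> x = \<iota> x"
    and oth: "\<And>x. x \<in> others \<Longrightarrow> \<kappa> x = x \<or> \<kappa> x \<in> I \<and> (x < mid \<longrightarrow> \<kappa> x < x) \<and> (mid < x \<longrightarrow> x < \<kappa> x)"
    and inside: "\<And>x. x \<in> I \<Longrightarrow> \<kappa> x \<in> I \<union> others"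
    and broken: "\<kappa> z \<noteq> \<iota> z"
  shows "lexless \<kappa> \<iota>"
proof -
  define x where "x = (LEAST x. \<kappa> x \<noteq> \<iota> x)"
  have x: "\<kappa> x \<noteq> \<iota> x" unfolding x_def using broken by (rule LeastI)
  have before: "\<kappa> y = \<iota> y" if "y < x" for y using not_less_Least that unfolding x_def by blast
  note kk = involution_onD(2)[OF k]
  have xX: "x \<in> X" using x involution_onD(3)[OF k] involution_onD(3)[OF inv] by metis
  have "\<iota> x \<ge> x"
  proof (rule ccontr)
    assume "\<not> \<iota> x \<ge> x"
    then have "\<kappa> (\<iota> x) = x" using before[of "\<iota> x"] inv_inv by simp
    then show False using kk[of "\<iota> x"] x by simp
  qed
  have kx: "\<kappa> x \<ge> x"
  proof (rule ccontr)
    assume "\<not> \<kappa> x \<ge> x"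
    then have "\<iota> (\<kappa> x) = x" using before[of "\<kappa> x"] kk by simp
    then show False using inv_inv[of "\<kappa> x"] x by simp
  qed
  have "\<kappa> x < \<iota> x"
  proof (cases "x \<in> I")
    case False
    then have xo: "x \<in> others" using outside xX x by blast
    then have "\<iota> x = x" by (simp add: others_def)
    then have kI: "\<kappa> x \<in> I" "mid < x" "x < \<kappa> x"
      using oth[OF xo] others_sides[OF xo] x kx by auto
    then have "\<iota> (\<kappa> x) < \<kappa> x" using mid(3)[of "\<kappa> x"] by fastforce
    then have "\<iota> (\<kappa> x) < x" using mid_less(2)[OF kI(1)] kI by simp
    then have "\<kappa> (\<iota> (\<kappa> x)) = \<kappa> x" using before inv_inv by simp
    then have "\<iota> (\<kappa> x) = x" using involution_on_inj[OF k] by simp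
    then show ?thesis using \<open>\<iota> (\<kappa> x) < x\<close> by simp
  next
    case True
    have xm: "x \<le> mid" using mid(3)[OF True] \<open>\<iota> x \<ge> x\<close> .
    show ?thesis
    proof (cases "\<kappa> x \<in> I")
      case kI: True
      show ?thesis
      proof (rule ccontr)
        assume "\<not> \<kappa> x < \<iota> x"
        then have "\<iota> x < \<kappa> x" using x by simp
        then have "\<iota> (\<kappa> x) < x" using antitone[OF I_closed[OF True] kI] inv_inv by simp
        then have "\<kappa> (\<iota> (\<kappa> x)) = \<kappa> x" using before inv_inv by simp
        then have "\<iota> (\<kappa> x) = x" using involution_on_inj[OF k] by simp
        then show False using \<open>\<iota> (\<kappa> x) < x\<close> by simp
      qed
    next
      case False
      then have ko: "\<kappa> x \<in> others" using inside[OF True] by blast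
      have "\<kappa> (\<kappa> x) \<noteq> \<kappa> x" using False True kk by metis
      then have "\<kappa> x < mid"
        using oth[OF ko] others_sides[OF ko] kk[of x] xm by auto
      moreover have "mid \<le> \<iota> x"
        using antitone[OF True mid(1)] xm mid(2) by (cases "x = mid") auto
      ultimately show ?thesis by simp
    qed
  qed
  then show ?thesis unfolding lexless_def using before by blast
qed

definition lower :: "((nat \<Rightarrow> nat) \<Rightarrow> complex) set" where
  "lower = fun_space.span (normal_form m X ` {\<kappa>. involution_on X \<kappa> \<and> lexless \<kappa> \<iota>})"

text \<open>
  The involutions that occur while the product over \<open>I\<close> is being expanded: the arcs of \<open>\<iota>\<close> outside
  \<open>I\<close> are always contracted.
\<close>

definition agrees_outside :: "(nat \<Rightarrow> nat) \<Rightarrow> bool" where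
  "agrees_outside \<kappa> \<longleftrightarrow> involution_on X \<kappa> \<and> (\<forall>x\<in>X - I. \<kappa> x = \<iota> x)"

definition flanked :: "(nat \<Rightarrow> nat) \<Rightarrow> nat list \<Rightarrow> (nat \<Rightarrow> nat) \<Rightarrow> complex" where
  "flanked \<kappa> ys = contraction m X \<kappa> (left @ ys @ right)"

lemma agrees_outside_closed: "agrees_outside \<kappa> \<Longrightarrow> x \<in> I \<Longrightarrow> \<kappa> x \<in> I"
proof (rule ccontr)
  assume k: "agrees_outside \<kappa>" and x: "x \<in> I" and n: "\<kappa> x \<notin> I"
  have i: "involution_on X \<kappa>" using k by (simp add: agrees_outside_def)
  have "\<kappa> x \<in> X" using involution_onD(1)[OF i] x I_sub by blast
  then have "\<kappa> (\<kappa> x) = \<iota> (\<kappa> x)" using k n by (simp add: agrees_outside_def)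
  then have "\<iota> x = \<kappa> x" using involution_onD(2)[OF i, of x] inv_inv by metis
  then show False using n I_closed[OF x] by simp
qed

text \<open>
  If for some arc of the nest the closing site does not precede the opening site in \<open>ys\<close>, sorting
  \<open>ys\<close> cannot contract this arc, and only smaller involutions arise.
\<close>

lemma flanked_lower:
  assumes k: "agrees_outside \<kappa>" and ys: "distinct ys" "set ys = fixed_points I \<kappa>"
    and z: "z \<in> I" "z < \<iota> z" "\<kappa> z \<noteq> \<iota> z" "(\<iota> z, z) \<notin> inversions ys"
  shows "flanked \<kappa> ys \<in> lower"
proof -
  let ?ys = "left @ ys @ right"
  have i: "involution_on X \<kappa>" and ki: "\<And>x. x \<in> X \<Longrightarrow> x \<notin> I \<Longrightarrow> \<kappa> x = \<iota> x"
    using k by (auto simp: agrees_outside_def)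
  have oI: "others \<inter> I = {}" by (auto simp: others_def)
  have d: "distinct ?ys"
    using ys oI distinct_left distinct_right set_left set_right by auto
  have fp: "set ?ys = fixed_points X \<kappa>"
  proof -
    have "set left \<union> set right = others" using set_left set_right others_sides by blast
    moreover have "fixed_points X \<kappa> = others \<union> fixed_points I \<kappa>"
      using ki I_sub by (auto simp: others_def)
    ultimately show ?thesis using ys(2) by auto
  qed
  have "extensions X \<kappa> ?ys \<subseteq> {\<kappa>. involution_on X \<kappa> \<and> lexless \<kappa> \<iota>}"
  proof
    fix \<kappa>' assume e: "\<kappa>' \<in> extensions X \<kappa> ?ys"
    have i': "involution_on X \<kappa>'" using e by (simp add: extensions_def)
    have e': "(x, \<kappa>' x) \<in> inversions ?ys \<or> (\<kappa>' x, x) \<in> inversions ?ys" if "\<kappa>' x \<noteq> \<kappa> x" "x \<in> X" for x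
      using e that by (simp add: extensions_def)
    have arcs: "a \<in> I \<and> b \<in> I \<and> (a, b) \<in> inversions ys \<or> a \<in> others \<and> a < mid \<and> b \<in> I \<or> b \<in> others \<and> mid < b \<and> a \<in> I"
      if "(a, b) \<in> inversions ?ys" for a b
    proof -
      have "b < a" using inversionsD that by blast
      moreover have "inversions left = {}" "inversions right = {}"
        using sorted_left sorted_right sorted_no_inversions by blast+
      ultimately have "(a, b) \<in> inversions ys \<or> a \<in> set ys \<and> b \<in> set right \<or> a \<in> set left \<and> b \<in> set ys
          \<or> a \<in> set left \<and> b \<in> set right"
        using that unfolding inversions_append by auto
      moreover have "x \<in> I" if "x \<in> set ys" for x using that ys(2) by blast
      moreover have "\<not> (a \<in> set left \<and> b \<in> set right)" using set_left set_right \<open>b < a\<close> by auto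
      ultimately show ?thesis using set_left set_right inversionsD by blast
    qed
    have "lexless \<kappa>' \<iota>"
    proof (rule lexless_if_broken[OF i'])
      fix x assume x: "x \<in> X" "x \<notin> I" "x \<notin> others"
      show "\<kappa>' x = \<iota> x"
      proof (rule ccontr)
        assume "\<kappa>' x \<noteq> \<iota> x"
        then have "(x, \<kappa>' x) \<in> inversions ?ys \<or> (\<kappa>' x, x) \<in> inversions ?ys" using e' x ki by simp
        then show False using arcs x by blast
      qed
    next
      fix x assume x: "x \<in> others"
      then have xX: "x \<in> X" "x \<notin> I" "\<iota> x = x" by (auto simp: others_def)
      show "\<kappa>' x = x \<or> \<kappa>' x \<in> I \<and> (x < mid \<longrightarrow> \<kappa>' x < x) \<and> (mid < x \<longrightarrow> x < \<kappa>' x)"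
      proof (cases "\<kappa>' x = x")
        case False
        then have "(x, \<kappa>' x) \<in> inversions ?ys \<or> (\<kappa>' x, x) \<in> inversions ?ys" using e'[of x] ki xX by simp
        then show ?thesis
        proof
          assume a: "(x, \<kappa>' x) \<in> inversions ?ys"
          have "x < mid \<and> \<kappa>' x \<in> I" using arcs[OF a] xX by blast
          moreover have "\<kappa>' x < x" using inversionsD[OF a] by blast
          ultimately show ?thesis by auto
        next
          assume a: "(\<kappa>' x, x) \<in> inversions ?ys"
          have "mid < x \<and> \<kappa>' x \<in> I" using arcs[OF a] xX by blast
          moreover have "x < \<kappa>' x" using inversionsD[OF a] by blast
          ultimately show ?thesis by auto
        qed
      qed simp
    next
      fix x assume x: "x \<in> I"
      show "\<kappa>' x \<in> I \<union> others"
      proof (cases "\<kappa>' x = \<kappa> x")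
        case True then show ?thesis using agrees_outside_closed[OF k x] by simp
      next
        case False
        then have "(x, \<kappa>' x) \<in> inversions ?ys \<or> (\<kappa>' x, x) \<in> inversions ?ys" using e'[of x] x I_sub by blast
        then show ?thesis using arcs by blast
      qed
    next
      show "\<kappa>' z \<noteq> \<iota> z"
      proof
        assume eq: "\<kappa>' z = \<iota> z"
        then have "(z, \<iota> z) \<in> inversions ?ys \<or> (\<iota> z, z) \<in> inversions ?ys" using e'[of z] z I_sub by auto
        then have "(\<iota> z, z) \<in> inversions ?ys" using inversionsD z(2) by (meson less_asym)
        then show False using arcs[of "\<iota> z" z] z oI I_closed[OF z(1)] by blast
      qed
    qed
    then show "\<kappa>' \<in> {\<kappa>. involution_on X \<kappa> \<and> lexless \<kappa> \<iota>}" using i' by simp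
  qed
  then have "fun_space.span (normal_form m X ` extensions X \<kappa> ?ys) \<subseteq> lower"
    unfolding lower_def by (intro fun_space.span_mono image_mono)
  then show ?thesis unfolding flanked_def using contraction_normal_form[OF finite_X i d fp] by blast
qed

lemma lower_add: "f \<in> lower \<Longrightarrow> g \<in> lower \<Longrightarrow> f + g \<in> lower"
  and lower_scale: "f \<in> lower \<Longrightarrow> (\<lambda>w. c * f w) \<in> lower"
  unfolding lower_def by (rule fun_space.span_add, assumption+) (rule fun_space.span_scale)

text \<open>
  Equality up to the factor \<open>c\<close> modulo smaller involutions.
\<close>

definition cong_lower :: "((nat \<Rightarrow> nat) \<Rightarrow> complex) \<Rightarrow> complex \<Rightarrow> ((nat \<Rightarrow> nat) \<Rightarrow> complex) \<Rightarrow> bool" where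
  "cong_lower f c g \<longleftrightarrow> f - (\<lambda>w. c * g w) \<in> lower"

lemma cong_lower_refl: "cong_lower f 1 f"
proof -
  have "f - (\<lambda>w. 1 * f w) = 0" by (simp add: fun_eq_iff)
  then show ?thesis unfolding cong_lower_def lower_def by (simp only: fun_space.span_zero)
qed

lemma cong_lower_trans: "cong_lower f c g \<Longrightarrow> cong_lower g d h \<Longrightarrow> cong_lower f (c * d) h"
proof -
  assume 1: "cong_lower f c g" and 2: "cong_lower g d h"
  have eq: "f - (\<lambda>w. (c * d) * h w) = (f - (\<lambda>w. c * g w)) + (\<lambda>w. c * (g - (\<lambda>w. d * h w)) w)"
    by (rule ext) (simp add: right_diff_distrib)
  have "(\<lambda>w. c * (g - (\<lambda>w. d * h w)) w) \<in> lower"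
    using 2 unfolding cong_lower_def by (rule lower_scale)
  then show ?thesis unfolding cong_lower_def eq by (rule lower_add[OF 1[unfolded cong_lower_def]])
qed

lemma cong_lower_combine:
  assumes "cong_lower f c h" "cong_lower g d h"
  shows "cong_lower (\<lambda>w. a * f w + b * g w) (a * c + b * d) h"
proof -
  have "(\<lambda>w. a * f w + b * g w) - (\<lambda>w. (a * c + b * d) * h w) =
    (\<lambda>w. a * (f - (\<lambda>w. c * h w)) w) + (\<lambda>w. b * (g - (\<lambda>w. d * h w)) w)"
    by (simp add: fun_eq_iff algebra_simps)
  moreover have "(\<lambda>w. a * (f - (\<lambda>w. c * h w)) w) \<in> lower"
    using assms(1) unfolding cong_lower_def by (rule lower_scale)
  moreover have "(\<lambda>w. b * (g - (\<lambda>w. d * h w)) w) \<in> lower"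
    using assms(2) unfolding cong_lower_def by (rule lower_scale)
  ultimately show ?thesis unfolding cong_lower_def using lower_add by simp
qed

lemma cong_lower_zero: "f \<in> lower \<Longrightarrow> cong_lower f 0 h"
proof -
  have "f - (\<lambda>w. 0 * h w) = f" by (simp add: fun_eq_iff)
  then show "f \<in> lower \<Longrightarrow> ?thesis" by (simp only: cong_lower_def)
qed

lemma cong_lower_lower: "cong_lower f c g \<Longrightarrow> g \<in> lower \<Longrightarrow> f \<in> lower"
proof -
  assume 1: "cong_lower f c g" and 2: "g \<in> lower"
  have "f = (f - (\<lambda>w. c * g w)) + (\<lambda>w. c * g w)" by (simp add: fun_eq_iff)
  then show ?thesis using lower_add[OF 1[unfolded cong_lower_def] lower_scale[OF 2, of c]] by simp
qed

lemma flanked_swap: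
  assumes k: "agrees_outside \<kappa>" and ys: "set (as @ i # j # bs) = fixed_points I \<kappa>" "distinct (as @ i # j # bs)"
    and low: "flanked (\<kappa>(i := j, j := i)) (as @ bs) \<in> lower"
  shows "cong_lower (flanked \<kappa> (as @ i # j # bs)) (-1) (flanked \<kappa> (as @ j # i # bs))"
proof -
  have ij: "i \<in> X" "j \<in> X" "i \<noteq> j" "\<kappa> i = i" "\<kappa> j = j" using ys I_sub by auto
  have i: "involution_on X \<kappa>" using k by (simp add: agrees_outside_def)
  have "flanked \<kappa> (as @ i # j # bs) - (\<lambda>w. (-1) * flanked \<kappa> (as @ j # i # bs) w)
    = (\<lambda>w. 2 * flanked (\<kappa>(i := j, j := i)) (as @ bs) w)"
    using contraction_swap[OF ij i, of m "left @ as" "bs @ right"]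
    by (simp add: flanked_def fun_eq_iff)
  then show ?thesis using lower_scale[OF low, of 2] unfolding cong_lower_def by simp
qed

text \<open>
  Modulo smaller involutions a letter anticommutes with a block, provided that the contractions of the
  letter with the block destroy the nest.
\<close>

lemma flanked_move:
  assumes k: "agrees_outside \<kappa>" and ys: "set (as @ i # K @ bs) = fixed_points I \<kappa>" "distinct (as @ i # K @ bs)"
    and low: "\<And>j zs. j \<in> set K \<Longrightarrow> distinct zs \<Longrightarrow> set zs = fixed_points I \<kappa> - {i, j} \<Longrightarrow>
       flanked (\<kappa>(i := j, j := i)) zs \<in> lower"
  shows "cong_lower (flanked \<kappa> (as @ i # K @ bs)) ((-1) ^ length K) (flanked \<kappa> (as @ K @ i # bs))"
  using ys low
proof (induction K arbitrary: as)
  case Nil then show ?case by (simp add: cong_lower_refl)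
next
  case (Cons j K)
  have "cong_lower (flanked \<kappa> (as @ i # j # K @ bs)) (-1) (flanked \<kappa> (as @ j # i # K @ bs))"
    using Cons.prems by (intro flanked_swap[OF k] Cons.prems(3)) auto
  moreover have "cong_lower (flanked \<kappa> ((as @ [j]) @ i # K @ bs)) ((-1) ^ length K) (flanked \<kappa> ((as @ [j]) @ K @ i # bs))"
    using Cons.prems by (intro Cons.IH) auto
  ultimately show ?case using cong_lower_trans by fastforce
qed

abbreviation detached :: "nat \<Rightarrow> nat" where "detached \<equiv> \<lambda>x. if x \<in> I then x else \<iota> x"

text \<open>
  The product with the letters of \<open>K\<close> antisymmetrized, when no pair within \<open>I\<close> is contracted yet.
\<close>

definition wedge :: "nat list \<Rightarrow> nat list \<Rightarrow> nat list \<Rightarrow> (nat \<Rightarrow> nat) \<Rightarrow> complex" where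
  "wedge as K bs = (\<lambda>w. if distinct (map w K) then flanked detached (as @ K @ bs) w else 0)"

lemma wedge_snoc:
  "wedge as (K @ [k]) bs = (\<lambda>w. (1 / 2) * wedge as K (k # bs) w + ((-1) ^ length K / 2) * wedge (as @ [k]) K bs w)"
proof
  fix w :: "nat \<Rightarrow> nat"
  have "wedge as (K @ [k]) bs w = (wedge as K (k # bs) w + (-1) ^ length K * wedge (as @ [k]) K bs w) / 2"
  proof (cases "(\<forall>x. w x < m) \<and> (\<forall>x\<in>X. w (detached x) = w x)")
    case True
    have red: "flanked detached ys w = csgn (map w (left @ ys @ right))" for ys
      using True unfolding flanked_def contraction_def by (rule if_P)
    show ?thesis unfolding wedge_def red
      using csgn_wedge[of "map w K" "w k" "map w (left @ as)" "map w (bs @ right)"]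
      by (simp only: map_append list.map append_assoc append_Cons append_Nil length_map)
  next
    case False
    have red: "flanked detached ys w = 0" for ys
      using False unfolding flanked_def contraction_def by (rule if_not_P)
    show ?thesis unfolding wedge_def red by simp
  qed
  then show "wedge as (K @ [k]) bs w = (1 / 2) * wedge as K (k # bs) w + ((-1) ^ length K / 2) * wedge (as @ [k]) K bs w"
    by (simp add: add_divide_distrib)
qed

lemma agrees_outside_base: "agrees_outside detached"
proof -
  have out: "\<iota> x \<notin> I" if "x \<notin> I" for x using I_closed[of "\<iota> x"] inv_inv that by auto
  have "detached x \<in> X \<and> detached (detached x) = x" if "x \<in> X" for x
    using that out involution_onD(1)[OF inv] inv_inv by auto
  moreover have "detached x = x" if "x \<notin> X" for x using involution_onD(3)[OF inv that] by simp
  ultimately have "involution_on X detached" unfolding involution_on_def by blast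
  then show ?thesis unfolding agrees_outside_def by simp
qed

definition decreasing_word :: "nat list" where "decreasing_word = rev (sorted_list_of_set I)"

lemma decreasing_word: "set decreasing_word = I" "distinct decreasing_word" "sorted_wrt (>) decreasing_word"
  using finite_I by (auto simp: decreasing_word_def sorted_wrt_rev)

text \<open>
  Antisymmetrization of an initial part of the decreasing word costs only a nonzero factor. The
  recursion \<open>wedge_snoc\<close> places the next letter \<open>k\<close> behind or in front of the earlier ones. If \<open>k\<close> is
  an opening site, its partner is an earlier letter, so the second term is smaller. If \<open>k\<close> is a
  closing site or the centre, contractions with earlier letters break arcs, so both terms agree.
  As the induction needs the second placement too, the factor must not depend on \<open>as\<close> and \<open>bs\<close>.
\<close>

lemma wedge_cong_flanked:
  assumes "decreasing_word = K @ L" "distinct (as @ K @ bs)" "set (as @ K @ bs) = I"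
  shows "\<exists>c. c \<noteq> 0 \<and> (\<forall>as bs. distinct (as @ K @ bs) \<longrightarrow> set (as @ K @ bs) = I \<longrightarrow>
     cong_lower (wedge as K bs) c (flanked detached (as @ K @ bs)))"
  using assms
proof (induction K arbitrary: L as bs rule: rev_induct)
  case Nil
  show ?case by (intro exI[of _ 1]) (auto simp: wedge_def cong_lower_refl)
next
  case (snoc k K)
  obtain c where c: "c \<noteq> 0" and IH: "\<And>as bs. distinct (as @ K @ bs) \<Longrightarrow> set (as @ K @ bs) = I \<Longrightarrow>
     cong_lower (wedge as K bs) c (flanked detached (as @ K @ bs))"
    using snoc.IH[of "k # L" as "k # bs"] snoc.prems by auto
  have kI: "k \<in> I" and KI: "set K \<subseteq> I" using decreasing_word(1) snoc.prems(1) by auto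
  have above: "set K = {y\<in>I. k < y}"
    using decreasing_word snoc.prems(1) by (auto simp: sorted_wrt_append)
  have fp: "fixed_points I detached = I" by auto
  show ?case
  proof (cases "k < \<iota> k")
    case True
    then have ik: "\<iota> k \<in> set K" using above I_closed kI by blast
    have "cong_lower (wedge as (K @ [k]) bs) (c / 2) (flanked detached (as @ (K @ [k]) @ bs))"
      if d: "distinct (as @ (K @ [k]) @ bs)" "set (as @ (K @ [k]) @ bs) = I" for as bs
    proof -
      have 1: "cong_lower (wedge as K (k # bs)) c (flanked detached (as @ K @ k # bs))"
        using d by (intro IH) auto
      have 2: "cong_lower (wedge (as @ [k]) K bs) c (flanked detached ((as @ [k]) @ K @ bs))"
        using d by (intro IH) auto
      have "flanked detached ((as @ [k]) @ K @ bs) \<in> lower"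
      proof (rule flanked_lower[OF agrees_outside_base _ _ kI True])
        show "(\<iota> k, k) \<notin> inversions ((as @ [k]) @ K @ bs)"
          using d ik unfolding inversions_append by (auto dest: inversionsD)
      qed (use d fp kI True in auto)
      then have "wedge (as @ [k]) K bs \<in> lower" using cong_lower_lower 2 by blast
      then have "cong_lower (wedge (as @ [k]) K bs) 0 (flanked detached (as @ K @ k # bs))" by (rule cong_lower_zero)
      from cong_lower_combine[OF 1 this, of "1/2" "(-1) ^ length K / 2"]
      show ?thesis by (simp add: wedge_snoc)
    qed
    then show ?thesis using c by (intro exI[of _ "c / 2"]) auto
  next
    case False
    have "cong_lower (wedge as (K @ [k]) bs) c (flanked detached (as @ (K @ [k]) @ bs))"
      if d: "distinct (as @ (K @ [k]) @ bs)" "set (as @ (K @ [k]) @ bs) = I" for as bs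
    proof -
      have 1: "cong_lower (wedge as K (k # bs)) c (flanked detached (as @ K @ k # bs))"
        using d by (intro IH) auto
      have 2: "cong_lower (wedge (as @ [k]) K bs) c (flanked detached ((as @ [k]) @ K @ bs))"
        using d by (intro IH) auto
      have 3: "cong_lower (flanked detached (as @ k # K @ bs)) ((-1) ^ length K) (flanked detached (as @ K @ k # bs))"
      proof (rule flanked_move[OF agrees_outside_base])
        fix j zs assume j: "j \<in> set K" and zs: "distinct zs" "set zs = fixed_points I detached - {k, j}"
        have jI: "j \<in> I" "k < j" using j above by auto
        then have ij: "\<iota> j < \<iota> k" using antitone[OF kI] by blast
        then have lt: "\<iota> j < j" using False jI by simp
        have "agrees_outside (detached(k := j, j := k))"
        proof -
          have "involution_on X (detached(k := j, j := k))"
            using agrees_outside_base jI kI I_sub by (intro involution_on_link) (auto simp: agrees_outside_def)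
          then show ?thesis using jI kI by (auto simp: agrees_outside_def)
        qed
        then show "flanked (detached(k := j, j := k)) zs \<in> lower"
        proof (rule flanked_lower[OF _ _ _ I_closed[OF jI(1)]])
          show "(\<iota> (\<iota> j), \<iota> j) \<notin> inversions zs" using zs inv_inv by (auto dest: inversionsD)
          show "(detached(k := j, j := k)) (\<iota> j) \<noteq> \<iota> (\<iota> j)"
            using ij lt False jI I_closed[OF jI(1)] inv_inv by auto
        qed (use zs jI lt inv_inv in auto)
      qed (use d fp in auto)
      then have 4: "cong_lower (wedge (as @ [k]) K bs) (c * (-1) ^ length K) (flanked detached (as @ K @ k # bs))"
        using cong_lower_trans[OF 2] by simp
      have e: "1 / 2 * c + (-1) ^ length K / 2 * (c * (-1) ^ length K) = c"
      proof -
        have "(-1) ^ length K * (c * (-1) ^ length K) = c * ((-1) ^ length K * (-1) ^ length K)"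
          by (simp only: ac_simps)
        also have "\<dots> = c" by (simp flip: power_mult_distrib)
        finally have f: "(-1) ^ length K * (c * (-1) ^ length K) = c" .
        have "1 / 2 * c + (-1) ^ length K / 2 * (c * (-1) ^ length K)
            = (c + (-1) ^ length K * (c * (-1) ^ length K)) / 2" by (simp add: add_divide_distrib)
        then show ?thesis unfolding f by simp
      qed
      from cong_lower_combine[OF 1 4, of "1/2" "(-1) ^ length K / 2"]
      show ?thesis unfolding e wedge_snoc by simp
    qed
    then show ?thesis using c by (intro exI[of _ c]) auto
  qed
qed

lemma decreasing_word_lower:
  "flanked detached decreasing_word \<in> lower"
proof -
  obtain c where c0: "c \<noteq> 0" and all: "\<And>as bs. distinct (as @ decreasing_word @ bs) \<Longrightarrow>
      set (as @ decreasing_word @ bs) = I \<Longrightarrow>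
      cong_lower (wedge as decreasing_word bs) c (flanked detached (as @ decreasing_word @ bs))"
    using wedge_cong_flanked[of decreasing_word "[]" "[]" "[]"] decreasing_word(1,2)
    by (auto simp del: set_append distinct_append)
  have c: "c \<noteq> 0" "cong_lower (wedge [] decreasing_word []) c (flanked detached decreasing_word)"
    using c0 all[of "[]" "[]"] decreasing_word(1,2) by simp_all
  have "wedge [] decreasing_word [] = 0"
  proof
    fix w :: "nat \<Rightarrow> nat"
    show "wedge [] decreasing_word [] w = 0 w"
    proof (cases "\<forall>x. w x < m")
      case True
      have "\<not> inj_on w I"
      proof
        assume "inj_on w I"
        then have "card I \<le> card {..<m}" using True by (intro card_inj_on_le[of w]) auto
        then show False using I_large by simp
      qed
      then show ?thesis using decreasing_word by (simp add: wedge_def distinct_map)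
    next
      case False
      then show ?thesis by (auto simp: wedge_def flanked_def contraction_def)
    qed
  qed
  then have "- (\<lambda>w. c * flanked detached decreasing_word w) \<in> lower"
    using c(2) by (simp add: cong_lower_def)
  from lower_scale[OF this, of "- 1 / c"] show ?thesis using c(1) by (simp add: fun_Compl_def)
qed

text \<open>
  The decreasing word is, up to a factor, the normal form of \<open>\<iota>\<close>: the outermost closing site moves
  next to its opening site, where it either passes, which leaves a smaller involution, or is
  contracted. Then the nest is smaller by one arc.
\<close>

lemma flanked_peel:
  assumes "agrees_outside \<kappa>" "distinct D" "sorted_wrt (>) D" "set D = fixed_points I \<kappa>"
    "\<And>x. x \<in> set D \<Longrightarrow> \<iota> x \<in> set D" "\<And>x. x \<in> I - set D \<Longrightarrow> \<kappa> x = \<iota> x"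
  shows "\<exists>c. c \<noteq> 0 \<and> cong_lower (flanked \<kappa> D) c (normal_form m X \<iota>)"
  using assms
proof (induction "length D" arbitrary: D \<kappa> rule: less_induct)
  case less
  note k = less.prems(1)
  have i: "involution_on X \<kappa>" using k by (simp add: agrees_outside_def)
  have off: "\<kappa> x = \<iota> x" if "x \<notin> set D" for x
  proof (cases "x \<in> X")
    case True then show ?thesis using that less.prems(6) k by (cases "x \<in> I") (auto simp: agrees_outside_def)
  next
    case False then show ?thesis using involution_onD(3)[OF i] involution_onD(3)[OF inv] by simp
  qed
  show ?case
  proof (cases "length D \<le> 1")
    case True
    have fixed: "\<iota> x = x" if "x \<in> set D" for x
      using that True less.prems(5)[OF that] by (cases D) auto
    have ki: "\<kappa> = \<iota>"
    proof
      fix x show "\<kappa> x = \<iota> x"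
      proof (cases "x \<in> set D")
        case True
        then have "\<kappa> x = x" using less.prems(4) by blast
        then show ?thesis using fixed[OF True] by (rule trans[OF _ sym])
      qed (rule off)
    qed
    have Dmid: "x = mid" if x: "x \<in> set D" for x
    proof -
      have "x \<in> I" "\<iota> x = x" using x fixed less.prems(4) by auto
      then show ?thesis using mid(1,2) mid(3)[of x] antitone[of x mid]
        by (cases x mid rule: linorder_cases) auto
    qed
    have oo: "set (left @ D @ right) = fixed_points X \<iota>"
      using set_left set_right others_sides less.prems(4) ki I_sub by (auto simp: others_def)
    have srt: "sorted (left @ D @ right)"
      using sorted_left sorted_right set_left set_right Dmid True
      by (cases D) (auto simp: sorted_append)
    have "distinct (left @ D @ right)"
      using distinct_left distinct_right set_left set_right Dmid less.prems(2) by fastforce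
    then have "left @ D @ right = sorted_list_of_set (fixed_points X \<iota>)"
      using srt oo sorted_list_of_set.idem_if_sorted_distinct by metis
    then have "flanked \<kappa> D = normal_form m X \<iota>" by (simp add: flanked_def normal_form_def ki)
    then show ?thesis using cong_lower_refl by (intro exI[of _ 1]) auto
  next
    case False
    then obtain j E where jE: "D = j # E" "E \<noteq> []" by (cases D) auto
    then obtain F q where D: "D = j # F @ [q]" using rev_exhaust[of E] by blast
    have fixD: "\<kappa> x = x" if "x \<in> set D" for x using that less.prems(4) by blast
    have kq: "\<kappa> q = q" "\<kappa> j = j" using fixD D by simp_all
    have sD: "set D \<subseteq> I" using less.prems(4) by auto
    have jmax: "x \<le> j" and qmin: "q \<le> x" if "x \<in> set D" for x
      using less.prems(3) that unfolding D by (auto simp: sorted_wrt_append intro: less_imp_le)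
    have qj: "q < j" using less.prems(3) unfolding D by (simp add: sorted_wrt_append)
    have jI: "j \<in> I" "q \<in> I" using sD D by auto
    have iq: "\<iota> j = q"
    proof -
      have "\<iota> q \<in> set D" using less.prems(5) D by simp
      then have "\<not> \<iota> q < j \<Longrightarrow> ?thesis" using jmax[of "\<iota> q"] inv_inv by (metis le_neq_implies_less)
      moreover have "\<not> \<iota> q < j"
      proof
        assume l: "\<iota> q < j"
        have "\<iota> j \<in> set D" using less.prems(5) D by simp
        then have "q \<le> \<iota> j" using qmin by blast
        moreover have "\<iota> j < \<iota> (\<iota> q)" using antitone[OF I_closed[OF jI(2)] jI(1) l] .
        ultimately show False using inv_inv by simp
      qed
      ultimately show ?thesis by blast
    qed
    then have ij: "\<iota> q = j" using inv_inv by metis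
    have dj: "j \<notin> set F" "q \<notin> set F" "distinct F" using less.prems(2) D by auto
    have link: "agrees_outside (\<kappa>(j := y, y := j))" if "y \<in> set D" for y
    proof -
      have "y \<in> I" "\<kappa> y = y" "\<kappa> j = j" using that less.prems(4) D by auto
      moreover have "involution_on X (\<kappa>(j := y, y := j))"
        using calculation jI I_sub i by (intro involution_on_link) auto
      ultimately show ?thesis using k jI by (auto simp: agrees_outside_def)
    qed
    \<comment> \<open>contracting \<open>j\<close> with an inner site would leave \<open>q\<close> without its partner\<close>
    have 1: "cong_lower (flanked \<kappa> ([] @ j # F @ [q])) ((-1) ^ length F) (flanked \<kappa> ([] @ F @ j # [q]))"
    proof (rule flanked_move[OF k])
      fix y zs assume y: "y \<in> set F" and zs: "distinct zs" "set zs = fixed_points I \<kappa> - {j, y}"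
      have yD: "y \<in> set D" "y \<noteq> q" "y \<noteq> j" using y D dj by auto
      show "flanked (\<kappa>(j := y, y := j)) zs \<in> lower"
      proof (rule flanked_lower[OF link[OF yD(1)] zs(1) _ jI(2)])
        show "(\<iota> q, q) \<notin> inversions zs" using zs ij by (auto dest: inversionsD)
        show "(\<kappa>(j := y, y := j)) q \<noteq> \<iota> q" using ij qj yD kq by simp
        show "set zs = fixed_points I (\<kappa>(j := y, y := j))"
          using zs yD by auto
      qed (use ij qj in auto)
    qed (use less.prems(2,4) D in simp_all)
    let ?k = "\<kappa>(j := q, q := j)"
    have "flanked \<kappa> (F @ q # j # []) \<in> lower"
    proof (rule flanked_lower[OF k _ _ jI(2)])
      show "(\<iota> q, q) \<notin> inversions (F @ [q, j])"
        using ij qj dj unfolding inversions_append by (auto dest: inversionsD)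
      show "set (F @ [q, j]) = fixed_points I \<kappa>" using less.prems(4) D by auto
    qed (use less.prems(2) D ij qj kq in auto)
    then have 2: "cong_lower (flanked \<kappa> (F @ q # j # [])) 0 (flanked ?k F)" by (rule cong_lower_zero)
    have "contraction m X \<kappa> ((left @ F) @ j # q # right) =
      (\<lambda>w. (-1) * contraction m X \<kappa> ((left @ F) @ q # j # right) w)
       + (\<lambda>w. 2 * contraction m X ?k ((left @ F) @ right) w)"
      using jI I_sub qj kq i by (intro contraction_swap) auto
    then have "flanked \<kappa> (F @ j # [q]) = (\<lambda>w. (-1) * flanked \<kappa> (F @ q # j # []) w + 2 * flanked ?k F w)"
      by (simp add: flanked_def fun_eq_iff)
    then have 3: "cong_lower (flanked \<kappa> (F @ j # [q])) 2 (flanked ?k F)"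
      using cong_lower_combine[OF 2 cong_lower_refl, of "-1" 2] by simp
    have "\<exists>c. c \<noteq> 0 \<and> cong_lower (flanked ?k F) c (normal_form m X \<iota>)"
    proof (rule less.hyps)
      show "sorted_wrt (>) F" using less.prems(3) unfolding D by (simp add: sorted_wrt_append)
      have "set F = set D - {j, q}" using D dj by auto
      also have "\<dots> = fixed_points I ?k" using qj unfolding less.prems(4) by auto
      finally show "set F = fixed_points I ?k" .
      show "agrees_outside ?k" using link[of q] D by simp
      show "\<iota> x \<in> set F" if x: "x \<in> set F" for x
      proof -
        have "\<iota> x \<in> set D" using less.prems(5) x D by simp
        moreover have "\<iota> x \<noteq> j" "\<iota> x \<noteq> q" using x dj ij iq inv_inj by metis+
        ultimately show ?thesis using D by auto
      qed
      show "?k x = \<iota> x" if "x \<in> I - set F" for x using that off[of x] D ij iq by auto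
    qed (use D dj in auto)
    then obtain c where c: "c \<noteq> 0" "cong_lower (flanked ?k F) c (normal_form m X \<iota>)" by blast
    have "cong_lower (flanked \<kappa> D) ((-1) ^ length F * (2 * c)) (normal_form m X \<iota>)"
      using cong_lower_trans[OF 1[simplified] cong_lower_trans[OF 3 c(2)]] D by simp
    then show ?thesis using c(1) by (intro exI[of _ "(-1) ^ length F * (2 * c)"]) simp
  qed
qed

lemma normal_form_lower: "normal_form m X \<iota> \<in> lower"
proof -
  obtain c where c: "c \<noteq> 0" "cong_lower (flanked detached decreasing_word) c (normal_form m X \<iota>)"
  proof -
    have "\<exists>c. c \<noteq> 0 \<and> cong_lower (flanked detached decreasing_word) c (normal_form m X \<iota>)"
      by (rule flanked_peel[OF agrees_outside_base decreasing_word(2,3)]) (auto simp: decreasing_word(1) I_closed)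
    then show ?thesis using that by blast
  qed
  have "(\<lambda>w. c * normal_form m X \<iota> w) =
     flanked detached decreasing_word
      + (\<lambda>w. (-1) * (flanked detached decreasing_word - (\<lambda>w. c * normal_form m X \<iota> w)) w)"
    by (simp add: fun_eq_iff)
  then have "(\<lambda>w. c * normal_form m X \<iota> w) \<in> lower"
    using lower_add[OF decreasing_word_lower lower_scale[OF c(2)[unfolded cong_lower_def], of "-1"]] by simp
  from lower_scale[OF this, of "1 / c"] show ?thesis using c(1) by simp
qed

end

lemma lexless_trans: "lexless f g \<Longrightarrow> lexless g h \<Longrightarrow> lexless f h"
proof -
  assume "lexless f g" "lexless g h"
  then obtain x y where x: "\<forall>z<x. f z = g z" "f x < g x" and y: "\<forall>z<y. g z = h z" "g y < h y"
    by (auto simp: lexless_def)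
  have "(\<forall>z<min x y. f z = h z) \<and> f (min x y) < h (min x y)"
    using x y by (cases x y rule: linorder_cases) (auto simp: min_def)
  then show ?thesis unfolding lexless_def by blast
qed

lemma lexless_irrefl: "\<not> lexless f f"
  by (simp add: lexless_def)

lemma involution_on_permutes: "involution_on X \<iota> \<Longrightarrow> \<iota> permutes X"
  unfolding permutes_def by (metis involution_onD(2,3))

lemma finite_involutions: "finite X \<Longrightarrow> finite {\<iota>. involution_on X \<iota> \<and> P \<iota>}"
  by (rule finite_subset[OF _ finite_permutations[of X]]) (auto intro: involution_on_permutes)

section \<open>The dimension of the span of all arrangements\<close>

text \<open>
  Of the points of a decreasing subsequence above and below the diagonal, keep the more numerous part
  and add its mirror image.
\<close>

lemma symmetric_decreasing_set:
  assumes "finite X" and inv: "involution_on X \<iota>" and D: "D \<subseteq> X" "decreasing_on D \<iota>"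
  shows "\<exists>I\<subseteq>X. (\<forall>x\<in>I. \<iota> x \<in> I) \<and> decreasing_on I \<iota> \<and> card D \<le> card I"
proof -
  note ii = involution_onD(2)[OF inv]
  have inj: "inj_on \<iota> S" for S using involution_on_inj[OF inv] by (auto simp: inj_on_def)
  let ?A = "{x\<in>D. x < \<iota> x}" and ?B = "{x\<in>D. \<iota> x < x}" and ?C = "{x\<in>D. \<iota> x = x}"
  have finD: "finite D" using assms finite_subset by blast
  have dec: "\<iota> y < \<iota> x" if "x \<in> D" "y \<in> D" "x < y" for x y using D(2) that by (auto simp: decreasing_on_def)
  define U where "U = (if card ?B \<le> card ?A then ?A else \<iota> ` ?B)"
  have cU: "card ?A \<le> card U" "card ?B \<le> card U"
    using card_image[OF inj, of ?B] by (auto simp: U_def)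
  have U: "U \<subseteq> X" "\<And>u. u \<in> U \<Longrightarrow> u < \<iota> u"
    using D(1) involution_onD(1)[OF inv] ii unfolding U_def by (auto split: if_splits)
  have Udec: "\<iota> v < \<iota> u" if uv: "u \<in> U" "v \<in> U" "u < v" for u v
  proof (cases "card ?B \<le> card ?A")
    case True then show ?thesis using uv dec by (auto simp: U_def)
  next
    case False
    then obtain x y where xy: "u = \<iota> x" "v = \<iota> y" "x \<in> D" "y \<in> D" using uv by (auto simp: U_def)
    then have "\<not> x < y" "x \<noteq> y" using dec[of x y] uv(3) by auto
    then show ?thesis using xy ii by auto
  qed
  have UC: "u < c \<and> c < \<iota> u" if uc: "u \<in> U" "c \<in> ?C" for u c
  proof (cases "card ?B \<le> card ?A")
    case True
    then have u: "u \<in> D" "u < \<iota> u" using uc by (auto simp: U_def)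
    then show ?thesis using dec[of u c] dec[of c u] uc(2) by (cases u c rule: linorder_cases) auto
  next
    case False
    then obtain x where x: "u = \<iota> x" "x \<in> D" "\<iota> x < x" using uc by (auto simp: U_def)
    then show ?thesis using dec[of x c] dec[of c x] uc(2) ii by (cases x c rule: linorder_cases) auto
  qed
  have UU: "u < \<iota> v" if "u \<in> U" "v \<in> U" for u v
    using Udec[OF that(2,1)] U(2)[OF that(1)] U(2)[OF that(2)] by (cases u v rule: linorder_cases) auto
  let ?I = "U \<union> \<iota> ` U \<union> ?C"
  have "?I \<subseteq> X" using U(1) D involution_onD(1)[OF inv] by auto
  moreover have "\<forall>x\<in>?I. \<iota> x \<in> ?I" using ii by auto
  moreover have "decreasing_on ?I \<iota>"
    unfolding decreasing_on_def
  proof (intro ballI impI)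
    fix x y assume x: "x \<in> ?I" and y: "y \<in> ?I" and lt: "x < y"
    consider "x \<in> U" | u where "u \<in> U" "x = \<iota> u" | "x \<in> ?C" using x by blast
    then show "\<iota> y < \<iota> x"
    proof cases
      case 1
      consider "y \<in> U" | v where "v \<in> U" "y = \<iota> v" | "y \<in> ?C" using y by blast
      then show ?thesis
      proof cases
        case 1 then show ?thesis using Udec \<open>x \<in> U\<close> lt by blast
      next
        case (2 v) then show ?thesis using UU[of v x] \<open>x \<in> U\<close> ii by simp
      next
        case 3 then show ?thesis using UC[of x y] \<open>x \<in> U\<close> by simp
      qed
    next
      case (2 u)
      consider "y \<in> U" | v where "v \<in> U" "y = \<iota> v" | "y \<in> ?C" using y by blast
      then show ?thesis
      proof cases
        case 1 then show ?thesis using UU[of y u] 2 lt by simp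
      next
        case (2 v)
        then show ?thesis using Udec[of u v] \<open>u \<in> U\<close> \<open>x = \<iota> u\<close> lt ii
          by (cases u v rule: linorder_cases) auto
      next
        case 3 then show ?thesis using UC[of u y] 2 lt by simp
      qed
    next
      case 3
      consider "y \<in> U" | v where "v \<in> U" "y = \<iota> v" | "y \<in> ?C" using y by blast
      then show ?thesis
      proof cases
        case 1 then show ?thesis using UC[of y x] 3 lt by simp
      next
        case (2 v) then show ?thesis using UC[of v x] 3 ii by simp
      next
        case yC: 3 then show ?thesis using dec[of x y] 3 lt by simp
      qed
    qed
  qed
  moreover have "card D \<le> card ?I"
  proof -
    have fin: "finite U" "finite ?C" using finD assms(1) U(1) finite_subset by auto
    have d: "U \<inter> \<iota> ` U = {}" using UU by force
    have d2: "(U \<union> \<iota> ` U) \<inter> ?C = {}"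
    proof -
      have "c \<notin> U" "c \<notin> \<iota> ` U" if "c \<in> ?C" for c using UC[OF _ that] by force+
      then show ?thesis by blast
    qed
    have "card ?I = card U + card (\<iota> ` U) + card ?C"
      using fin d d2 by (subst card_Un_disjoint) (auto simp: card_Un_disjoint)
    also have "card (\<iota> ` U) = card U" by (rule card_image[OF inj])
    finally have "card ?I \<ge> card ?A + card ?B + card ?C" using cU by simp
    moreover have "D = ?A \<union> ?B \<union> ?C" by (auto)
    then have "card D \<le> card ?A + card ?B + card ?C"
      by (metis (no_types, lifting) card_Un_le le_trans add_le_mono1)
    ultimately show ?thesis by simp
  qed
  ultimately show ?thesis by blast
qed

definition avoiders :: "nat \<Rightarrow> nat set \<Rightarrow> (nat \<Rightarrow> nat) set" where
  "avoiders m X = {\<iota>. involution_on X \<iota> \<and> short_decreasing m X \<iota>}"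

text \<open>
  Lexicographic induction: an involution with a long decreasing subsequence has a large symmetric one,
  so its normal form reduces to smaller ones.
\<close>

lemma normal_form_span_avoiders:
  assumes "finite X" "involution_on X \<iota>"
  shows "normal_form m X \<iota> \<in> fun_space.span (normal_form m X ` avoiders m X)"
proof -
  let ?R = "{(\<kappa>, \<iota>). involution_on X \<kappa> \<and> involution_on X \<iota> \<and> lexless \<kappa> \<iota>}"
  have "finite ?R"
    by (rule finite_subset[of _ "{\<kappa>. involution_on X \<kappa> \<and> True} \<times> {\<kappa>. involution_on X \<kappa> \<and> True}"])
       (use finite_involutions[OF assms(1), of "\<lambda>_. True"] in auto)
  moreover have "trans ?R" unfolding trans_def using lexless_trans by blast
  then have "acyclic ?R" using lexless_irrefl by (auto simp: acyclic_def trancl_id)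
  ultimately have "wf ?R" by (rule finite_acyclic_wf)
  then show ?thesis using assms(2)
  proof (induction \<iota> rule: wf_induct_rule)
    case (less \<iota>)
    show ?case
    proof (cases "short_decreasing m X \<iota>")
      case True
      then show ?thesis using less.prems by (intro fun_space.span_base) (auto simp: avoiders_def)
    next
      case False
      then obtain D where "D \<subseteq> X" "decreasing_on D \<iota>" "m < card D"
        by (auto simp: short_decreasing_def not_le)
      then obtain I where I: "I\<subseteq>X" "\<forall>x\<in>I. \<iota> x \<in> I" "decreasing_on I \<iota>" "m < card I"
        using symmetric_decreasing_set[OF assms(1) less.prems] by (meson less_le_trans)
      interpret nesting m X I \<iota> using I assms(1) less.prems by unfold_locales auto
      have "normal_form m X ` {\<kappa>. involution_on X \<kappa> \<and> lexless \<kappa> \<iota>} \<subseteq> fun_space.span (normal_form m X ` avoiders m X)"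
        using less.IH less.prems by auto
      then have "lower \<subseteq> fun_space.span (normal_form m X ` avoiders m X)"
        unfolding lower_def by (rule fun_space.span_minimal[OF _ fun_space.subspace_span])
      then show ?thesis using normal_form_lower by blast
    qed
  qed
qed

definition arrangements :: "nat \<Rightarrow> nat set \<Rightarrow> ((nat \<Rightarrow> nat) \<Rightarrow> complex) set" where
  "arrangements m X = (\<lambda>ys. contraction m X id ys) ` {ys. distinct ys \<and> set ys = X}"

lemma arrangements_upper:
  assumes "finite X"
  shows "arrangements m X \<subseteq> fun_space.span (normal_form m X ` avoiders m X)"
proof
  fix f assume "f \<in> arrangements m X"
  then obtain ys where ys: "distinct ys" "set ys = X" "f = contraction m X id ys"
    by (auto simp: arrangements_def)
  have "f \<in> fun_space.span (normal_form m X ` extensions X id ys)"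
    unfolding ys(3) using ys assms by (intro contraction_normal_form) (auto simp: involution_on_def)
  also have "\<dots> \<subseteq> fun_space.span (normal_form m X ` avoiders m X)"
    using normal_form_span_avoiders[OF assms] 
    by (intro fun_space.span_minimal fun_space.subspace_span) (auto simp: extensions_def)
  finally show "f \<in> fun_space.span (normal_form m X ` avoiders m X)" .
qed

text \<open>
  Antisymmetrized products are combinations of ordinary ones; \<open>P\<close> stands for factors that have been
  antisymmetrized before.
\<close>

lemma wedge_in_span:
  fixes P :: "(nat \<Rightarrow> nat) \<Rightarrow> bool"
  assumes "fun_space.subspace V"
    and "\<And>ys. distinct ys \<Longrightarrow> set ys = T \<Longrightarrow> (\<lambda>w. if P w then csgn (map w (ys @ zs)) else 0) \<in> V"
    and "distinct (as @ K @ bs)" "set (as @ K @ bs) = T"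
  shows "(\<lambda>w. if P w \<and> distinct (map w K) then csgn (map w (as @ K @ bs @ zs)) else 0) \<in> V"
  using assms(3,4)
proof (induction K arbitrary: as bs rule: rev_induct)
  case Nil
  then have "(\<lambda>w. if P w then csgn (map w (as @ bs @ zs)) else 0) \<in> V"
    using assms(2)[of "as @ bs", unfolded append_assoc] by simp
  then show ?case unfolding append_Nil by (simp only: list.map distinct.simps simp_thms)
next
  case (snoc k K)
  let ?f = "\<lambda>as K bs w. if P w \<and> distinct (map w K) then csgn (map w (as @ K @ bs @ zs)) else 0"
  have e: "?f as (K @ [k]) bs = (\<lambda>w. (1 / 2) * ?f as K (k # bs) w) + (\<lambda>w. ((-1) ^ length K / 2) * ?f (as @ [k]) K bs w)"
  proof
    fix w
    have "?f as (K @ [k]) bs w = (?f as K (k # bs) w + (-1) ^ length K * ?f (as @ [k]) K bs w) / 2"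
    proof (cases "P w")
      case True
      then show ?thesis
        using csgn_wedge[of "map w K" "w k" "map w as" "map w (bs @ zs)"]
        by (simp only: map_append list.map append_assoc append_Cons append_Nil length_map simp_thms)
    next
      case False then show ?thesis by simp
    qed
    then show "?f as (K @ [k]) bs w = ((\<lambda>w. (1 / 2) * ?f as K (k # bs) w) + (\<lambda>w. ((-1) ^ length K / 2) * ?f (as @ [k]) K bs w)) w"
      by (simp add: add_divide_distrib)
  qed
  have 1: "?f as K (k # bs) \<in> V" using snoc.prems by (intro snoc.IH) auto
  have 2: "?f (as @ [k]) K bs \<in> V" using snoc.prems by (intro snoc.IH) auto
  show ?case unfolding e
    by (intro fun_space.subspace_add[OF assms(1)] fun_space.subspace_scale[OF assms(1)] 1 2)
qed

lemma wedges_in_span: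
  assumes "distinct (as @ concat Ks)" "set (as @ concat Ks) = X"
  shows "(\<lambda>w. if (\<forall>x. w x < m) \<and> (\<forall>K\<in>set Ks. distinct (map w K)) then csgn (map w (as @ concat Ks)) else 0)
    \<in> fun_space.span (arrangements m X)"
  using assms
proof (induction Ks arbitrary: as)
  case Nil
  have "(\<lambda>w. if \<forall>x. w x < m then csgn (map w as) else 0) = contraction m X id as"
    by (auto simp: contraction_def fun_eq_iff)
  moreover have "contraction m X id as \<in> fun_space.span (arrangements m X)"
    using Nil by (intro fun_space.span_base) (auto simp: arrangements_def)
  ultimately show ?case unfolding concat.simps append_Nil2 by simp
next
  case (Cons K Ks)
  have "(\<lambda>w. if ((\<forall>x. w x < m) \<and> (\<forall>K\<in>set Ks. distinct (map w K))) \<and> distinct (map w K)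
      then csgn (map w (as @ K @ [] @ concat Ks)) else 0) \<in> fun_space.span (arrangements m X)"
  proof (rule wedge_in_span[where T = "set as \<union> set K"])
    fix ys assume "distinct ys" "set ys = set as \<union> set K"
    then show "(\<lambda>w. if (\<forall>x. w x < m) \<and> (\<forall>K\<in>set Ks. distinct (map w K)) then csgn (map w (ys @ concat Ks)) else 0)
        \<in> fun_space.span (arrangements m X)"
      using Cons.prems by (intro Cons.IH) auto
  qed (use Cons.prems in \<open>auto intro: fun_space.subspace_span\<close>)
  moreover have "(\<lambda>w. if ((\<forall>x. w x < m) \<and> (\<forall>K\<in>set Ks. distinct (map w K))) \<and> distinct (map w K)
      then csgn (map w (as @ K @ [] @ concat Ks)) else 0) =
     (\<lambda>w. if (\<forall>x. w x < m) \<and> (\<forall>K\<in>set (K # Ks). distinct (map w K)) then csgn (map w (as @ concat (K # Ks))) else 0)"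
    by (auto simp: fun_eq_iff)
  ultimately show ?case by metis
qed

text \<open>
  The product of the antisymmetrized columns is supported on colourings that are injective on each
  column. Reading such a colouring from the left, at each site the colours smaller than its row
  have been used up by the entries above it; so the row word is the lexicographically smallest
  colouring in the support.
\<close>

lemma tableau_vector:
  assumes "finite X" "0 < m" and t: "tableau m X r c"
  shows "\<exists>H\<in>fun_space.span (arrangements m X). H r \<noteq> 0 \<and>
    (\<forall>w. (\<forall>x. x \<notin> X \<longrightarrow> w x = 0) \<longrightarrow> H w \<noteq> 0 \<longrightarrow> w = r \<or> lexless r w)"
proof -
  define block where "block a = sorted_list_of_set {x\<in>X. c x = a}" for a
  define Ks where "Ks = map block (sorted_list_of_set (c ` X))"
  have setb: "set (block a) = {x\<in>X. c x = a}" and db: "distinct (block a)" for a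
    using assms(1) by (auto simp: block_def)
  have setK: "set (concat Ks) = X" using assms(1) setb by (auto simp: Ks_def)
  have "distinct (concat (map block as))" if "distinct as" for as
    using that setb db by (induction as) auto
  then have dK: "distinct (concat Ks)" by (simp add: Ks_def)
  let ?H = "\<lambda>w. if (\<forall>x. w x < m) \<and> (\<forall>K\<in>set Ks. distinct (map w K)) then csgn (map w (concat Ks)) else 0"
  have H: "?H \<in> fun_space.span (arrangements m X)"
    using wedges_in_span[of "[]" Ks X m, unfolded append_Nil] setK dK by simp
  have sep: "w x \<noteq> w y" if "\<forall>K\<in>set Ks. distinct (map w K)" "x \<in> X" "y \<in> X" "x \<noteq> y" "c x = c y" for w :: "nat \<Rightarrow> nat" and x y
  proof -
    have "block (c x) \<in> set Ks" using that(2) assms(1) by (auto simp: Ks_def)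
    then have "inj_on w {z\<in>X. c z = c x}" using that(1) setb by (auto simp: distinct_map)
    then show ?thesis using that by (auto simp: inj_on_def)
  qed
  have r: "\<forall>x\<in>X. r x < m" "\<forall>x. x \<notin> X \<longrightarrow> r x = 0"
    "\<And>x y. x\<in>X \<Longrightarrow> y\<in>X \<Longrightarrow> r x = r y \<Longrightarrow> c x = c y \<Longrightarrow> x = y"
    "\<And>x a. x\<in>X \<Longrightarrow> r x = Suc a \<Longrightarrow> \<exists>y\<in>X. y < x \<and> r y = a \<and> c y = c x"
    using t unfolding tableau_def by blast+
  have rm: "r x < m" for x using r(1,2) assms(2) by (cases "x \<in> X") auto
  have "distinct (map r K)" if "K \<in> set Ks" for K
    using that db setb r(3) by (auto simp: Ks_def distinct_map inj_on_def)
  then have 1: "?H r \<noteq> 0" using rm csgn_nonzero by simp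
  have below: "\<exists>y\<in>X. y < x \<and> r y = b \<and> c y = c x" if "x \<in> X" "b < r x" for x b
    using that
  proof (induction "r x" arbitrary: x)
    case (Suc a)
    obtain y where y: "y\<in>X" "y < x" "r y = a" "c y = c x" using r(4)[OF Suc.prems(1)] Suc.hyps(2) by metis
    show ?case
    proof (cases "b = a")
      case False
      then obtain z where "z\<in>X" "z < y" "r z = b" "c z = c y" using Suc.hyps(1)[of y] y Suc.prems Suc.hyps(2) by auto
      then show ?thesis using y by (intro bexI[of _ z]) auto
    qed (use y in blast)
  qed auto
  have 2: "w = r \<or> lexless r w" if w: "\<forall>x. x \<notin> X \<longrightarrow> w x = 0" "?H w \<noteq> 0" for w
  proof (rule disjCI)
    assume nl: "\<not> lexless r w"
    have inj: "\<forall>K\<in>set Ks. distinct (map w K)" using w(2) by (auto split: if_splits)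
    show "w = r"
    proof (rule ccontr)
      assume "w \<noteq> r"
      then obtain x0 where "w x0 \<noteq> r x0" by (auto simp: fun_eq_iff)
      define x where "x = (LEAST x. w x \<noteq> r x)"
      have x: "w x \<noteq> r x" unfolding x_def using \<open>w x0 \<noteq> r x0\<close> by (rule LeastI)
      have before: "w y = r y" if "y < x" for y using not_less_Least that unfolding x_def by blast
      have xX: "x \<in> X" using x w(1) r(2) by metis
      have "\<not> r x < w x" using nl before unfolding lexless_def by metis
      then have "w x < r x" using x by simp
      then obtain y where "y\<in>X" "y < x" "r y = w x" "c y = c x" using below[OF xX] by blast
      then show False using sep[OF inj, of y x] xX before by auto
    qed
  qed
  show ?thesis
  proof (rule bexI[OF _ H], intro conjI allI impI)
    show "?H r \<noteq> 0" by (rule 1)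
  qed (rule 2)
qed

lemma fun_sum_apply: "(\<Sum>i\<in>S. f i) x = (\<Sum>i\<in>S. f i x)"
  by (induction S rule: infinite_finite_induct) auto

text \<open>
  In a nontrivial relation, evaluate at the lexicographically smallest of the points \<open>r j\<close> with
  nonzero coefficient.
\<close>

lemma triangular_independent:
  assumes fin: "finite S" and diag: "\<And>i. i \<in> S \<Longrightarrow> H i (r i) \<noteq> (0::complex)" and "inj_on r S"
    and tri: "\<And>i j. i \<in> S \<Longrightarrow> j \<in> S \<Longrightarrow> H i (r j) \<noteq> 0 \<Longrightarrow> r j = r i \<or> lexless (r i) (r j)"
  shows "fun_space.independent (H ` S)" "inj_on H S"
proof -
  have key: "\<forall>i\<in>S. a i = 0" if "\<forall>w. (\<Sum>i\<in>S. a i * H i w) = 0" for a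
  proof (rule ccontr)
    assume "\<not> (\<forall>i\<in>S. a i = 0)"
    let ?N = "{i\<in>S. a i \<noteq> 0}"
    have ne: "?N \<noteq> {}" using \<open>\<not> (\<forall>i\<in>S. a i = 0)\<close> by blast
    let ?R = "{(i, j). i \<in> ?N \<and> j \<in> ?N \<and> lexless (r i) (r j)}"
    have "finite ?R" by (rule finite_subset[of _ "?N \<times> ?N"]) (use fin in auto)
    moreover have "trans ?R" unfolding trans_def using lexless_trans by blast
    then have "acyclic ?R" using lexless_irrefl by (auto simp: acyclic_def trancl_id)
    ultimately have "wf ?R" by (rule finite_acyclic_wf)
    then obtain j where j: "j \<in> ?N" "\<And>i. (i, j) \<in> ?R \<Longrightarrow> i \<notin> ?N" using ne by (meson wfE_min equals0I ex_in_conv)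
    have "a i * H i (r j) = 0" if "i \<in> S - {j}" for i
    proof (rule ccontr)
      assume nz: "a i * H i (r j) \<noteq> 0"
      then have "i \<in> ?N" using that by auto
      moreover have "r j \<noteq> r i" using that j(1) assms(3) by (auto simp: inj_on_def)
      then have "lexless (r i) (r j)" using tri[of i j] that nz j(1) by auto
      ultimately show False using j by blast
    qed
    then have "(\<Sum>i\<in>S - {j}. a i * H i (r j)) = 0" by (intro sum.neutral) blast
    then have "(\<Sum>i\<in>S. a i * H i (r j)) = a j * H j (r j)"
      using j(1) fin sum.remove[of S j "\<lambda>i. a i * H i (r j)"] by simp
    then show False using that[rule_format, of "r j"] j(1) diag by auto
  qed
  show inj: "inj_on H S"
  proof (rule inj_onI, rule ccontr)
    fix i j assume ij: "i \<in> S" "j \<in> S" "H i = H j" "i \<noteq> j"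
    let ?a = "\<lambda>k. if k = i then 1 else if k = j then -1 else (0::complex)"
    have z: "(\<Sum>k\<in>S. ?a k * H k w) = 0" for w
    proof -
      have "(\<Sum>k\<in>S. ?a k * H k w) = (\<Sum>k\<in>{i, j}. ?a k * H k w)"
        using ij fin by (intro sum.mono_neutral_right) auto
      also have "\<dots> = ?a i * H i w + ?a j * H j w" using ij(4) by (subst sum.insert) simp_all
      also have "\<dots> = 0" unfolding ij(3) using ij(4) by simp
      finally show ?thesis .
    qed
    have "\<forall>k\<in>S. ?a k = 0" by (rule key) (rule allI, rule z)
    then have "?a i = 0" using ij(1) by (rule bspec)
    then show False by simp
  qed
  show "fun_space.independent (H ` S)"
  proof (rule fun_space.independent_if_scalars_zero)
    show "finite (H ` S)" using fin by simp
    fix u f assume s: "(\<Sum>x\<in>H ` S. (\<lambda>w. u x * x w)) = 0" and f: "f \<in> H ` S"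
    have "(\<Sum>i\<in>S. (\<lambda>w. u (H i) * H i w)) = 0" using s inj by (simp add: sum.reindex)
    then have "\<forall>w. (\<Sum>i\<in>S. u (H i) * H i w) = 0"
      by (simp add: fun_eq_iff fun_sum_apply)
    then show "u f = 0" using key[of "\<lambda>i. u (H i)"] f by blast
  qed
qed

theorem dim_arrangements:
  assumes "finite X" "0 < m"
  shows "fun_space.dim (arrangements m X) = card (avoiders m X)"
proof -
  have finA: "finite (avoiders m X)" unfolding avoiders_def using finite_involutions[OF assms(1)] .
  have loc: "finite_involution X \<iota>" "short_decreasing m X \<iota>" if "\<iota> \<in> avoiders m X" for \<iota>
    using that assms(1) by (auto simp: avoiders_def finite_involution_def)
  let ?r = "row_word m X"
  have tab: "tableau m X (?r \<iota>) (column m X \<iota>)" if "\<iota> \<in> avoiders m X" for \<iota>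
    using row_word_tableau loc[OF that] by blast
  have "\<forall>\<iota>\<in>avoiders m X. \<exists>H. H \<in> fun_space.span (arrangements m X) \<and> H (?r \<iota>) \<noteq> 0 \<and>
      (\<forall>w. (\<forall>x. x \<notin> X \<longrightarrow> w x = 0) \<longrightarrow> H w \<noteq> 0 \<longrightarrow> w = ?r \<iota> \<or> lexless (?r \<iota>) w)"
    using tableau_vector[OF assms tab] by (meson)
  then obtain H where H: "\<And>\<iota>. \<iota> \<in> avoiders m X \<Longrightarrow> H \<iota> \<in> fun_space.span (arrangements m X) \<and> H \<iota> (?r \<iota>) \<noteq> 0 \<and>
      (\<forall>w. (\<forall>x. x \<notin> X \<longrightarrow> w x = 0) \<longrightarrow> H \<iota> w \<noteq> 0 \<longrightarrow> w = ?r \<iota> \<or> lexless (?r \<iota>) w)"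
    by metis
  have inj: "inj_on ?r (avoiders m X)"
    using row_word_inj loc by (meson inj_onI)
  have zero: "\<forall>x. x \<notin> X \<longrightarrow> ?r \<iota> x = 0" if "\<iota> \<in> avoiders m X" for \<iota>
    using tab[OF that] by (simp add: tableau_def)
  have ind: "fun_space.independent (H ` avoiders m X)" "inj_on H (avoiders m X)"
    using triangular_independent[OF finA _ inj, of H] H zero by blast+
  obtain B where B: "B \<subseteq> arrangements m X" "fun_space.independent B" "arrangements m X \<subseteq> fun_space.span B"
      "card B = fun_space.dim (arrangements m X)"
    using fun_space.basis_exists by blast
  have "B \<subseteq> fun_space.span (normal_form m X ` avoiders m X)" using B(1) arrangements_upper[OF assms(1)] by blast
  then have up: "finite B" "card B \<le> card (normal_form m X ` avoiders m X)"
    using fun_space.independent_span_bound[OF finite_imageI[OF finA] B(2)] by blast+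
  have "fun_space.span (arrangements m X) \<subseteq> fun_space.span B"
    by (rule fun_space.span_minimal[OF B(3) fun_space.subspace_span])
  then have "H ` avoiders m X \<subseteq> fun_space.span B" using H by blast
  then have "card (H ` avoiders m X) \<le> card B"
    using fun_space.independent_span_bound[OF up(1) ind(1)] by blast
  then show ?thesis using up(2) card_image_le[OF finA, of "normal_form m X"] B(4) card_image[OF ind(2)] by simp
qed

section \<open>Lowering words and their pairing with raising words\<close>

text \<open>
  The part of the structure of a highest weight module that determines how raising operators act on
  lowering words, for the vertices in \<open>L\<close>. It is common to the modules of Kac--Moody algebras and to
  the concrete model.
\<close>

locale chevalley = vector_space scale
  for scale :: "complex \<Rightarrow> 'v::ab_group_add \<Rightarrow> 'v" +
  fixes L :: "nat set" and E F H :: "nat \<Rightarrow> 'v \<Rightarrow> 'v" and vac :: 'v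
    and A :: "nat \<Rightarrow> nat \<Rightarrow> complex" and lam :: "nat \<Rightarrow> complex"
  assumes E_add: "i \<in> L \<Longrightarrow> E i (u + u') = E i u + E i u'" and E_scale: "i \<in> L \<Longrightarrow> E i (scale c u) = scale c (E i u)"
    and F_add: "i \<in> L \<Longrightarrow> F i (u + u') = F i u + F i u'" and F_scale: "i \<in> L \<Longrightarrow> F i (scale c u) = scale c (F i u)"
    and E_F: "i \<in> L \<Longrightarrow> j \<in> L \<Longrightarrow> E i (F j u) = F j (E i u) + (if i = j then H i u else 0)"
    and H_F: "i \<in> L \<Longrightarrow> j \<in> L \<Longrightarrow> H i (F j u) = F j (H i u) - scale (A i j) (F j u)"
    and H_vac: "i \<in> L \<Longrightarrow> H i vac = scale (lam i) vac" and E_vac: "i \<in> L \<Longrightarrow> E i vac = 0"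
begin

definition fword :: "nat list \<Rightarrow> 'v" where "fword is = foldr F is vac"
definition eword :: "nat list \<Rightarrow> 'v \<Rightarrow> 'v" where "eword js u = fold E js u"

lemma fword_simps [simp]: "fword [] = vac" "fword (i # is) = F i (fword is)" by (simp_all add: fword_def)
lemma eword_simps [simp]: "eword [] u = u" "eword (j # js) u = eword js (E j u)" by (simp_all add: eword_def)

lemma H_fword: "i \<in> L \<Longrightarrow> set is \<subseteq> L \<Longrightarrow> H i (fword is) = scale (lam i - (\<Sum>j\<leftarrow>is. A i j)) (fword is)"
  by (induction "is") (auto simp: H_vac H_F F_scale scale_left_diff_distrib[symmetric] diff_diff_eq add.commute)

lemma E_zero: "i \<in> L \<Longrightarrow> E i 0 = 0" using E_add[of i 0 0] by simp
lemma F_zero: "i \<in> L \<Longrightarrow> F i 0 = 0" using F_add[of i 0 0] by simp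

lemma eword_add: "set js \<subseteq> L \<Longrightarrow> eword js (u + u') = eword js u + eword js u'"
  by (induction js arbitrary: u u') (auto simp: E_add)
lemma eword_scale: "set js \<subseteq> L \<Longrightarrow> eword js (scale c u) = scale c (eword js u)"
  by (induction js arbitrary: u) (auto simp: E_scale)
lemma eword_zero: "set js \<subseteq> L \<Longrightarrow> eword js 0 = 0" 
  by (induction js) (auto simp: E_zero)
lemma eword_sum: "set js \<subseteq> L \<Longrightarrow> eword js (\<Sum>x\<in>S. g x) = (\<Sum>x\<in>S. eword js (g x))"
  by (induction S rule: infinite_finite_induct) (auto simp: eword_zero eword_add)
end

lemma sum_list_map_zero: "(\<And>x. x \<in> set xs \<Longrightarrow> f x = 0) \<Longrightarrow> sum_list (map f xs) = (0::'a::comm_monoid_add)"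
  by (induction xs) auto

text \<open>
  The terms of \<open>E\<^sub>k F\<^bsub>i1\<^esub> \<cdots> F\<^bsub>iN\<^esub> vac\<close>, obtained by moving \<open>E\<^sub>k\<close> to the right: it cancels one of the letters
  \<open>k\<close>, and the coefficient is the weight of the rest of the word at the coroot \<open>k\<close>.
\<close>

fun lowering :: "(nat \<Rightarrow> nat \<Rightarrow> complex) \<Rightarrow> (nat \<Rightarrow> complex) \<Rightarrow> nat \<Rightarrow> nat list \<Rightarrow> (complex \<times> nat list) list" where
  "lowering A lam k [] = []"
| "lowering A lam k (i # is) = (if i = k then [(lam k - (\<Sum>j\<leftarrow>is. A k j), is)] else [])
     @ map (\<lambda>(c, js). (c, i # js)) (lowering A lam k is)"

text \<open>
  The coefficient of the vacuum in a raising word applied to a lowering word. For equal lengths it is a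
  universal function of the Cartan integers and the highest weight.
\<close>

fun pairing :: "(nat \<Rightarrow> nat \<Rightarrow> complex) \<Rightarrow> (nat \<Rightarrow> complex) \<Rightarrow> nat list \<Rightarrow> nat list \<Rightarrow> complex" where
  "pairing A lam [] is = (if is = [] then 1 else 0)"
| "pairing A lam (k # ks) is = (\<Sum>(c, js)\<leftarrow>lowering A lam k is. c * pairing A lam ks js)"

lemma lowering_set: "(c, js) \<in> set (lowering A lam k is) \<Longrightarrow> set js \<subseteq> set is \<and> k \<in> set is \<and> Suc (length js) = length is"
  by (induction "is" arbitrary: c js) (fastforce split: if_splits)+

lemma lowering_cong:
  assumes "\<And>i. i \<in> set is \<Longrightarrow> lam i = lam' i" "\<And>i j. i \<in> set is \<Longrightarrow> j \<in> set is \<Longrightarrow> A i j = A' i j"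
  shows "lowering A lam k is = lowering A' lam' k is"
  using assms
proof (induction "is")
  case (Cons i "is")
  have "(\<Sum>j\<leftarrow>is. A i j) = (\<Sum>j\<leftarrow>is. A' i j)"
    using Cons.prems(2) by (intro arg_cong[where f = sum_list] map_cong) auto
  then show ?case using Cons by auto
qed simp

lemma pairing_cong:
  assumes "\<And>i. i \<in> set is \<Longrightarrow> lam i = lam' i" "\<And>i j. i \<in> set is \<Longrightarrow> j \<in> set is \<Longrightarrow> A i j = A' i j"
  shows "pairing A lam ks is = pairing A' lam' ks is"
  using assms
proof (induction ks arbitrary: "is")
  case (Cons k ks)
  have lc: "lowering A' lam' k is = lowering A lam k is"
    using lowering_cong[of "is" lam lam' A A' k] Cons.prems by simp
  have meq: "map (\<lambda>(c, js). c * pairing A lam ks js) (lowering A lam k is) =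
     map (\<lambda>(c, js). c * pairing A' lam' ks js) (lowering A lam k is)"
  proof (intro map_cong refl, clarify)
    fix c js assume a: "(c, js) \<in> set (lowering A lam k is)"
    have "set js \<subseteq> set is" using lowering_set[OF a] by blast
    then have "pairing A lam ks js = pairing A' lam' ks js" using Cons.prems by (intro Cons.IH) blast+
    then show "c * pairing A lam ks js = c * pairing A' lam' ks js" by simp
  qed
  show ?case unfolding pairing.simps lc meq by (rule refl)
qed simp

context chevalley begin

lemma E_fword:
  assumes "k \<in> L" "set is \<subseteq> L"
  shows "E k (fword is) = (\<Sum>(c, js)\<leftarrow>lowering A lam k is. scale c (fword js))"
  using assms(2)
proof (induction "is")
  case Nil then show ?case using assms by (simp add: E_vac)
next
  case (Cons i "is")
  have F_list: "F i (\<Sum>(c, js)\<leftarrow>xs. scale c (fword js)) = (\<Sum>(c, js)\<leftarrow>xs. scale c (F i (fword js)))" for xs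
    using Cons.prems by (induction xs) (auto simp: F_zero F_add F_scale)
  have 2: "sum_list (map ((\<lambda>(c, js). scale c (fword js)) \<circ> (\<lambda>(c, js). (c, i # js))) xs) = (\<Sum>(c, js)\<leftarrow>xs. scale c (F i (fword js)))" for xs
    by (induction xs) auto
  show ?case using Cons assms E_F[of k i "fword is"] by (simp add: H_fword F_list 2)
qed

lemma eword_list: "set js \<subseteq> L \<Longrightarrow> eword js (\<Sum>(c, is)\<leftarrow>xs. scale c (fword is)) = (\<Sum>(c, is)\<leftarrow>xs. scale c (eword js (fword is)))"
  by (induction xs) (auto simp: eword_zero eword_add eword_scale)

lemma eword_fword_pairing:
  assumes "set js \<subseteq> L" "set is \<subseteq> L" "length js = length is"
  shows "eword js (fword is) = scale (pairing A lam js is) vac"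
  using assms
proof (induction js arbitrary: "is")
  case (Cons k ks)
  let ?xs = "lowering A lam k is"
  have "eword (k # ks) (fword is) = (\<Sum>(c, is')\<leftarrow>?xs. scale c (eword ks (fword is')))"
    using Cons.prems by (simp add: E_fword eword_list)
  also have "\<dots> = (\<Sum>(c, is')\<leftarrow>?xs. scale (c * pairing A lam ks is') vac)"
  proof (intro arg_cong[where f = sum_list] map_cong refl, clarify)
    fix c is' assume a: "(c, is') \<in> set ?xs"
    then have "eword ks (fword is') = scale (pairing A lam ks is') vac"
      using lowering_set[OF a] Cons.prems by (intro Cons.IH) auto
    then show "scale c (eword ks (fword is')) = scale (c * pairing A lam ks is') vac" by simp
  qed
  also have "\<dots> = scale (pairing A lam (k # ks) is) vac"
  proof -
    have "(\<Sum>(c, is')\<leftarrow>ys. scale (c * pairing A lam ks is') vac)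
        = scale (\<Sum>(c, is')\<leftarrow>ys. c * pairing A lam ks is') vac" for ys
      by (induction ys) (auto simp: scale_left_distrib)
    then show ?thesis by simp
  qed
  finally show ?case .
qed simp

lemma eword_fword_long:
  assumes "set js \<subseteq> L" "set is \<subseteq> L" "length is < length js"
  shows "eword js (fword is) = 0"
  using assms
proof (induction js arbitrary: "is")
  case (Cons k ks)
  let ?xs = "lowering A lam k is"
  have "eword (k # ks) (fword is) = (\<Sum>(c, is')\<leftarrow>?xs. scale c (eword ks (fword is')))"
    using Cons.prems by (simp add: E_fword eword_list)
  also have "\<dots> = 0"
  proof (rule sum_list_map_zero, clarify)
    fix c is' assume a: "(c, is') \<in> set ?xs"
    then have "eword ks (fword is') = 0"
      using lowering_set[OF a] Cons.prems by (intro Cons.IH) auto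
    then show "scale c (eword ks (fword is')) = 0" by simp
  qed
  finally show ?case .
qed simp

lemma eword_fword_short:
  assumes "set js \<subseteq> L" "set is \<subseteq> L" "length js < length is"
  shows "eword js (fword is) \<in> span (fword ` {is. is \<noteq> [] \<and> set is \<subseteq> L})"
  using assms
proof (induction js arbitrary: "is")
  case Nil
  then show ?case by (intro span_base) auto
next
  case (Cons k ks)
  let ?xs = "lowering A lam k is"
  have e: "eword (k # ks) (fword is) = (\<Sum>(c, is')\<leftarrow>?xs. scale c (eword ks (fword is')))"
    using Cons.prems by (simp add: E_fword eword_list)
  have "scale c (eword ks (fword is')) \<in> span (fword ` {is. is \<noteq> [] \<and> set is \<subseteq> L})" if "(c, is') \<in> set ?xs" for c is'
    using lowering_set[OF that] Cons.prems by (intro span_scale Cons.IH) auto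
  then have "(\<Sum>(c, is')\<leftarrow>ys. scale c (eword ks (fword is'))) \<in> span (fword ` {is. is \<noteq> [] \<and> set is \<subseteq> L})"
    if "set ys \<subseteq> set ?xs" for ys using that
    by (induction ys) (auto intro: span_zero span_add)
  then show ?case unfolding e by blast
qed

lemma sum_fword_zero_pairing:
  assumes "vac \<noteq> 0" "finite S" "\<And>is. is \<in> S \<Longrightarrow> set is \<subseteq> L \<and> length is = n"
    and "(\<Sum>is\<in>S. scale (c is) (fword is)) = 0" "set js \<subseteq> L" "length js = n"
  shows "(\<Sum>is\<in>S. c is * pairing A lam js is) = 0"
proof -
  have "0 = eword js (\<Sum>is\<in>S. scale (c is) (fword is))" using assms by (simp add: eword_zero)
  also have "\<dots> = (\<Sum>is\<in>S. scale (c is * pairing A lam js is) vac)"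
    using assms(1-3,5,6) by (simp add: eword_sum eword_scale eword_fword_pairing)
  also have "\<dots> = scale (\<Sum>is\<in>S. c is * pairing A lam js is) vac" by (simp add: scale_sum_left)
  finally show ?thesis using assms(1) by simp
qed

end

section \<open>Dimensions from linear relations\<close>

lemma (in vector_space) dim_family:
  fixes a :: "'i \<Rightarrow> 'b"
  assumes "finite S"
  obtains T where "T \<subseteq> S" "inj_on a T" "independent (a ` T)" "a ` S \<subseteq> span (a ` T)" "card T = dim (span (a ` S))"
proof -
  obtain B where B: "B \<subseteq> a ` S" "independent B" "a ` S \<subseteq> span B"
    using maximal_independent_subset by blast
  obtain T where T: "T \<subseteq> S" "inj_on a T" "B = a ` T"
    using B(1) by (metis subset_image_inj)
  have "span (a ` S) = span B"
    by (intro subset_antisym span_minimal[OF B(3) subspace_span] span_mono B(1))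
  then have "dim (span (a ` S)) = card B" by (intro dim_eq_card B(2)) (simp add: span_span)
  moreover have "card T = card B" using card_image[OF T(2)] T(3) by simp
  ultimately have "card T = dim (span (a ` S))" by simp
  then show ?thesis using T B by (intro that[of T]) auto
qed

lemma (in vector_space) independent_family_iff:
  assumes "finite T"
  shows "inj_on a T \<and> independent (a ` T) \<longleftrightarrow>
    (\<forall>c. (\<Sum>i\<in>T. scale (c i) (a i)) = 0 \<longrightarrow> (\<forall>i\<in>T. c i = 0))"
proof
  assume ii: "inj_on a T \<and> independent (a ` T)"
  show "\<forall>c. (\<Sum>i\<in>T. scale (c i) (a i)) = 0 \<longrightarrow> (\<forall>i\<in>T. c i = 0)"
  proof (intro allI impI ballI)
    fix c i assume s: "(\<Sum>i\<in>T. scale (c i) (a i)) = 0" and i: "i \<in> T"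
    have "(\<Sum>v\<in>a ` T. scale (c (inv_into T a v)) v) = 0"
      using s ii by (simp add: sum.reindex)
    then have "c (inv_into T a (a i)) = 0"
      using independentD[of "a ` T" "a ` T" "\<lambda>v. c (inv_into T a v)" "a i"] ii i assms by simp
    then show "c i = 0" using ii i by simp
  qed
next
  assume z: "\<forall>c. (\<Sum>i\<in>T. scale (c i) (a i)) = 0 \<longrightarrow> (\<forall>i\<in>T. c i = 0)"
  have inj: "inj_on a T"
  proof (rule inj_onI, rule ccontr)
    fix i j assume ij: "i \<in> T" "j \<in> T" "a i = a j" "i \<noteq> j"
    let ?c = "\<lambda>k. if k = i then (1::'a) else if k = j then -1 else 0"
    have "(\<Sum>k\<in>T. scale (?c k) (a k)) = (\<Sum>k\<in>{i, j}. scale (?c k) (a k))"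
      using ij assms by (intro sum.mono_neutral_right) auto
    also have "\<dots> = 0" using ij by simp
    finally have "?c i = 0" by (rule z[rule_format, OF _ ij(1)])
    then show False by simp
  qed
  have "independent (a ` T)"
  proof (rule independent_if_scalars_zero)
    fix f x assume "(\<Sum>x\<in>a ` T. scale (f x) x) = 0" "x \<in> a ` T"
    then have "(\<Sum>i\<in>T. scale (f (a i)) (a i)) = 0" using inj by (simp add: sum.reindex)
    then have "\<forall>i\<in>T. f (a i) = 0" using z[rule_format, of "\<lambda>i. f (a i)"] by blast
    then show "f x = 0" using \<open>x \<in> a ` T\<close> by blast
  qed (use assms in simp)
  then show "inj_on a T \<and> independent (a ` T)" using inj by blast
qed

text \<open>
  Families in different spaces: if all relations of \<open>b\<close> hold for \<open>a\<close>, a linearly independent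
  subfamily of \<open>a\<close> is independent in \<open>b\<close>.
\<close>

lemma dim_le_of_relations:
  fixes s1 :: "complex \<Rightarrow> 'v::ab_group_add \<Rightarrow> 'v" and s2 :: "complex \<Rightarrow> 'w::ab_group_add \<Rightarrow> 'w"
  assumes "vector_space s1" "vector_space s2" "finite S"
    and rel: "\<And>c. (\<Sum>i\<in>S. s2 (c i) (b i)) = 0 \<Longrightarrow> (\<Sum>i\<in>S. s1 (c i) (a i)) = 0"
  shows "vector_space.dim s1 (module.span s1 (a ` S)) \<le> vector_space.dim s2 (module.span s2 (b ` S))"
proof -
  interpret V: vector_space s1 by fact
  interpret W: vector_space s2 by fact
  obtain T where T: "T \<subseteq> S" "inj_on a T" "V.independent (a ` T)" "a ` S \<subseteq> V.span (a ` T)"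
      "card T = V.dim (V.span (a ` S))"
    by (rule V.dim_family[OF assms(3)])
  have finT: "finite T" using T(1) assms(3) finite_subset by blast
  have "\<forall>c. (\<Sum>i\<in>T. s2 (c i) (b i)) = 0 \<longrightarrow> (\<forall>i\<in>T. c i = 0)"
  proof (intro allI impI)
    fix c assume z: "(\<Sum>i\<in>T. s2 (c i) (b i)) = 0"
    let ?c = "\<lambda>i. if i \<in> T then c i else 0"
    have "(\<Sum>i\<in>S. s2 (?c i) (b i)) = (\<Sum>i\<in>T. s2 (?c i) (b i))"
      using T(1) assms(3) by (intro sum.mono_neutral_right) auto
    also have "\<dots> = 0" using z by simp
    finally have "(\<Sum>i\<in>S. s1 (?c i) (a i)) = 0" by (rule rel)
    moreover have "(\<Sum>i\<in>S. s1 (?c i) (a i)) = (\<Sum>i\<in>T. s1 (?c i) (a i))"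
      using T(1) assms(3) by (intro sum.mono_neutral_right) auto
    ultimately have "(\<Sum>i\<in>T. s1 (c i) (a i)) = 0" by simp
    then show "\<forall>i\<in>T. c i = 0" using V.independent_family_iff[OF finT] T(2,3) by blast
  qed
  then have bT: "inj_on b T" "W.independent (b ` T)" using W.independent_family_iff[OF finT] by blast+
  obtain U where U: "U \<subseteq> S" "inj_on b U" "W.independent (b ` U)" "b ` S \<subseteq> W.span (b ` U)"
      "card U = W.dim (W.span (b ` S))"
    by (rule W.dim_family[OF assms(3)])
  have "card (b ` T) \<le> card (b ` U)"
  proof -
    have "finite (b ` U)" using U(1) assms(3) finite_subset by blast
    moreover have "b ` T \<subseteq> W.span (b ` U)" using image_mono[OF T(1), of b] U(4) by (rule subset_trans)
    ultimately show ?thesis using W.independent_span_bound bT(2) by blast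
  qed
  then show ?thesis using T(5) U(5) card_image[OF bT(1)] card_image[OF U(2)] by simp
qed

section \<open>Powers of the spin representation\<close>

text \<open>
  The spin representation of \<open>B\<^sub>l\<close> has a basis indexed by the subsets of the sites \<open>{1..l}\<close>. The
  lowering operator \<open>0\<close> occupies site \<open>1\<close>, and the operator \<open>i > 0\<close> moves a particle from site \<open>i\<close> to
  an empty site \<open>i + 1\<close>. In the \<open>m\<close>-fold tensor power a state has a subset \<open>s a\<close> for each layer
  \<open>a < m\<close>, and the operators act as the sum over the layers. As all matrix entries are \<open>0\<close> or \<open>1\<close>,
  raising and lowering operators are transposes of each other.
\<close>

type_synonym state = "nat \<Rightarrow> nat set"

definition toggle :: "nat \<Rightarrow> nat set \<Rightarrow> nat set" where
  "toggle i t = {x. (x \<in> t) \<noteq> (x = Suc i \<or> i \<noteq> 0 \<and> x = i)}"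

text \<open>
  The configurations after and before a move \<open>i\<close>. The case \<open>i = 0\<close> stands for a reservoir that can
  always supply and absorb a particle.
\<close>

definition hopped :: "nat \<Rightarrow> nat set \<Rightarrow> bool" where "hopped i t \<longleftrightarrow> Suc i \<in> t \<and> (i = 0 \<or> i \<notin> t)"
definition hoppable :: "nat \<Rightarrow> nat set \<Rightarrow> bool" where "hoppable i t \<longleftrightarrow> Suc i \<notin> t \<and> (i = 0 \<or> i \<in> t)"
definition charge :: "nat \<Rightarrow> nat set \<Rightarrow> complex" where
  "charge i t = (if hoppable i t then 1 else if hopped i t then -1 else 0)"

lemma toggle_toggle [simp]: "toggle i (toggle i t) = t" by (auto simp: toggle_def)
lemma hopped_toggle [simp]: "hopped i (toggle i t) = hoppable i t" by (auto simp: toggle_def hopped_def hoppable_def)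
lemma hoppable_toggle [simp]: "hoppable i (toggle i t) = hopped i t" by (auto simp: toggle_def hopped_def hoppable_def)
lemma not_both: "hopped i t \<Longrightarrow> \<not> hoppable i t" by (auto simp: hopped_def hoppable_def)
lemma toggle_commute: "toggle i (toggle k t) = toggle k (toggle i t)" by (auto simp: toggle_def)

text \<open>
  Moves at distant vertices are independent. At adjacent vertices neither composition is possible,
  since a move down at one vertex closes the way for a move up at the other one.
\<close>

lemma hop_exclusive:
  "i \<noteq> k \<Longrightarrow> hoppable k t \<and> hopped i (toggle k t) \<longleftrightarrow> hopped i t \<and> hoppable k (toggle i t)"
  by (auto simp: toggle_def hopped_def hoppable_def)

lemma hop_layer:
  fixes g :: "nat set \<Rightarrow> complex"
  shows "(if hoppable k t then if hopped i (toggle k t) then g (toggle i (toggle k t)) else 0 else 0) =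
   (if hopped i t then if hoppable k (toggle i t) then g (toggle k (toggle i t)) else 0 else 0)
    + (if i = k then charge i t * g t else 0)"
proof (cases "i = k")
  case True then show ?thesis using not_both[of k t] by (auto simp: charge_def)
next
  case False
  then show ?thesis using hop_exclusive[OF False, of t] toggle_commute[of i k t] by auto
qed

text \<open>
  The Cartan matrix of type \<open>B\<close> of infinite rank, with the short root at \<open>0\<close>.
\<close>

definition cartan_B :: "nat \<Rightarrow> nat \<Rightarrow> complex" where
  "cartan_B k i = (if k = i then 2 else if k = 0 \<and> i = 1 then -2 else if k = Suc i \<or> i = Suc k then -1 else 0)"

lemma charge_toggle: "hopped i t \<Longrightarrow> charge k (toggle i t) = charge k t + cartan_B k i"
proof -
  assume h: "hopped i t"
  consider "k = i" | "k = Suc i" | "i = Suc k" | "k \<noteq> i" "k \<noteq> Suc i" "i \<noteq> Suc k" by blast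
  then show ?thesis
    using h by cases (auto simp: charge_def cartan_B_def hopped_def hoppable_def toggle_def)
qed

text \<open>
  Vectors are functions on states, so an operator evaluates its argument at the state before the move.
\<close>

definition hop1 :: "nat \<Rightarrow> nat \<Rightarrow> (state \<Rightarrow> complex) \<Rightarrow> state \<Rightarrow> complex" where
  "hop1 i a \<phi> s = (if hopped i (s a) then \<phi> (s(a := toggle i (s a))) else 0)"
definition unhop1 :: "nat \<Rightarrow> nat \<Rightarrow> (state \<Rightarrow> complex) \<Rightarrow> state \<Rightarrow> complex" where
  "unhop1 i a \<phi> s = (if hoppable i (s a) then \<phi> (s(a := toggle i (s a))) else 0)"
definition hop :: "nat \<Rightarrow> nat \<Rightarrow> (state \<Rightarrow> complex) \<Rightarrow> state \<Rightarrow> complex" where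
  "hop m i \<phi> s = (\<Sum>a<m. hop1 i a \<phi> s)"
definition unhop :: "nat \<Rightarrow> nat \<Rightarrow> (state \<Rightarrow> complex) \<Rightarrow> state \<Rightarrow> complex" where
  "unhop m i \<phi> s = (\<Sum>a<m. unhop1 i a \<phi> s)"
definition charge_op :: "nat \<Rightarrow> nat \<Rightarrow> (state \<Rightarrow> complex) \<Rightarrow> state \<Rightarrow> complex" where
  "charge_op m i \<phi> s = (\<Sum>a<m. charge i (s a)) * \<phi> s"
definition vacuum :: "state \<Rightarrow> complex" where "vacuum s = (if s = (\<lambda>_. {}) then 1 else 0)"

lemma unhop1_hop1: "unhop1 k a (hop1 i b \<phi>) s = hop1 i b (unhop1 k a \<phi>) s + (if a = b \<and> i = k then charge i (s a) * \<phi> s else 0)"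
proof (cases "a = b")
  case True
  then have ba: "b = a" by simp
  show ?thesis unfolding ba using hop_layer[of k "s a" i "\<lambda>t. \<phi> (s(a := t))"]
    by (simp only: unhop1_def hop1_def fun_upd_same fun_upd_upd fun_upd_triv simp_thms)
next
  case False
  then show ?thesis by (simp add: unhop1_def hop1_def fun_upd_twist)
qed

lemma hop1_sum: "hop1 i b (\<lambda>s. \<Sum>a\<in>S. g a s) s = (\<Sum>a\<in>S. hop1 i b (g a) s)"
  and unhop1_sum: "unhop1 i b (\<lambda>s. \<Sum>a\<in>S. g a s) s = (\<Sum>a\<in>S. unhop1 i b (g a) s)"
  by (simp_all add: hop1_def unhop1_def)

lemma unhop_hop: "unhop m k (hop m i \<phi>) = hop m i (unhop m k \<phi>) + (if k = i then charge_op m k \<phi> else 0)"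
proof
  fix s
  have "unhop m k (hop m i \<phi>) s = (\<Sum>a<m. \<Sum>b<m. unhop1 k a (hop1 i b \<phi>) s)"
    unfolding unhop_def hop_def[abs_def] by (simp add: unhop1_sum)
  also have "\<dots> = (\<Sum>a<m. \<Sum>b<m. hop1 i b (unhop1 k a \<phi>) s) + (\<Sum>a<m. \<Sum>b<m. if a = b \<and> i = k then charge i (s a) * \<phi> s else 0)"
    by (simp add: unhop1_hop1 sum.distrib)
  also have "(\<Sum>a<m. \<Sum>b<m. hop1 i b (unhop1 k a \<phi>) s) = (\<Sum>b<m. \<Sum>a<m. hop1 i b (unhop1 k a \<phi>) s)"
    by (rule sum.swap)
  also have "\<dots> = hop m i (unhop m k \<phi>) s"
    unfolding hop_def unhop_def[abs_def] by (simp add: hop1_sum)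
  also have "(\<Sum>a<m. \<Sum>b<m. if a = b \<and> i = k then charge i (s a) * \<phi> s else 0) = (if k = i then charge_op m k \<phi> else 0) s"
    by (auto simp: charge_op_def sum_distrib_right)
  finally show "unhop m k (hop m i \<phi>) s = (hop m i (unhop m k \<phi>) + (if k = i then charge_op m k \<phi> else 0)) s" by simp
qed

lemma charge_op_hop: "charge_op m k (hop m i \<phi>) = hop m i (charge_op m k \<phi>) - (\<lambda>s. cartan_B k i * hop m i \<phi> s)"
proof
  fix s
  have "hop1 i b (charge_op m k \<phi>) s = (\<Sum>a<m. charge k (s a)) * hop1 i b \<phi> s + cartan_B k i * hop1 i b \<phi> s" if "b < m" for b
  proof (cases "hopped i (s b)")
    case True
    let ?s = "s(b := toggle i (s b))"
    have "(\<Sum>a<m. charge k (?s a)) = charge k (?s b) + (\<Sum>a\<in>{..<m} - {b}. charge k (?s a))"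
      using that by (intro sum.remove) auto
    also have "(\<Sum>a\<in>{..<m} - {b}. charge k (?s a)) = (\<Sum>a\<in>{..<m} - {b}. charge k (s a))"
      by (intro sum.cong) auto
    also have "charge k (?s b) = charge k (s b) + cartan_B k i" using charge_toggle[OF True] by simp
    finally have "(\<Sum>a<m. charge k (?s a)) = cartan_B k i + (charge k (s b) + (\<Sum>a\<in>{..<m} - {b}. charge k (s a)))"
      by simp
    also have "charge k (s b) + (\<Sum>a\<in>{..<m} - {b}. charge k (s a)) = (\<Sum>a<m. charge k (s a))"
      using that by (intro sum.remove[symmetric]) auto
    finally show ?thesis using True by (simp add: hop1_def charge_op_def algebra_simps)
  next
    case False then show ?thesis by (simp add: hop1_def)
  qed
  then have "hop m i (charge_op m k \<phi>) s = (\<Sum>b<m. (\<Sum>a<m. charge k (s a)) * hop1 i b \<phi> s + cartan_B k i * hop1 i b \<phi> s)"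
    unfolding hop_def by simp
  also have "\<dots> = charge_op m k (hop m i \<phi>) s + cartan_B k i * hop m i \<phi> s"
    by (simp add: sum.distrib charge_op_def hop_def sum_distrib_left)
  finally show "charge_op m k (hop m i \<phi>) s = (hop m i (charge_op m k \<phi>) - (\<lambda>s. cartan_B k i * hop m i \<phi> s)) s" by simp
qed

lemma hop1_add: "hop1 i a (\<phi> + \<psi>) s = hop1 i a \<phi> s + hop1 i a \<psi> s"
  and hop1_scale: "hop1 i a (\<lambda>s. c * \<phi> s) s = c * hop1 i a \<phi> s"
  and unhop1_add: "unhop1 i a (\<phi> + \<psi>) s = unhop1 i a \<phi> s + unhop1 i a \<psi> s"
  and unhop1_scale: "unhop1 i a (\<lambda>s. c * \<phi> s) s = c * unhop1 i a \<phi> s"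
  by (simp_all add: hop1_def unhop1_def)

lemma hop_add: "hop m i (\<phi> + \<psi>) = hop m i \<phi> + hop m i \<psi>"
  and hop_scale: "hop m i (\<lambda>s. c * \<phi> s) = (\<lambda>s. c * hop m i \<phi> s)"
  and unhop_add: "unhop m i (\<phi> + \<psi>) = unhop m i \<phi> + unhop m i \<psi>"
  and unhop_scale: "unhop m i (\<lambda>s. c * \<phi> s) = (\<lambda>s. c * unhop m i \<phi> s)"
  by (simp_all add: fun_eq_iff hop_def unhop_def hop1_add hop1_scale unhop1_add unhop1_scale sum.distrib sum_distrib_left)

lemma unhop_vacuum: "unhop m i vacuum = 0"
proof
  fix s
  have "unhop1 i a vacuum s = 0" for a
  proof (cases "hoppable i (s a)")
    case True
    then have "Suc i \<in> toggle i (s a)" by (simp add: toggle_def hoppable_def)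
    then have "s(a := toggle i (s a)) \<noteq> (\<lambda>_. {})" by (metis empty_iff fun_upd_same)
    then show ?thesis by (simp add: unhop1_def vacuum_def)
  qed (simp add: unhop1_def)
  then show "unhop m i vacuum s = 0 s" by (simp add: unhop_def)
qed

lemma charge_op_vacuum: "charge_op m i vacuum = (\<lambda>s. (if i = 0 then of_nat m else 0) * vacuum s)"
  by (auto simp: fun_eq_iff charge_op_def vacuum_def charge_def hoppable_def hopped_def)

interpretation fock: chevalley "\<lambda>(c::complex) (\<phi>::state \<Rightarrow> complex) s. c * \<phi> s" L "unhop m" "hop m" "charge_op m" vacuum
    cartan_B "\<lambda>i. if i = 0 then of_nat m else 0" for m L
  by unfold_locales (auto simp: unhop_add unhop_scale hop_add hop_scale unhop_hop charge_op_hop unhop_vacuum charge_op_vacuum)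

definition states :: "nat \<Rightarrow> nat \<Rightarrow> state set" where
  "states m l = {s. \<forall>a. s a \<subseteq> (if a < m then {1..l} else {})}"

lemma states_iff: "s \<in> states m l \<longleftrightarrow> (\<forall>a. (a \<in> {..<m} \<longrightarrow> s a \<in> Pow {1..l}) \<and> (a \<notin> {..<m} \<longrightarrow> s a = {}))"
  unfolding states_def by (auto split: if_splits)

lemma finite_states: "finite (states m l)"
proof -
  have "states m l = {s. \<forall>a. (a \<in> {..<m} \<longrightarrow> s a \<in> Pow {1..l}) \<and> (a \<notin> {..<m} \<longrightarrow> s a = {})}"
    by (rule Set.set_eqI) (simp only: mem_Collect_eq states_iff)
  then show ?thesis using finite_set_of_finite_funs[of "{..<m}" "Pow {1..l}" "{}"] by simp
qed

lemma toggle_states: "a < m \<Longrightarrow> i < l \<Longrightarrow> s(a := toggle i (s a)) \<in> states m l \<longleftrightarrow> s \<in> states m l"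
proof -
  assume a: "a < m" "i < l"
  have 1: "s(a := toggle i (s a)) \<in> states m l" if "s \<in> states m l" for s
  proof -
    have "s a \<subseteq> {1..l}" using that a(1) by (simp add: states_iff)
    then have "toggle i (s a) \<subseteq> {1..l}" using a(2) by (auto simp: toggle_def)
    then show ?thesis using that a(1) unfolding states_iff by simp
  qed
  show ?thesis using 1[of s] 1[of "s(a := toggle i (s a))"] by auto
qed

definition inner_product :: "nat \<Rightarrow> nat \<Rightarrow> (state \<Rightarrow> complex) \<Rightarrow> (state \<Rightarrow> complex) \<Rightarrow> complex" where
  "inner_product m l \<phi> \<psi> = (\<Sum>s\<in>states m l. \<phi> s * \<psi> s)"

text \<open>
  A move in a layer is a bijection between the states where it is possible and their images.
\<close>

lemma adjoint:
  assumes "i < l" shows "inner_product m l (hop m i \<phi>) \<psi> = inner_product m l \<phi> (unhop m i \<psi>)"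
proof -
  have layer: "(\<Sum>s\<in>states m l. hop1 i a \<phi> s * \<psi> s) = (\<Sum>s\<in>states m l. \<phi> s * unhop1 i a \<psi> s)" if "a < m" for a
  proof (rule sum.reindex_bij_witness[of _ "\<lambda>s. s(a := toggle i (s a))" "\<lambda>s. s(a := toggle i (s a))"])
  qed (use toggle_states[OF that assms] in \<open>auto simp: hop1_def unhop1_def\<close>)
  have "inner_product m l (hop m i \<phi>) \<psi> = (\<Sum>a<m. \<Sum>s\<in>states m l. hop1 i a \<phi> s * \<psi> s)"
    unfolding inner_product_def hop_def by (simp add: sum_distrib_right) (rule sum.swap)
  also have "\<dots> = (\<Sum>a<m. \<Sum>s\<in>states m l. \<phi> s * unhop1 i a \<psi> s)" by (intro sum.cong refl layer) simp
  also have "\<dots> = inner_product m l \<phi> (unhop m i \<psi>)"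
    unfolding inner_product_def unhop_def by (simp add: sum_distrib_left) (rule sum.swap)
  finally show ?thesis .
qed

abbreviation fock_word :: "nat \<Rightarrow> nat list \<Rightarrow> state \<Rightarrow> complex" where
  "fock_word m \<equiv> chevalley.fword (hop m) vacuum"

lemma fock_word_simps: "fock_word m [] = vacuum" "fock_word m (i # is) = hop m i (fock_word m is)"
  by (simp_all only: fock.fword_simps)

lemma fock_word_real: "cnj (fock_word m is s) = fock_word m is s"
  by (induction "is" arbitrary: s) (auto simp: fock_word_simps vacuum_def hop_def hop1_def intro!: sum.cong)

lemma fock_word_support: "set is \<subseteq> {..<l} \<Longrightarrow> s \<notin> states m l \<Longrightarrow> fock_word m is s = 0"
proof (induction "is" arbitrary: s)
  case Nil
  then have "s \<noteq> (\<lambda>_. {})" by (auto simp: states_iff)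
  then have "vacuum s = 0" by (simp add: vacuum_def)
  then show ?case by (simp only: fock_word_simps)
next
  case (Cons i "is")
  have "hop1 i a (fock_word m is) s = 0" if "a < m" for a
    using Cons toggle_states[OF that, of i l s] by (auto simp: hop1_def)
  then show ?case unfolding fock_word_simps hop_def[of m i "fock_word m is" s] by simp
qed

lemma inner_product_word:
  assumes "set js \<subseteq> {..<l}"
  shows "inner_product m l (fock_word m js) \<psi> = inner_product m l vacuum (chevalley.eword (unhop m) js \<psi>)"
  using assms
proof (induction js arbitrary: \<psi>)
  case Nil then show ?case by simp
next
  case (Cons j js) then show ?case by (simp add: adjoint)
qed

text \<open>
  If the pairings with all raising words vanish, the combination is orthogonal to every lowering word.
  Lowering words have real coefficients, so it is also orthogonal to its own complex conjugate.
\<close>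

lemma fock_relation:
  assumes "finite S" "\<And>is. is \<in> S \<Longrightarrow> set is \<subseteq> {..<l} \<and> length is = n"
    and zero: "\<And>js. set js \<subseteq> {..<l} \<Longrightarrow> length js = n \<Longrightarrow>
      (\<Sum>is\<in>S. c is * pairing cartan_B (\<lambda>i. if i = 0 then of_nat m else 0) js is) = 0"
  shows "(\<Sum>is\<in>S. (\<lambda>s. c is * fock_word m is s)) = 0"
proof -
  let ?lam = "\<lambda>i. if i = 0 then of_nat m else 0 :: complex"
  define U where "U = (\<Sum>is\<in>S. (\<lambda>s. c is * fock_word m is s))"
  have orth: "inner_product m l (fock_word m js) U = 0" if js: "js \<in> S" for js
  proof -
    have jl: "set js \<subseteq> {..<l}" "length js = n" using assms(2)[OF js] by auto
    have "chevalley.eword (unhop m) js U = (\<Sum>is\<in>S. (\<lambda>s. c is * chevalley.eword (unhop m) js (fock_word m is) s))"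
      unfolding U_def using jl by (simp add: fock.eword_sum[of _ "{..<l}"] fock.eword_scale[of _ "{..<l}"])
    also have "\<dots> = (\<Sum>is\<in>S. (\<lambda>s. c is * (pairing cartan_B ?lam js is * vacuum s)))"
      using assms(2) jl by (intro sum.cong refl) (simp add: fock.eword_fword_pairing[of _ "{..<l}"])
    also have "\<dots> = (\<lambda>s. (\<Sum>is\<in>S. c is * pairing cartan_B ?lam js is) * vacuum s)"
      by (rule ext) (simp only: fun_sum_apply sum_distrib_right mult.assoc)
    also have "\<dots> = 0" using zero[OF jl] by (simp add: fun_eq_iff)
    finally show ?thesis using inner_product_word[OF jl(1), of m U] by (simp add: inner_product_def)
  qed
  have "(\<Sum>s\<in>states m l. cnj (U s) * U s) = (\<Sum>js\<in>S. cnj (c js) * inner_product m l (fock_word m js) U)"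
  proof -
    have "(\<Sum>s\<in>states m l. cnj (U s) * U s) = (\<Sum>s\<in>states m l. \<Sum>js\<in>S. cnj (c js) * (fock_word m js s * U s))"
    proof (intro sum.cong refl)
      fix s
      have "cnj (U s) = (\<Sum>js\<in>S. cnj (c js) * fock_word m js s)"
        unfolding U_def by (simp add: fun_sum_apply fock_word_real)
      then show "cnj (U s) * U s = (\<Sum>js\<in>S. cnj (c js) * (fock_word m js s * U s))"
        by (simp add: sum_distrib_right mult.assoc)
    qed
    also have "\<dots> = (\<Sum>js\<in>S. \<Sum>s\<in>states m l. cnj (c js) * (fock_word m js s * U s))" by (rule sum.swap)
    finally show ?thesis by (simp add: inner_product_def sum_distrib_left)
  qed
  then have "(\<Sum>s\<in>states m l. cnj (U s) * U s) = 0" using orth by simp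
  moreover have "complex_of_real (\<Sum>s\<in>states m l. (cmod (U s))\<^sup>2) = (\<Sum>s\<in>states m l. cnj (U s) * U s)"
    unfolding of_real_sum complex_norm_square by (simp only: mult.commute)
  ultimately have "complex_of_real (\<Sum>s\<in>states m l. (cmod (U s))\<^sup>2) = 0" by simp
  then have "(\<Sum>s\<in>states m l. (cmod (U s))\<^sup>2) = 0" by (simp only: of_real_eq_0_iff)
  then have "\<forall>s\<in>states m l. U s = 0"
    using finite_states by (simp add: sum_nonneg_eq_0_iff)
  moreover have "U s = 0" if "s \<notin> states m l" for s
    unfolding U_def fun_sum_apply using assms(2) fock_word_support[OF _ that] by (intro sum.neutral) auto
  ultimately show ?thesis unfolding U_def[symmetric] by (auto simp: fun_eq_iff)
qed

section \<open>Creation operators\<close>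

text \<open>
  The root vector for the short root \<open>- \<epsilon>\<^sub>j\<close>, which creates a particle at site \<open>j\<close>. The sign counts the
  particles that the new one has to pass on its way from site \<open>1\<close>.
\<close>

definition create1 :: "nat \<Rightarrow> nat \<Rightarrow> (state \<Rightarrow> complex) \<Rightarrow> state \<Rightarrow> complex" where
  "create1 j a \<phi> s = (if j \<in> s a then (-1) ^ card (s a \<inter> {1..<j}) * \<phi> (s(a := s a - {j})) else 0)"
definition create :: "nat \<Rightarrow> nat \<Rightarrow> (state \<Rightarrow> complex) \<Rightarrow> state \<Rightarrow> complex" where
  "create m j \<phi> s = (\<Sum>a<m. create1 j a \<phi> s)"

lemma hop_0: "hop m 0 = create m (Suc 0)"
proof -
  have "hop1 0 a \<phi> s = create1 (Suc 0) a \<phi> s" for a \<phi> s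
  proof (cases "Suc 0 \<in> s a")
    case True
    then have "toggle 0 (s a) = s a - {Suc 0}" by (auto simp: toggle_def)
    then show ?thesis using True by (simp add: hop1_def create1_def hopped_def)
  qed (simp add: hop1_def create1_def hopped_def)
  then show ?thesis by (simp add: fun_eq_iff hop_def create_def)
qed

lemma create1_add: "create1 j a (\<phi> + \<psi>) s = create1 j a \<phi> s + create1 j a \<psi> s"
  and create1_scale: "create1 j a (\<lambda>s. c * \<phi> s) s = c * create1 j a \<phi> s"
  and create1_sum: "create1 j a (\<lambda>s. \<Sum>b\<in>S. g b s) s = (\<Sum>b\<in>S. create1 j a (g b) s)"
  by (simp_all add: create1_def algebra_simps sum_distrib_left)

lemma create_add: "create m j (\<phi> + \<psi>) = create m j \<phi> + create m j \<psi>"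
  and create_scale: "create m j (\<lambda>s. c * \<phi> s) = (\<lambda>s. c * create m j \<phi> s)"
  by (simp_all add: fun_eq_iff create_def create1_add create1_scale sum.distrib sum_distrib_left)

text \<open>
  For \<open>i > 0\<close> the only nonzero commutators of \<open>f\<^sub>i\<close> with creation operators are
  \<open>[f\<^sub>i, X\<^sub>i] = X\<^bsub>i + 1\<^esub>\<close>.
\<close>

lemma create1_layer:
  fixes g :: "nat set \<Rightarrow> complex"
  assumes "1 \<le> i"
  shows "(if hopped i t then if j \<in> toggle i t then (-1) ^ card (toggle i t \<inter> {1..<j}) * g (toggle i t - {j}) else 0 else 0)
    = (if j \<in> t then (-1) ^ card (t \<inter> {1..<j}) * (if hopped i (t - {j}) then g (toggle i (t - {j})) else 0) else 0)
      + (if i = j then if Suc i \<in> t then (-1) ^ card (t \<inter> {1..<Suc i}) * g (t - {Suc i}) else 0 else 0)"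
proof -
  consider (same) "j = i" | (adj) "j = Suc i" | (low) "j < i" | (high) "Suc i < j" by linarith
  then show ?thesis
  proof cases
    case same
    have c: "t \<inter> {1..<Suc i} = (if i \<in> t then insert i (t \<inter> {1..<i}) else t \<inter> {1..<i})"
      using assms by (auto simp: less_Suc_eq)
    have d: "toggle i t \<inter> {1..<i} = t \<inter> {1..<i}" by (auto simp: toggle_def)
    have e: "Suc i \<in> t \<Longrightarrow> i \<notin> t \<Longrightarrow> toggle i t - {i} = t - {Suc i}" "Suc i \<in> t \<Longrightarrow> i \<in> t \<Longrightarrow> toggle i (t - {i}) = t - {Suc i}"
      using assms by (auto simp: toggle_def)
    show ?thesis
    proof (cases "Suc i \<in> t")
      case True
      show ?thesis
      proof (cases "i \<in> t")
        case it: True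
        have "\<not> hopped i t" "hopped i (t - {i})" using it True assms by (auto simp: hopped_def)
        then show ?thesis using same it True c e by simp
      next
        case False
        have "hopped i t" "i \<in> toggle i t" using False True assms by (auto simp: hopped_def toggle_def)
        then show ?thesis using same False True c d e by simp
      qed
    next
      case False
      then show ?thesis using same by (simp add: hopped_def)
    qed
  next
    case adj
    then show ?thesis by (auto simp: hopped_def toggle_def)
  next
    case low
    have "toggle i t \<inter> {1..<j} = t \<inter> {1..<j}" "j \<in> toggle i t \<longleftrightarrow> j \<in> t" "hopped i (t - {j}) = hopped i t"
      "toggle i t - {j} = toggle i (t - {j})" using low by (auto simp: hopped_def toggle_def)
    then show ?thesis using low by simp
  next
    case high
    have e: "j \<in> toggle i t \<longleftrightarrow> j \<in> t" "hopped i (t - {j}) = hopped i t" "toggle i t - {j} = toggle i (t - {j})"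
      using high by (auto simp: hopped_def toggle_def)
    have "card (toggle i t \<inter> {1..<j}) = card (t \<inter> {1..<j})" if h: "hopped i t"
    proof -
      let ?R = "t \<inter> {1..<j} - {Suc i}"
      have "toggle i t \<inter> {1..<j} = insert i ?R" "i \<notin> ?R" "t \<inter> {1..<j} = insert (Suc i) ?R"
        using h assms high by (auto simp: toggle_def hopped_def)
      moreover have "Suc i \<notin> ?R" "finite ?R" by auto
      ultimately show ?thesis by (metis card_insert_disjoint)
    qed
    then show ?thesis using high e by simp
  qed
qed

lemma hop1_create1:
  assumes "1 \<le> i"
  shows "hop1 i b (create1 j a \<phi>) s = create1 j a (hop1 i b \<phi>) s + (if a = b \<and> i = j then create1 (Suc i) a \<phi> s else 0)"
proof (cases "a = b")
  case True
  then have ba: "b = a" by simp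
  show ?thesis unfolding ba using create1_layer[OF assms, of "s a" j "\<lambda>t. \<phi> (s(a := t))"]
    by (simp only: create1_def hop1_def fun_upd_same fun_upd_upd fun_upd_triv simp_thms)
next
  case False
  then show ?thesis by (simp add: create1_def hop1_def fun_upd_twist)
qed

lemma hop_create:
  assumes "1 \<le> i"
  shows "hop m i (create m j \<phi>) = create m j (hop m i \<phi>) + (if i = j then create m (Suc i) \<phi> else 0)"
proof
  fix s
  have "hop m i (create m j \<phi>) s = (\<Sum>b<m. \<Sum>a<m. hop1 i b (create1 j a \<phi>) s)"
    unfolding hop_def create_def[abs_def] by (simp add: hop1_sum)
  also have "\<dots> = (\<Sum>b<m. \<Sum>a<m. create1 j a (hop1 i b \<phi>) s)
      + (\<Sum>b<m. \<Sum>a<m. if b = a then if i = j then create1 (Suc i) a \<phi> s else 0 else 0)"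
    unfolding hop1_create1[OF assms] sum.distrib by (intro arg_cong2[where f = "(+)"] refl sum.cong) auto
  also have "(\<Sum>b<m. \<Sum>a<m. create1 j a (hop1 i b \<phi>) s) = (\<Sum>a<m. \<Sum>b<m. create1 j a (hop1 i b \<phi>) s)"
    by (rule sum.swap)
  also have "\<dots> = create m j (hop m i \<phi>) s"
    unfolding create_def hop_def[abs_def] by (simp add: create1_sum)
  also have "(\<Sum>b<m. \<Sum>a<m. if b = a then if i = j then create1 (Suc i) a \<phi> s else 0 else 0)
      = (if i = j then create m (Suc i) \<phi> else 0) s"
    by (simp add: create_def)
  finally show "hop m i (create m j \<phi>) s = (create m j (hop m i \<phi>) + (if i = j then create m (Suc i) \<phi> else 0)) s" by simp
qed

definition creation_word :: "nat \<Rightarrow> nat list \<Rightarrow> state \<Rightarrow> complex" where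
  "creation_word m ys = foldr (create m) ys vacuum"

lemma creation_word_simps: "creation_word m [] = vacuum" "creation_word m (y # ys) = create m y (creation_word m ys)"
  by (simp_all add: creation_word_def)

lemma hop_vacuum: "1 \<le> i \<Longrightarrow> hop m i vacuum = 0"
proof
  fix s assume i: "1 \<le> i"
  have "hop1 i a vacuum s = 0" for a
  proof (cases "hopped i (s a)")
    case True
    then have "i \<in> toggle i (s a)" using i by (simp add: toggle_def hopped_def)
    then have "s(a := toggle i (s a)) \<noteq> (\<lambda>_. {})" by (metis empty_iff fun_upd_same)
    then show ?thesis by (simp add: hop1_def vacuum_def)
  qed (simp add: hop1_def)
  then show "hop m i vacuum s = 0 s" by (simp add: hop_def)
qed

text \<open>
  The multiplicity of the simple root \<open>k\<close> in the weight of a product of creation operators: \<open>X\<^sub>y\<close>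
  lowers the weight by the simple roots \<open>0, \<dots>, y - 1\<close>.
\<close>

definition content :: "nat list \<Rightarrow> nat \<Rightarrow> nat" where "content ys k = length (filter (\<lambda>y. k < y) ys)"

lemma linear_span_image:
  fixes T :: "(state \<Rightarrow> complex) \<Rightarrow> (state \<Rightarrow> complex)"
  assumes add: "\<And>f g. T (f + g) = T f + T g" and scale: "\<And>c f. T (\<lambda>s. c * f s) = (\<lambda>s. c * T f s)"
    and gen: "\<And>x. x \<in> A \<Longrightarrow> T x \<in> fun_space.span B" and x: "x \<in> fun_space.span A"
  shows "T x \<in> fun_space.span B"
proof -
  have z: "T 0 = 0" using scale[of 0 0] by (simp add: fun_eq_iff zero_fun_def)
  have "fun_space.subspace {x. T x \<in> fun_space.span B}"
    by (rule fun_space.subspaceI) (auto simp: z add scale intro: fun_space.span_zero fun_space.span_add fun_space.span_scale)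
  then have "fun_space.span A \<subseteq> {x. T x \<in> fun_space.span B}" using gen by (intro fun_space.span_minimal) auto
  then show ?thesis using x by blast
qed

definition creation_words :: "nat \<Rightarrow> (nat \<Rightarrow> nat) \<Rightarrow> (state \<Rightarrow> complex) set" where
  "creation_words m c = creation_word m ` {ys. (\<forall>y\<in>set ys. 1 \<le> y) \<and> content ys = c}"
definition hop_words :: "nat \<Rightarrow> (nat \<Rightarrow> nat) \<Rightarrow> (state \<Rightarrow> complex) set" where
  "hop_words m c = fock_word m ` {is. count_list is = c}"

lemma creation_wordsI: "\<forall>y\<in>set ys. 1 \<le> y \<Longrightarrow> content ys = c \<Longrightarrow> creation_word m ys \<in> fun_space.span (creation_words m c)"
  by (intro fun_space.span_base) (auto simp: creation_words_def)

lemma hop_wordsI: "count_list is = c \<Longrightarrow> fock_word m is \<in> fun_space.span (hop_words m c)"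
  by (intro fun_space.span_base) (auto simp: hop_words_def)

lemma content_Nil: "content [] = count_list []"
  by (auto simp: content_def)

lemma create_creation_words:
  assumes "1 \<le> y" "x \<in> fun_space.span (creation_words m c)"
  shows "create m y x \<in> fun_space.span (creation_words m (\<lambda>k. c k + (if k < y then 1 else 0)))"
  using assms(2)
proof (rule linear_span_image[OF create_add create_scale, rotated])
  fix x assume "x \<in> creation_words m c"
  then obtain ys where ys: "\<forall>y\<in>set ys. 1 \<le> y" "content ys = c" "x = creation_word m ys" by (auto simp: creation_words_def)
  have "create m y x = creation_word m (y # ys)" by (simp add: creation_word_simps ys)
  moreover have "content (y # ys) = (\<lambda>k. c k + (if k < y then 1 else 0))"
    using ys(2) by (auto simp: fun_eq_iff content_def)
  ultimately show "create m y x \<in> fun_space.span (creation_words m (\<lambda>k. c k + (if k < y then 1 else 0)))"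
    using assms(1) ys by (intro fun_space.span_base) (auto simp: creation_words_def)
qed

text \<open>
  A move commutes past the creation operators, replacing some \<open>X\<^sub>i\<close> by \<open>X\<^bsub>i + 1\<^esub>\<close>, until it kills the
  vacuum.
\<close>

lemma hop_creation_word:
  assumes "\<forall>y\<in>set ys. 1 \<le> y"
  shows "hop m i (creation_word m ys) \<in> fun_space.span (creation_words m (\<lambda>k. content ys k + (if k = i then 1 else 0)))"
proof (cases "i = 0")
  case True
  have "create m 1 (creation_word m ys) \<in> fun_space.span (creation_words m (\<lambda>k. content ys k + (if k < 1 then 1 else 0)))"
    using assms by (intro create_creation_words fun_space.span_base) (auto simp: creation_words_def)
  then show ?thesis using True by (simp add: hop_0)
next
  case False
  then have i: "1 \<le> i" by simp
  show ?thesis using assms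
  proof (induction ys)
    case Nil
    show ?case unfolding creation_word_simps hop_vacuum[OF i] by (rule fun_space.span_zero)
  next
    case (Cons y ys)
    let ?c = "\<lambda>k. content ys k + (if k = i then 1 else 0)"
    have 1: "create m y (hop m i (creation_word m ys)) \<in> fun_space.span (creation_words m (\<lambda>k. ?c k + (if k < y then 1 else 0)))"
      using Cons by (intro create_creation_words) auto
    have c1: "(\<lambda>k. ?c k + (if k < y then 1 else 0)) = (\<lambda>k. content (y # ys) k + (if k = i then 1 else 0))"
      by (auto simp: fun_eq_iff content_def)
    have 2: "create m (Suc i) (creation_word m ys) \<in> fun_space.span (creation_words m (\<lambda>k. content (y # ys) k + (if k = i then 1 else 0)))"
      if "i = y"
    proof -
      have "create m (Suc i) (creation_word m ys) \<in> fun_space.span (creation_words m (\<lambda>k. content ys k + (if k < Suc i then 1 else 0)))"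
        using Cons.prems by (intro create_creation_words fun_space.span_base) (auto simp: creation_words_def)
      moreover have "(\<lambda>k. content ys k + (if k < Suc i then 1 else 0)) = (\<lambda>k. content (y # ys) k + (if k = i then 1 else 0))"
        using that by (auto simp: fun_eq_iff content_def)
      ultimately show ?thesis by simp
    qed
    show ?case
    proof (cases "i = y")
      case True
      show ?thesis unfolding creation_word_simps hop_create[OF i] if_P[OF True]
        by (rule fun_space.span_add[OF 1[unfolded c1] 2[OF True]])
    next
      case False
      show ?thesis unfolding creation_word_simps hop_create[OF i] if_not_P[OF False] add_0_right
        by (rule 1[unfolded c1])
    qed
  qed
qed

lemma fock_word_in_creation_words: "fock_word m is \<in> fun_space.span (creation_words m (count_list is))"
proof (induction "is")
  case Nil
  show ?case unfolding fock_word_simps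
    by (rule creation_wordsI[of "[]", unfolded creation_word_simps, OF _ content_Nil]) simp
next
  case (Cons i "is")
  have "hop m i (fock_word m is) \<in> fun_space.span (creation_words m (\<lambda>k. count_list is k + (if k = i then 1 else 0)))"
    using Cons
  proof (rule linear_span_image[OF hop_add hop_scale, rotated])
    fix x assume "x \<in> creation_words m (count_list is)"
    then obtain ys where ys: "\<forall>y\<in>set ys. 1 \<le> y" "content ys = count_list is" "x = creation_word m ys" by (auto simp: creation_words_def)
    then show "hop m i x \<in> fun_space.span (creation_words m (\<lambda>k. count_list is k + (if k = i then 1 else 0)))"
      using hop_creation_word[OF ys(1), of m i] by simp
  qed
  moreover have "(\<lambda>k. count_list is k + (if k = i then 1 else 0)) = count_list (i # is)"
    by (auto simp: fun_eq_iff)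
  ultimately show ?case unfolding fock_word_simps by (simp only:)
qed

lemma hop_hop_words:
  assumes "x \<in> fun_space.span (hop_words m c)"
  shows "hop m i x \<in> fun_space.span (hop_words m (\<lambda>k. c k + (if k = i then 1 else 0)))"
  using assms
proof (rule linear_span_image[OF hop_add hop_scale, rotated])
  fix x assume "x \<in> hop_words m c"
  then obtain "is" where "is": "count_list is = c" "x = fock_word m is" by (auto simp: hop_words_def)
  have "count_list (i # is) = (\<lambda>k. c k + (if k = i then 1 else 0))"
    using "is" by (auto simp: fun_eq_iff)
  from hop_wordsI[OF this]
  show "hop m i x \<in> fun_space.span (hop_words m (\<lambda>k. c k + (if k = i then 1 else 0)))"
    unfolding "is" fock_word_simps .
qed

text \<open>
  Creation operators are iterated commutators of moves.
\<close>

lemma create_hop_words: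
  assumes "x \<in> fun_space.span (hop_words m c)"
  shows "create m (Suc j) x \<in> fun_space.span (hop_words m (\<lambda>k. c k + (if k < Suc j then 1 else 0)))"
  using assms
proof (induction j arbitrary: x c)
  case 0
  then show ?case using hop_hop_words[of x m c 0] by (simp add: hop_0)
next
  case (Suc j)
  let ?T = "fun_space.span (hop_words m (\<lambda>k. c k + (if k < Suc (Suc j) then 1 else 0)))"
  have e: "create m (Suc (Suc j)) x = hop m (Suc j) (create m (Suc j) x) - create m (Suc j) (hop m (Suc j) x)"
    using hop_create[of "Suc j" m "Suc j" x] by simp
  have "hop m (Suc j) (create m (Suc j) x) \<in> ?T"
  proof -
    have "(\<lambda>k. c k + (if k < Suc j then 1 else 0) + (if k = Suc j then 1 else 0))
        = (\<lambda>k. c k + (if k < Suc (Suc j) then 1 else 0))" by (auto simp: fun_eq_iff)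
    then show ?thesis using hop_hop_words[OF Suc.IH[OF Suc.prems], of "Suc j"] by simp
  qed
  moreover have "create m (Suc j) (hop m (Suc j) x) \<in> ?T"
  proof -
    have "(\<lambda>k. c k + (if k = Suc j then 1 else 0) + (if k < Suc j then 1 else 0))
        = (\<lambda>k. c k + (if k < Suc (Suc j) then 1 else 0))" by (auto simp: fun_eq_iff)
    then show ?thesis using Suc.IH[OF hop_hop_words[OF Suc.prems, of "Suc j"]] by simp
  qed
  ultimately show ?case unfolding e by (rule fun_space.span_diff)
qed

lemma creation_word_in_hop_words:
  assumes "\<forall>y\<in>set ys. 1 \<le> y" shows "creation_word m ys \<in> fun_space.span (hop_words m (content ys))"
  using assms
proof (induction ys)
  case Nil
  show ?case unfolding creation_word_simps
    by (rule hop_wordsI[of "[]", unfolded fock_word_simps, OF content_Nil[symmetric]])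
next
  case (Cons y ys)
  then obtain j where j: "y = Suc j" by (cases y) auto
  have "(\<lambda>k. content ys k + (if k < Suc j then 1 else 0)) = content (y # ys)"
    using j by (auto simp: fun_eq_iff content_def)
  then show ?case using create_hop_words[of "creation_word m ys" m "content ys" j] Cons j by (simp add: creation_word_simps)
qed

lemma span_hop_words_creation_words: "fun_space.span (hop_words m c) = fun_space.span (creation_words m c)"
proof
  show "fun_space.span (hop_words m c) \<subseteq> fun_space.span (creation_words m c)"
    using fock_word_in_creation_words by (intro fun_space.span_minimal fun_space.subspace_span) (auto simp: hop_words_def)
  show "fun_space.span (creation_words m c) \<subseteq> fun_space.span (hop_words m c)"
    using creation_word_in_hop_words by (intro fun_space.span_minimal fun_space.subspace_span) (auto simp: creation_words_def)
qed

text \<open>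
  The weight of \<open>\<gamma> l\<close>: every site is created exactly once.
\<close>

lemma content_staircase:
  "(\<forall>y\<in>set ys. 1 \<le> y) \<and> content ys = (\<lambda>k. l - k) \<longleftrightarrow> distinct ys \<and> set ys = {1..l}"
proof -
  have step: "content ys k = content ys (Suc k) + count_list ys (Suc k)" for k
    by (induction ys) (auto simp: content_def)
  have card: "content ys k = card {y\<in>set ys. k < y}" if "distinct ys" for k
    using that distinct_card[of "filter (\<lambda>y. k < y) ys"] by (simp add: content_def)
  show ?thesis
  proof
    assume a: "(\<forall>y\<in>set ys. 1 \<le> y) \<and> content ys = (\<lambda>k. l - k)"
    have cnt: "count_list ys (Suc k) = (if k < l then 1 else 0)" for k
      using step[of k] a by (auto split: if_splits)
    have mem: "y \<in> set ys \<longleftrightarrow> y \<in> {1..l}" for y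
    proof (cases y)
      case 0 then show ?thesis using a by auto
    next
      case (Suc k)
      have "y \<in> set ys \<longleftrightarrow> count_list ys y \<noteq> 0" by (simp add: count_list_0_iff)
      then show ?thesis using cnt[of k] Suc by auto
    qed
    have "count_list ys y \<le> 1" for y
      using cnt mem[of y] a by (cases y) (auto simp: count_list_0_iff)
    moreover have "distinct zs" if "\<And>y. count_list zs y \<le> 1" for zs :: "nat list"
      using that
    proof (induction zs)
      case (Cons z zs)
      have "count_list zs z = 0" using Cons.prems[of z] by simp
      moreover have "count_list zs y \<le> 1" for y
        using Cons.prems[of y] by (auto split: if_splits)
      ultimately show ?case using Cons.IH by (simp add: count_list_0_iff)
    qed simp
    ultimately have "distinct ys" by blast
    then show "distinct ys \<and> set ys = {1..l}" using mem by blast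
  next
    assume a: "distinct ys \<and> set ys = {1..l}"
    have "content ys k = l - k" for k
    proof -
      have "{y\<in>set ys. k < y} = {Suc k..l}" using a by auto
      then show ?thesis using card a by simp
    qed
    then show "(\<forall>y\<in>set ys. 1 \<le> y) \<and> content ys = (\<lambda>k. l - k)" using a by auto
  qed
qed

definition word_state :: "(nat \<Rightarrow> nat) \<Rightarrow> nat set \<Rightarrow> state" where
  "word_state w Y = (\<lambda>a. {x\<in>Y. w x = a})"

text \<open>
  The parts of two creation operators in the same layer anticommute and those in different layers
  commute, so the sign of a creation word at a state counts inversions between sites of the same layer.
\<close>

fun same_sign :: "(nat \<Rightarrow> nat) \<Rightarrow> nat list \<Rightarrow> complex" where
  "same_sign w [] = 1"
| "same_sign w (y # ys) = (-1) ^ length (filter (\<lambda>x. x < y \<and> w x = w y) ys) * same_sign w ys"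

lemma creation_word_at_word_state:
  assumes "distinct ys" "\<forall>y\<in>set ys. 1 \<le> y \<and> w y < m"
  shows "creation_word m ys (word_state w (set ys)) = same_sign w ys"
  using assms
proof (induction ys)
  case Nil
  then show ?case by (simp add: creation_word_simps vacuum_def word_state_def)
next
  case (Cons y ys)
  let ?s = "word_state w (set (y # ys))"
  have other: "create1 y a (creation_word m ys) ?s = 0" if "a \<noteq> w y" for a
    using that by (simp add: create1_def word_state_def)
  have s: "?s(w y := ?s (w y) - {y}) = word_state w (set ys)"
    using Cons.prems by (auto simp: word_state_def fun_eq_iff)
  have "?s (w y) \<inter> {1..<y} = {x\<in>set ys. x < y \<and> w x = w y}"
    using Cons.prems by (auto simp: word_state_def)
  then have c: "card (?s (w y) \<inter> {1..<y}) = length (filter (\<lambda>x. x < y \<and> w x = w y) ys)"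
    using Cons.prems distinct_card[of "filter (\<lambda>x. x < y \<and> w x = w y) ys"] by simp
  have "creation_word m (y # ys) ?s = create1 y (w y) (creation_word m ys) ?s"
  proof -
    have "(\<Sum>a<m. create1 y a (creation_word m ys) ?s) = (\<Sum>a\<in>{w y}. create1 y a (creation_word m ys) ?s)"
      using Cons.prems other by (intro sum.mono_neutral_right) auto
    then show ?thesis by (simp add: creation_word_simps create_def)
  qed
  also have "\<dots> = same_sign w (y # ys)"
    using Cons s c by (simp add: create1_def) (simp add: word_state_def)
  finally show ?case .
qed

lemma creation_word_support:
  assumes "creation_word m ys s \<noteq> 0" "distinct ys"
  shows "\<exists>w. (\<forall>y\<in>set ys. w y < m) \<and> s = word_state w (set ys)"
  using assms
proof (induction ys arbitrary: s)
  case Nil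
  then show ?case by (auto simp: creation_word_simps vacuum_def word_state_def split: if_splits)
next
  case (Cons y ys)
  obtain a where a: "a < m" "create1 y a (creation_word m ys) s \<noteq> 0"
    using Cons.prems(1) unfolding creation_word_simps create_def by (metis lessThan_iff sum.neutral)
  then have y: "y \<in> s a" "creation_word m ys (s(a := s a - {y})) \<noteq> 0" by (auto simp: create1_def split: if_splits)
  then obtain w where w: "\<forall>y\<in>set ys. w y < m" "s(a := s a - {y}) = word_state w (set ys)"
    using Cons by auto
  have s: "s b = word_state (w(y := a)) (set (y # ys)) b" for b
    using fun_cong[OF w(2), of b] y(1) Cons.prems(2) by (cases "b = a") (auto simp: word_state_def split: if_splits)
  show ?case
  proof (intro exI conjI)
    show "s = word_state (w(y := a)) (set (y # ys))" by (rule ext) (rule s)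
  qed (use w(1) a(1) in simp)
qed

definition cross_sign :: "(nat \<Rightarrow> nat) \<Rightarrow> nat set \<Rightarrow> complex" where
  "cross_sign w Y = (\<Prod>x\<in>Y. \<Prod>y\<in>Y. if x < y \<and> w y < w x then -1 else 1)"

lemma sign_prod:
  "distinct ys \<Longrightarrow> (-1) ^ length (filter P ys) = (\<Prod>x\<in>set ys. if P x then -1 else (1::complex))"
  by (induction ys) auto

text \<open>
  The three signs count the inversions of the sites within a colour, of all the sites, and of the
  colours. What remains is the parity of the number of pairs of sites, independent of their
  arrangement, on which colours and sites are ordered oppositely. Thus, up to signs
  that depend either on the arrangement or on the colouring, creation words are colour signs.
\<close>

lemma sign_identity:
  assumes "distinct ys"
  shows "same_sign w ys * csgn ys * csgn (map w ys) = cross_sign w (set ys)"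
  using assms
proof (induction ys)
  case Nil then show ?case by (simp add: cross_sign_def)
next
  case (Cons y ys)
  then have d: "distinct ys" and y: "y \<notin> set ys" by auto
  let ?e = "\<lambda>P. if P then -1 else (1::complex)"
  have f: "filter (\<lambda>d. d < w y) (map w ys) = map w (filter (\<lambda>x. w x < w y) ys)" by (simp add: filter_map o_def)
  have "same_sign w (y # ys) * csgn (y # ys) * csgn (map w (y # ys)) =
     ((\<Prod>x\<in>set ys. ?e (x < y \<and> w x = w y)) * (\<Prod>x\<in>set ys. ?e (x < y)) * (\<Prod>x\<in>set ys. ?e (w x < w y)))
      * (same_sign w ys * csgn ys * csgn (map w ys))"
    by (simp add: f sign_prod[OF d])
  also have "(\<Prod>x\<in>set ys. ?e (x < y \<and> w x = w y)) * (\<Prod>x\<in>set ys. ?e (x < y)) * (\<Prod>x\<in>set ys. ?e (w x < w y))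
     = (\<Prod>x\<in>set ys. ?e (x < y \<and> w y < w x)) * (\<Prod>x\<in>set ys. ?e (y < x \<and> w x < w y))"
    unfolding prod.distrib[symmetric] using y
    by (intro prod.cong refl) (auto split: if_splits)
  also have "same_sign w ys * csgn ys * csgn (map w ys) = cross_sign w (set ys)" using Cons by simp
  also have "(\<Prod>x\<in>set ys. ?e (x < y \<and> w y < w x)) * (\<Prod>x\<in>set ys. ?e (y < x \<and> w x < w y)) * cross_sign w (set ys)
     = cross_sign w (set (y # ys))"
    using y by (simp add: cross_sign_def prod.distrib)
  finally show ?case .
qed

lemma span_scaled_image:
  assumes "\<And>i. i \<in> S \<Longrightarrow> c i \<noteq> (0::complex)"
  shows "fun_space.span ((\<lambda>i w. c i * g i w) ` S) = fun_space.span (g ` S)"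
proof
  show "fun_space.span ((\<lambda>i w. c i * g i w) ` S) \<subseteq> fun_space.span (g ` S)"
    by (intro fun_space.span_minimal fun_space.subspace_span) (auto intro: fun_space.span_scale fun_space.span_base)
  have "g i \<in> fun_space.span ((\<lambda>i w. c i * g i w) ` S)" if "i \<in> S" for i
  proof -
    have "(\<lambda>w. (1 / c i) * (c i * g i w)) \<in> fun_space.span ((\<lambda>i w. c i * g i w) ` S)"
      using that by (intro fun_space.span_scale fun_space.span_base) auto
    moreover have "(\<lambda>w. (1 / c i) * (c i * g i w)) = g i" using assms[OF that] by (simp add: fun_eq_iff)
    ultimately show ?thesis by simp
  qed
  then show "fun_space.span (g ` S) \<subseteq> fun_space.span ((\<lambda>i w. c i * g i w) ` S)"
    by (intro fun_space.span_minimal fun_space.subspace_span) auto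
qed

text \<open>
  Rescaling the arrangements and, via \<open>cross_sign\<close>, the colourings turns the values of creation words
  into the sign functions of \<open>dim_arrangements\<close>.
\<close>

lemma dim_creation_words:
  assumes "0 < m"
  shows "fun_space.dim (fun_space.span (creation_words m (\<lambda>k. l - k))) = card (avoiders m {1..l})"
proof -
  let ?P = "{ys. distinct ys \<and> set ys = {1..l}}"
  let ?b = "\<lambda>ys w. csgn ys * contraction m {1..l} id ys w"
  have finP: "finite ?P"
    by (rule finite_subset[OF _ finite_lists_length_eq[of "{1..l}" l]]) (auto dest: distinct_card)
  have xw: "creation_words m (\<lambda>k. l - k) = creation_word m ` ?P"
    unfolding creation_words_def using content_staircase by auto
  have link: "cross_sign w {1..l} * contraction m {1..l} id ys w * csgn ys
      = (if \<forall>x. w x < m then creation_word m ys (word_state w {1..l}) else 0)" if ys: "ys \<in> ?P" for ys w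
  proof (cases "\<forall>x. w x < m")
    case True
    have sq: "csgn cs * csgn cs = 1" for cs
      by (induction cs) (auto simp: power_mult_distrib[symmetric] algebra_simps simp flip: mult.assoc)
    have "cross_sign w {1..l} = same_sign w ys * csgn ys * csgn (map w ys)"
      using sign_identity[of ys w] ys by simp
    moreover have "creation_word m ys (word_state w {1..l}) = same_sign w ys"
      using creation_word_at_word_state[of ys w m] ys True by simp
    moreover have "contraction m {1..l} id ys w = csgn (map w ys)" using True by (simp add: contraction_def)
    moreover have "same_sign w ys * csgn ys * csgn (map w ys) * csgn (map w ys) * csgn ys
       = same_sign w ys * (csgn ys * csgn ys) * (csgn (map w ys) * csgn (map w ys))" by (simp only: ac_simps)
    ultimately show ?thesis using True by (simp add: sq)
  next
    case False then show ?thesis by (auto simp: contraction_def)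
  qed
  have total: "cross_sign w {1..l} * (\<Sum>ys\<in>?P. c ys * ?b ys w)
      = (if \<forall>x. w x < m then \<Sum>ys\<in>?P. c ys * creation_word m ys (word_state w {1..l}) else 0)" for c w
  proof -
    have "cross_sign w {1..l} * (\<Sum>ys\<in>?P. c ys * ?b ys w)
       = (\<Sum>ys\<in>?P. c ys * (cross_sign w {1..l} * contraction m {1..l} id ys w * csgn ys))"
      unfolding sum_distrib_left by (intro sum.cong refl) (simp only: ac_simps)
    also have "\<dots> = (\<Sum>ys\<in>?P. c ys * (if \<forall>x. w x < m then creation_word m ys (word_state w {1..l}) else 0))"
      by (intro sum.cong refl) (simp only: link)
    finally show ?thesis by (cases "\<forall>x. w x < m") auto
  qed
  have cs0: "cross_sign w {1..l} \<noteq> 0" for w by (auto simp: cross_sign_def)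
  have vs: "vector_space (\<lambda>(c::complex) (f::'x \<Rightarrow> complex) x. c * f x)" by (rule fun_space.vector_space_axioms)
  have rel1: "(\<Sum>ys\<in>?P. (\<lambda>w. c ys * ?b ys w)) = 0" if "(\<Sum>ys\<in>?P. (\<lambda>s. c ys * creation_word m ys s)) = 0" for c
  proof
    fix w
    have "(\<Sum>ys\<in>?P. c ys * creation_word m ys s) = 0" for s
      using fun_cong[OF that, of s] by (simp add: fun_sum_apply)
    then have "cross_sign w {1..l} * (\<Sum>ys\<in>?P. c ys * ?b ys w) = 0" unfolding total by simp
    then have "(\<Sum>ys\<in>?P. c ys * ?b ys w) = 0" using cs0 mult_eq_0_iff by blast
    then show "(\<Sum>ys\<in>?P. (\<lambda>w. c ys * ?b ys w)) w = 0 w" by (simp only: fun_sum_apply zero_fun_apply)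
  qed
  have rel2: "(\<Sum>ys\<in>?P. (\<lambda>s. c ys * creation_word m ys s)) = 0" if "(\<Sum>ys\<in>?P. (\<lambda>w. c ys * ?b ys w)) = 0" for c
  proof
    fix s
    show "(\<Sum>ys\<in>?P. (\<lambda>s. c ys * creation_word m ys s)) s = 0 s"
    proof (cases "\<exists>w. (\<forall>y\<in>{1..l}. w y < m) \<and> s = word_state w {1..l}")
      case True
      then obtain w0 where w0: "\<forall>y\<in>{1..l}. w0 y < m" "s = word_state w0 {1..l}" by blast
      define w where "w y = (if y \<in> {1..l} then w0 y else 0)" for y
      have w: "\<forall>y. w y < m" "s = word_state w {1..l}"
        using w0 assms by (auto simp: w_def word_state_def fun_eq_iff)
      have "(\<Sum>ys\<in>?P. c ys * ?b ys w) = 0"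
        using fun_cong[OF that, of w] by (simp only: fun_sum_apply zero_fun_apply)
      then have "(\<Sum>ys\<in>?P. c ys * creation_word m ys s) = 0" using total[of w c] w(1) unfolding w(2) by simp
      then show ?thesis by (simp only: fun_sum_apply zero_fun_apply)
    next
      case False
      have "creation_word m ys s = 0" if "ys \<in> ?P" for ys
        using creation_word_support[of m ys s] that False by auto
      then show ?thesis by (simp add: fun_sum_apply)
    qed
  qed
  have "fun_space.dim (fun_space.span (creation_word m ` ?P)) = fun_space.dim (fun_space.span (?b ` ?P))"
    using dim_le_of_relations[OF vs vs finP, of "creation_word m" ?b] dim_le_of_relations[OF vs vs finP, of ?b "creation_word m"] rel1 rel2
    by (intro antisym) blast+
  also have "fun_space.span (?b ` ?P) = fun_space.span (arrangements m {1..l})"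
    unfolding arrangements_def by (rule span_scaled_image) (rule csgn_nonzero)
  also have "fun_space.dim (fun_space.span (arrangements m {1..l})) = fun_space.dim (arrangements m {1..l})"
    by (rule fun_space.dim_span)
  also have "\<dots> = card (avoiders m {1..l})" using assms by (intro dim_arrangements) auto
  finally show ?thesis unfolding xw .
qed

theorem dim_fock_words:
  "0 < m \<Longrightarrow> fun_space.dim (fun_space.span (fock_word m ` {is. count_list is = (\<lambda>k. l - k)})) = card (avoiders m {1..l})"
  using dim_creation_words span_hop_words_creation_words by (simp add: hop_words_def)

section \<open>Irreducible highest weight modules\<close>

context irreducible_highest_weight_module begin

definition hw_vector :: 'v where
  "hw_vector = (SOME v. v \<noteq> 0 \<and> (\<forall>x \<in> subalgebra hull (e ` {..<m}). act x v = 0) \<and>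
      (\<forall>h. act (cartan h) v = vscale (\<Lambda> h) v) \<and> submodule hull {v} = UNIV)"

lemma hw_vector: "hw_vector \<noteq> 0" "i < m \<Longrightarrow> act (e i) hw_vector = 0" "act (cartan h) hw_vector = vscale (\<Lambda> h) hw_vector"
  "submodule hull {hw_vector} = UNIV"
proof -
  have *: "hw_vector \<noteq> 0 \<and> (\<forall>x \<in> subalgebra hull (e ` {..<m}). act x hw_vector = 0) \<and>
      (\<forall>h. act (cartan h) hw_vector = vscale (\<Lambda> h) hw_vector) \<and> submodule hull {hw_vector} = UNIV"
    unfolding hw_vector_def by (rule someI_ex[OF highest_weight_vector])
  then show "hw_vector \<noteq> 0" "act (cartan h) hw_vector = vscale (\<Lambda> h) hw_vector" "submodule hull {hw_vector} = UNIV" by blast+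
  show "act (e i) hw_vector = 0" if "i < m"
  proof -
    have "e i \<in> subalgebra hull (e ` {..<m})" using that by (intro hull_inc) auto
    then show ?thesis using * by blast
  qed
qed

lemma act_zero_left: "act 0 v = 0"
  using act_add_left[of 0 0 v] by simp
lemma act_zero_right: "act x 0 = 0"
  using act_add_right[of x 0 0] by simp

lemma act_e_f:
  assumes "i < m" "j < m"
  shows "act (e i) (act (f j) u) = act (f j) (act (e i) u) + (if i = j then act (cartan (coroot i)) u else 0)"
  using act_bracket[of "e i" "f j" u] e_f[OF assms] by (auto simp: act_zero_left algebra_simps)

lemma act_cartan_f:
  assumes "j < m" shows "act (cartan h) (act (f j) u) = act (f j) (act (cartan h) u) - vscale (\<alpha> j h) (act (f j) u)"
proof -
  have "act (bracket (cartan h) (f j)) u = vscale (- \<alpha> j h) (act (f j) u)"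
    by (simp only: cartan_f[OF assms] act_scale_left)
  then show ?thesis using act_bracket[of "cartan h" "f j" u] by (simp add: algebra_simps)
qed

lemma act_cartan_e:
  assumes "j < m" shows "act (e j) (act (cartan h) u) = act (cartan h) (act (e j) u) - vscale (\<alpha> j h) (act (e j) u)"
  using act_bracket[of "cartan h" "e j" u] cartan_e[OF assms, of h] by (simp add: act_scale_left algebra_simps)

sublocale hw: chevalley vscale "{..<m}" "\<lambda>i. act (e i)" "\<lambda>i. act (f i)" "\<lambda>i. act (cartan (coroot i))" hw_vector
    "\<lambda>i j. of_int (A i j)" "\<lambda>i. \<Lambda> (coroot i)"
  by unfold_locales (auto simp: act_add_right act_scale_right act_e_f act_cartan_f hw_vector R.root_coroot)

definition word_weight :: "nat list \<Rightarrow> 'h \<Rightarrow> complex" where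
  "word_weight is h = \<Lambda> h - (\<Sum>j\<leftarrow>is. \<alpha> j h)"

lemma cartan_fword:
  "set is \<subseteq> {..<m} \<Longrightarrow> act (cartan h) (hw.fword is) = vscale (word_weight is h) (hw.fword is)"
  by (induction "is") (auto simp: word_weight_def hw_vector act_cartan_f act_scale_right V.scale_left_diff_distrib[symmetric] diff_diff_eq add.commute)

abbreviation wspace where "wspace \<equiv> weight_space cartan vscale act"

lemma subspace_wspace: "V.subspace (wspace \<mu>)"
  by (rule V.subspaceI) (auto simp: weight_space_def act_zero_right act_add_right act_scale_right V.scale_right_distrib mult.commute)

lemma act_span:
  assumes "\<And>u. u \<in> S \<Longrightarrow> act x u \<in> V.span T" "u \<in> V.span S"
  shows "act x u \<in> V.span T"
proof -
  have "V.subspace {u. act x u \<in> V.span T}"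
    by (rule V.subspaceI) (auto simp: act_zero_right act_add_right act_scale_right
        intro: V.span_zero V.span_add V.span_scale)
  then have "V.span S \<subseteq> {u. act x u \<in> V.span T}" using assms(1) by (intro V.span_minimal) auto
  then show ?thesis using assms(2) by blast
qed

lemma submoduleI:
  assumes W: "V.subspace W" and c: "\<And>h w. w \<in> W \<Longrightarrow> act (cartan h) w \<in> W"
    and e: "\<And>i w. i < m \<Longrightarrow> w \<in> W \<Longrightarrow> act (e i) w \<in> W"
    and f: "\<And>i w. i < m \<Longrightarrow> w \<in> W \<Longrightarrow> act (f i) w \<in> W"
  shows "submodule W"
proof -
  let ?T = "{x. \<forall>w\<in>W. act x w \<in> W}"
  have "subalgebra ?T"
    unfolding subalgebra_def
  proof (intro conjI ballI)
    show "subspace ?T"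
      by (rule subspaceI) (auto simp: act_zero_left act_add_left act_scale_left
          intro: V.subspace_0[OF W] V.subspace_add[OF W] V.subspace_scale[OF W])
  qed (auto simp: act_bracket intro: V.subspace_diff[OF W])
  moreover have "range cartan \<union> e ` {..<m} \<union> f ` {..<m} \<subseteq> ?T" using c e f by auto
  ultimately have "UNIV \<subseteq> ?T" unfolding generated[symmetric] by (intro hull_minimal)
  then show ?thesis using W unfolding submodule_def by blast
qed

abbreviation vwords where "vwords \<equiv> {is. set is \<subseteq> {..<m}}"

lemma fword_span: "is \<in> W \<Longrightarrow> vscale c (hw.fword is) \<in> V.span (hw.fword ` W)"
  by (intro V.span_scale V.span_base imageI)

text \<open>
  The span of the lowering words is stable under the generators of the Lie algebra.
\<close>

lemma span_vwords: "V.span (hw.fword ` vwords) = UNIV"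
proof -
  let ?P = "V.span (hw.fword ` vwords)"
  have "submodule ?P"
  proof (rule submoduleI)
    show "V.subspace ?P" by (rule V.subspace_span)
    fix h w assume "w \<in> ?P"
    then show "act (cartan h) w \<in> ?P"
      by (rule act_span[rotated]) (auto simp: cartan_fword intro!: fword_span)
  next
    fix i w assume i: "i < m" and w: "w \<in> ?P"
    show "act (f i) w \<in> ?P"
    proof (rule act_span[OF _ w])
      fix u assume "u \<in> hw.fword ` vwords"
      then obtain "is" where "is": "set is \<subseteq> {..<m}" "u = hw.fword is" by blast
      then have "act (f i) u = hw.fword (i # is)" by simp
      then show "act (f i) u \<in> ?P" using i "is" by (intro V.span_base image_eqI[of _ _ "i # is"]) auto
    qed
    show "act (e i) w \<in> ?P"
    proof (rule act_span[OF _ w])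
      fix u assume "u \<in> hw.fword ` vwords"
      then obtain "is" where "is": "set is \<subseteq> {..<m}" "u = hw.fword is" by blast
      let ?xs = "lowering (\<lambda>i j. of_int (A i j)) (\<lambda>i. \<Lambda> (coroot i)) i is"
      have "(\<Sum>(c, js)\<leftarrow>ys. vscale c (hw.fword js)) \<in> ?P" if "set ys \<subseteq> set ?xs" for ys
        using that
      proof (induction ys)
        case (Cons y ys)
        obtain c js where y: "y = (c, js)" by (cases y)
        have "set js \<subseteq> {..<m}" using lowering_set[of c js] Cons.prems y "is"(1) by fastforce
        then have 1: "vscale c (hw.fword js) \<in> ?P" by (intro fword_span) simp
        have "(\<Sum>(c, js)\<leftarrow>ys. vscale c (hw.fword js)) \<in> ?P" using Cons by simp
        from V.span_add[OF 1 this] show ?case using y by simp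
      qed (simp add: V.span_zero)
      then show "act (e i) u \<in> ?P" using hw.E_fword[of i "is"] i "is" by simp
    qed
  qed
  moreover have "hw.fword [] \<in> ?P" by (intro V.span_base imageI) simp
  ultimately have "submodule hull {hw_vector} \<subseteq> ?P" by (intro hull_minimal) simp_all
  then show ?thesis using hw_vector(4) by blast
qed

text \<open>
  Vectors of different weights are separated by the Cartan operators.
\<close>

lemma weight_vectors_independent:
  assumes "finite M" "\<And>\<mu>. \<mu> \<in> M \<Longrightarrow> u \<mu> \<in> wspace \<mu>" "(\<Sum>\<mu>\<in>M. u \<mu>) = 0" "\<mu> \<in> M"
  shows "u \<mu> = 0"
  using assms
proof (induction M arbitrary: u \<mu> rule: finite_induct)
  case empty then show ?case by simp
next
  case (insert \<nu> M)
  have act_sum: "act x (\<Sum>\<mu>\<in>M. u \<mu>) = (\<Sum>\<mu>\<in>M. act x (u \<mu>))" for x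
    by (induction M rule: infinite_finite_induct) (auto simp: act_zero_right act_add_right)
  have s: "u \<nu> + (\<Sum>\<mu>\<in>M. u \<mu>) = 0" using insert by simp
  have z: "u \<mu> = 0" if mu: "\<mu> \<in> M" for \<mu>
  proof -
    obtain h where h: "\<mu> h \<noteq> \<nu> h" using mu insert.hyps(2) by (metis ext)
    let ?w = "\<lambda>\<mu>. vscale (\<mu> h - \<nu> h) (u \<mu>)"
    have "vscale (\<nu> h) (u \<nu>) + (\<Sum>\<mu>\<in>M. vscale (\<mu> h) (u \<mu>)) = 0"
    proof -
      have "act (cartan h) (u \<nu> + (\<Sum>\<mu>\<in>M. u \<mu>)) = vscale (\<nu> h) (u \<nu>) + (\<Sum>\<mu>\<in>M. vscale (\<mu> h) (u \<mu>))"
        unfolding act_add_right act_sum using insert.prems(1)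
        by (intro arg_cong2[where f = "(+)"] sum.cong) (auto simp: weight_space_def)
      then show ?thesis using s by (simp add: act_zero_right)
    qed
    moreover have "vscale (\<nu> h) (u \<nu>) + (\<Sum>\<mu>\<in>M. vscale (\<nu> h) (u \<mu>)) = 0"
      using s by (metis V.scale_right_distrib V.scale_sum_right V.scale_zero_right)
    ultimately have "(\<Sum>\<mu>\<in>M. vscale (\<mu> h) (u \<mu>)) - (\<Sum>\<mu>\<in>M. vscale (\<nu> h) (u \<mu>)) = 0"
      by (metis add_left_cancel diff_self)
    then have "(\<Sum>\<mu>\<in>M. ?w \<mu>) = 0" by (simp add: V.scale_left_diff_distrib sum_subtractf)
    moreover have "?w \<mu> \<in> wspace \<mu>" if "\<mu> \<in> M" for \<mu>
      using insert.prems(1)[of \<mu>] that V.subspace_scale[OF subspace_wspace] by blast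
    ultimately have "?w \<mu> = 0" using insert.IH[of ?w \<mu>] mu by blast
    then show ?thesis using h by simp
  qed
  show ?case
  proof (cases "\<mu> \<in> M")
    case False
    then have "\<mu> = \<nu>" using insert.prems(3) by simp
    then show ?thesis using s z by simp
  qed (rule z)
qed

text \<open>
  Group a combination of words by weight: the components of weights other than \<open>\<nu>\<close> vanish by
  independence.
\<close>

lemma span_weight_component:
  assumes Ws: "Ws \<subseteq> vwords" and u: "u \<in> V.span (hw.fword ` Ws)" "u \<in> wspace \<nu>"
  shows "u \<in> V.span (hw.fword ` {is\<in>Ws. word_weight is = \<nu>})"
proof -
  let ?S = "\<lambda>\<mu>. V.span (hw.fword ` {is\<in>Ws. word_weight is = \<mu>})"
  have S: "?S \<mu> \<subseteq> wspace \<mu>" for \<mu>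
    using Ws by (intro V.span_minimal subspace_wspace) (auto simp: weight_space_def cartan_fword)
  have "\<exists>M g. finite M \<and> (\<forall>\<mu>. g \<mu> \<in> ?S \<mu>) \<and> (\<forall>\<mu>. \<mu> \<notin> M \<longrightarrow> g \<mu> = 0) \<and> u = (\<Sum>\<mu>\<in>M. g \<mu>)"
    using u(1)
  proof (induction u rule: V.span_induct_alt)
    case base
    then show ?case by (intro exI[of _ "{}"] exI[of _ "\<lambda>_. 0"]) (auto intro: V.span_zero)
  next
    case (step c x y)
    obtain "is" where "is": "is \<in> Ws" "x = hw.fword is" using step by blast
    obtain M g where g: "finite M" "\<And>\<mu>. g \<mu> \<in> ?S \<mu>" "\<And>\<mu>. \<mu> \<notin> M \<Longrightarrow> g \<mu> = 0" "y = (\<Sum>\<mu>\<in>M. g \<mu>)"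
      using step by blast
    let ?w = "word_weight is" let ?M = "insert ?w M" let ?g = "g(?w := vscale c x + g ?w)"
    have "(\<Sum>\<mu>\<in>M. g \<mu>) = (\<Sum>\<mu>\<in>?M. g \<mu>)" using g(1,3) by (intro sum.mono_neutral_left) auto
    also have "\<dots> = g ?w + (\<Sum>\<mu>\<in>?M - {?w}. g \<mu>)" using g(1) by (intro sum.remove) auto
    finally have y: "y = g ?w + (\<Sum>\<mu>\<in>?M - {?w}. g \<mu>)" using g(4) by simp
    have "(\<Sum>\<mu>\<in>?M. ?g \<mu>) = ?g ?w + (\<Sum>\<mu>\<in>?M - {?w}. ?g \<mu>)" using g(1) by (intro sum.remove) auto
    also have "(\<Sum>\<mu>\<in>?M - {?w}. ?g \<mu>) = (\<Sum>\<mu>\<in>?M - {?w}. g \<mu>)" by (intro sum.cong) auto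
    finally have "vscale c x + y = (\<Sum>\<mu>\<in>?M. ?g \<mu>)" using y by (simp add: add.assoc)
    moreover have "?g \<mu> \<in> ?S \<mu>" for \<mu>
      using g(2) "is" by (auto intro!: V.span_add V.span_scale intro: V.span_base)
    moreover have "\<mu> \<notin> ?M \<Longrightarrow> ?g \<mu> = 0" for \<mu> using g(3) by auto
    moreover have "finite ?M" using g(1) by simp
    ultimately show ?case by blast
  qed
  then obtain M g where g: "finite M" "\<And>\<mu>. g \<mu> \<in> ?S \<mu>" "\<And>\<mu>. \<mu> \<notin> M \<Longrightarrow> g \<mu> = 0" "u = (\<Sum>\<mu>\<in>M. g \<mu>)"
    by blast
  let ?M = "insert \<nu> M" let ?g = "g(\<nu> := g \<nu> - u)"
  have "(\<Sum>\<mu>\<in>M. g \<mu>) = (\<Sum>\<mu>\<in>?M. g \<mu>)" using g(1,3) by (intro sum.mono_neutral_left) auto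
  then have "u = (\<Sum>\<mu>\<in>?M. g \<mu>)" using g(4) by simp
  also have "\<dots> = g \<nu> + (\<Sum>\<mu>\<in>?M - {\<nu>}. g \<mu>)" using g(1) by (intro sum.remove) auto
  finally have 1: "u = g \<nu> + (\<Sum>\<mu>\<in>?M - {\<nu>}. g \<mu>)" .
  have "(\<Sum>\<mu>\<in>?M. ?g \<mu>) = ?g \<nu> + (\<Sum>\<mu>\<in>?M - {\<nu>}. ?g \<mu>)" using g(1) by (intro sum.remove) auto
  also have "(\<Sum>\<mu>\<in>?M - {\<nu>}. ?g \<mu>) = (\<Sum>\<mu>\<in>?M - {\<nu>}. g \<mu>)" by (intro sum.cong) auto
  also have "?g \<nu> + (\<Sum>\<mu>\<in>?M - {\<nu>}. g \<mu>) = 0" using 1 by (simp add: algebra_simps)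
  finally have 2: "(\<Sum>\<mu>\<in>?M. ?g \<mu>) = 0" .
  have 3: "?g \<mu> \<in> wspace \<mu>" for \<mu>
    using g(2) S u(2) V.subspace_diff[OF subspace_wspace] by (cases "\<mu> = \<nu>") (auto, blast+)
  have "?g \<nu> = 0" by (rule weight_vectors_independent[OF _ 3 2]) (use g(1) in auto)
  then show ?thesis using g(2)[of \<nu>] by simp
qed

lemma wspace_span: "wspace \<mu> = V.span (hw.fword ` {is\<in>vwords. word_weight is = \<mu>})"
proof
  show "wspace \<mu> \<subseteq> V.span (hw.fword ` {is\<in>vwords. word_weight is = \<mu>})"
    using span_weight_component[of vwords _ \<mu>] span_vwords by auto
  show "V.span (hw.fword ` {is\<in>vwords. word_weight is = \<mu>}) \<subseteq> wspace \<mu>"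
    by (intro V.span_minimal subspace_wspace) (auto simp: weight_space_def cartan_fword)
qed

lemma sum_list_roots: "set is \<subseteq> {..<m} \<Longrightarrow> (\<Sum>j\<leftarrow>is. \<alpha> j h) = (\<Sum>j<m. of_nat (count_list is j) * \<alpha> j h)"
proof (induction "is")
  case (Cons i "is")
  have "(\<Sum>j<m. of_nat (count_list (i # is) j) * \<alpha> j h)
      = (\<Sum>j<m. of_nat (count_list is j) * \<alpha> j h + (if j = i then \<alpha> j h else 0))"
    by (intro sum.cong) (auto simp: algebra_simps)
  then show ?case using Cons by (simp add: sum.distrib)
qed simp

lemma word_weight_eq_iff:
  assumes "set is \<subseteq> {..<m}"
  shows "word_weight is = (\<lambda>h. \<Lambda> h - (\<Sum>j<m. c j * \<alpha> j h)) \<longleftrightarrow> (\<forall>j<m. of_nat (count_list is j) = c j)"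
proof
  assume eq: "word_weight is = (\<lambda>h. \<Lambda> h - (\<Sum>j<m. c j * \<alpha> j h))"
  have "(\<Sum>j<m. (of_nat (count_list is j) - c j) * \<alpha> j h) = 0" for h
    using fun_cong[OF eq, of h] sum_list_roots[OF assms, of h]
    by (simp add: word_weight_def left_diff_distrib sum_subtractf)
  then have "of_nat (count_list is j) - c j = 0" if "j < m" for j
    using R.root_independent[of "\<lambda>j. of_nat (count_list is j) - c j"] that by blast
  then show "\<forall>j<m. of_nat (count_list is j) = c j" by simp
next
  assume "\<forall>j<m. of_nat (count_list is j) = c j"
  then show "word_weight is = (\<lambda>h. \<Lambda> h - (\<Sum>j<m. c j * \<alpha> j h))"
    using sum_list_roots[OF assms] by (auto simp: word_weight_def fun_eq_iff intro!: sum.cong)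
qed

definition lower_part where "lower_part = V.span (hw.fword ` {is. is \<noteq> [] \<and> set is \<subseteq> {..<m}})"

lemma subspace_lower_part: "V.subspace lower_part"
  unfolding lower_part_def by (rule V.subspace_span)

lemma hw_vector_not_lower: "hw_vector \<notin> lower_part"
proof
  assume "hw_vector \<in> lower_part"
  moreover have "hw_vector \<in> wspace \<Lambda>" by (simp add: weight_space_def hw_vector)
  ultimately have *: "hw_vector \<in> V.span (hw.fword ` {is \<in> {is. is \<noteq> [] \<and> set is \<subseteq> {..<m}}. word_weight is = \<Lambda>})"
    unfolding lower_part_def by (intro span_weight_component) auto
  have "word_weight is \<noteq> \<Lambda>" if "is": "is \<noteq> []" "set is \<subseteq> {..<m}" for "is"
  proof
    assume "word_weight is = \<Lambda>"
    then have "\<forall>j<m. of_nat (count_list is j) = (0::complex)"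
      using word_weight_eq_iff[OF "is"(2), of "\<lambda>_. 0"] by simp
    moreover have "hd is \<in> set is" "hd is < m" using "is" by (auto dest: hd_in_set)
    ultimately show False by (auto simp: count_list_0_iff)
  qed
  then have none: "{is \<in> {is. is \<noteq> [] \<and> set is \<subseteq> {..<m}}. word_weight is = \<Lambda>} = {}" by blast
  have "hw_vector = 0" using * unfolding none by simp
  then show False using hw_vector(1) by simp
qed

lemma cartan_lower: "u \<in> lower_part \<Longrightarrow> act (cartan h) u \<in> lower_part"
  unfolding lower_part_def
  by (rule act_span[rotated]) (auto simp: cartan_fword intro!: fword_span)

lemma f_lower: "i < m \<Longrightarrow> act (f i) u \<in> lower_part"
  unfolding lower_part_def
proof (rule act_span[of "hw.fword ` vwords"])
  fix w assume i: "i < m" and "w \<in> hw.fword ` vwords"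
  then obtain "is" where "is": "set is \<subseteq> {..<m}" "w = hw.fword is" by blast
  then have "act (f i) w = hw.fword (i # is)" by simp
  then show "act (f i) w \<in> V.span (hw.fword ` {is. is \<noteq> [] \<and> set is \<subseteq> {..<m}})"
    using i "is" by (intro V.span_base image_eqI[of _ _ "i # is"]) auto
qed (simp add: span_vwords)

text \<open>
  The vectors from which no raising word leads back to the highest weight vector. They form a proper
  submodule, which is zero by irreducibility. Therefore the pairings detect whether a combination of
  lowering words vanishes.
\<close>

definition radical where "radical = {u. \<forall>js. set js \<subseteq> {..<m} \<longrightarrow> hw.eword js u \<in> lower_part}"

lemma eword_cartan:
  "set js \<subseteq> {..<m} \<Longrightarrow> hw.eword js (act (cartan h) u) =
     act (cartan h) (hw.eword js u) - vscale (\<Sum>j\<leftarrow>js. \<alpha> j h) (hw.eword js u)"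
proof (induction js arbitrary: u)
  case (Cons j js)
  have m1: "hw.eword js (a - b) = hw.eword js a - hw.eword js b" for a b
    using hw.eword_add[of js a "- b"] hw.eword_add[of js "- b" b] Cons.prems hw.eword_zero[of js]
    by (simp add: eq_neg_iff_add_eq_0[symmetric])
  show ?case using Cons by (simp add: act_cartan_e m1 hw.eword_scale V.scale_left_distrib algebra_simps)
qed simp

lemma radical_zero: "radical = {0}"
proof -
  have sub: "V.subspace radical"
    by (rule V.subspaceI) (auto simp: radical_def hw.eword_zero hw.eword_add hw.eword_scale
        intro: V.subspace_0[OF subspace_lower_part] V.subspace_add[OF subspace_lower_part] V.subspace_scale[OF subspace_lower_part])
  have e: "act (e i) u \<in> radical" if "i < m" "u \<in> radical" for i u
    unfolding radical_def
  proof (intro CollectI allI impI)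
    fix js assume "set js \<subseteq> {..<m}"
    then have "hw.eword (i # js) u \<in> lower_part" using that unfolding radical_def by (auto simp del: hw.eword_simps)
    then show "hw.eword js (act (e i) u) \<in> lower_part" by simp
  qed
  have c: "act (cartan h) u \<in> radical" if "u \<in> radical" for h u
    using that unfolding radical_def
    by (auto simp: eword_cartan intro!: V.subspace_diff[OF subspace_lower_part] cartan_lower V.subspace_scale[OF subspace_lower_part])
  have "hw.eword js (act (f i) u) \<in> lower_part" if "i < m" "u \<in> radical" "set js \<subseteq> {..<m}" for i u js
    using that(2,3)
  proof (induction js arbitrary: u)
    case Nil then show ?case using f_lower that(1) by simp
  next
    case (Cons j js)
    have "hw.eword js (act (f i) (act (e j) u)) \<in> lower_part" using Cons e by auto
    moreover have "hw.eword js (act (cartan (coroot j)) u) \<in> lower_part"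
      using c[OF Cons.prems(1)] Cons.prems(2) by (auto simp: radical_def)
    ultimately show ?case using Cons.prems that(1)
      by (auto simp: act_e_f hw.eword_add hw.eword_zero intro: V.subspace_add[OF subspace_lower_part])
  qed
  then have "submodule radical" using sub c e by (intro submoduleI) (auto simp: radical_def)
  moreover have "hw_vector \<notin> radical"
  proof
    assume "hw_vector \<in> radical"
    then have "hw.eword [] hw_vector \<in> lower_part" unfolding radical_def by (auto simp del: hw.eword_simps)
    then show False using hw_vector_not_lower by simp
  qed
  ultimately show ?thesis using irreducible by blast
qed

text \<open>
  Raising words of other lengths cannot reach the highest weight vector, so for words of equal
  length only the pairings matter.
\<close>

lemma fword_relation:
  assumes "finite S" "\<And>is. is \<in> S \<Longrightarrow> set is \<subseteq> {..<m} \<and> length is = n"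
    and zero: "\<And>js. set js \<subseteq> {..<m} \<Longrightarrow> length js = n \<Longrightarrow>
      (\<Sum>is\<in>S. c is * pairing (\<lambda>i j. of_int (A i j)) (\<lambda>i. \<Lambda> (coroot i)) js is) = 0"
  shows "(\<Sum>is\<in>S. vscale (c is) (hw.fword is)) = 0"
proof -
  let ?u = "\<Sum>is\<in>S. vscale (c is) (hw.fword is)"
  have "hw.eword js ?u \<in> lower_part" if js: "set js \<subseteq> {..<m}" for js
  proof -
    have eq: "hw.eword js ?u = (\<Sum>is\<in>S. vscale (c is) (hw.eword js (hw.fword is)))"
      using js by (simp add: hw.eword_sum hw.eword_scale)
    consider "length js < n" | "length js = n" | "n < length js" by linarith
    then show ?thesis
    proof cases
      case 1
      have "hw.eword js (hw.fword is) \<in> lower_part" if "is \<in> S" for "is"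
        using hw.eword_fword_short[OF js, of "is"] assms(2)[OF that] 1 unfolding lower_part_def by simp
      then show ?thesis unfolding eq
        by (intro V.subspace_sum[OF subspace_lower_part] V.subspace_scale[OF subspace_lower_part])
    next
      case 2
      have "hw.eword js ?u = (\<Sum>is\<in>S. vscale (c is * pairing (\<lambda>i j. of_int (A i j)) (\<lambda>i. \<Lambda> (coroot i)) js is) hw_vector)"
        unfolding eq using assms(2) js 2 by (intro sum.cong refl) (simp add: hw.eword_fword_pairing)
      also have "\<dots> = vscale (\<Sum>is\<in>S. c is * pairing (\<lambda>i j. of_int (A i j)) (\<lambda>i. \<Lambda> (coroot i)) js is) hw_vector"
        by (rule V.scale_sum_left[symmetric])
      also have "\<dots> = 0" using zero[OF js 2] by simp
      finally show ?thesis using V.subspace_0[OF subspace_lower_part] by simp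
    next
      case 3
      have "hw.eword js ?u = 0" unfolding eq
        using assms(2) js 3 by (intro sum.neutral ballI) (simp add: hw.eword_fword_long)
      then show ?thesis using V.subspace_0[OF subspace_lower_part] by simp
    qed
  qed
  then have "?u \<in> radical" by (simp add: radical_def)
  then show ?thesis using radical_zero by blast
qed

lemma weights_lowered:
  assumes "\<mu> \<in> weights hscale cartan vscale act"
  shows "\<exists>is. set is \<subseteq> {..<m} \<and> word_weight is = \<mu>"
proof (rule ccontr)
  assume "\<not> ?thesis"
  then have none: "{is\<in>vwords. word_weight is = \<mu>} = {}" by blast
  have "wspace \<mu> = {0}" unfolding wspace_span none by simp
  then show False using assms by (simp add: weights_def)
qed

text \<open>
  Near the vertex \<open>0\<close> the Cartan integers and the highest weight agree with those of the \<open>r\<close>-fold tensor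
  power of the spin representation, hence so do the pairings and the linear relations among lowering
  words of the weight \<open>\<mu>\<close>.
\<close>

lemma dim_wspace:
  assumes small: "\<And>i j. i < l \<Longrightarrow> j < l \<Longrightarrow> of_int (A i j) = cartan_B i j"
    and high: "\<And>i. i < l \<Longrightarrow> \<Lambda> (coroot i) = (if i = 0 then of_nat r else 0)"
    and "0 < r" "l < m" and \<mu>: "\<mu> = (\<lambda>h. \<Lambda> h - (\<Sum>j<m. of_nat (l - j) * \<alpha> j h))"
  shows "V.dim (wspace \<mu>) = card (avoiders r {1..l})"
proof -
  let ?S = "{is. count_list is = (\<lambda>k. l - k)}"
  have sl: "set is \<subseteq> {..<l}" if "is \<in> ?S" for "is"
  proof
    fix i assume "i \<in> set is"
    then have "count_list is i \<noteq> 0" by (simp add: count_list_0_iff)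
    then show "i \<in> {..<l}" using that by simp
  qed
  have len: "length is = (\<Sum>k<l. l - k)" if "is \<in> ?S" for "is"
    using sum_count_set[OF sl[OF that]] that by simp
  have fin: "finite ?S"
    by (rule finite_subset[OF _ finite_lists_length_eq[of "{..<l}" "\<Sum>k<l. l - k"]]) (use sl len in auto)
  have words: "{is\<in>vwords. word_weight is = \<mu>} = ?S"
  proof (intro Set.set_eqI iffI)
    fix "is" assume "is": "is \<in> {is\<in>vwords. word_weight is = \<mu>}"
    then have v: "set is \<subseteq> {..<m}" and w: "word_weight is = (\<lambda>h. \<Lambda> h - (\<Sum>j<m. of_nat (l - j) * \<alpha> j h))"
      using \<mu> by simp_all
    have "\<forall>j<m. (of_nat (count_list is j) :: complex) = of_nat (l - j)"
      using word_weight_eq_iff[OF v, of "\<lambda>j. of_nat (l - j)"] w by simp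
    then have lt: "count_list is j = l - j" if "j < m" for j using that by (simp only: of_nat_eq_iff)
    have "count_list is j = l - j" for j
    proof (cases "j < m")
      case False
      then have "j \<notin> set is" using "is" by auto
      then show ?thesis using False assms(4) by (simp add: count_list_0_iff)
    qed (rule lt)
    then show "is \<in> ?S" by auto
  next
    fix "is" assume "is": "is \<in> ?S"
    have v: "set is \<subseteq> {..<m}" using sl[OF "is"] assms(4) by auto
    then show "is \<in> {is\<in>vwords. word_weight is = \<mu>}" using word_weight_eq_iff[OF v] "is" \<mu> by simp
  qed
  let ?lam = "\<lambda>i. if i = 0 then of_nat r else 0 :: complex"
  have pair: "pairing (\<lambda>i j. of_int (A i j)) (\<lambda>i. \<Lambda> (coroot i)) js is = pairing cartan_B ?lam js is"
    if "is \<in> ?S" for js "is"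
  proof (rule pairing_cong)
    have lt: "i < l" if "i \<in> set is" for i using that sl[OF \<open>is \<in> ?S\<close>] by auto
    fix i assume i: "i \<in> set is"
    show "\<Lambda> (coroot i) = ?lam i" by (rule high[OF lt[OF i]])
    fix j assume j: "j \<in> set is"
    show "of_int (A i j) = cartan_B i j" by (rule small[OF lt[OF i] lt[OF j]])
  qed
  have SL: "set is \<subseteq> {..<m} \<and> length is = (\<Sum>k<l. l - k)" if "is \<in> ?S" for "is"
    using sl[OF that] len[OF that] assms(4) by auto
  have rel1: "(\<Sum>is\<in>?S. vscale (c is) (hw.fword is)) = 0"
    if z: "(\<Sum>is\<in>?S. (\<lambda>s. c is * fock_word r is s)) = 0" for c
  proof (rule fword_relation[OF fin SL])
    fix js :: "nat list" assume js: "set js \<subseteq> {..<m}" "length js = (\<Sum>k<l. l - k)"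
    have v0: "vacuum \<noteq> 0"
    proof
      assume "vacuum = 0"
      then have "vacuum (\<lambda>_. {}) = 0" by (simp only: zero_fun_apply)
      then show False by (simp add: vacuum_def)
    qed
    have "(\<Sum>is\<in>?S. c is * pairing cartan_B ?lam js is) = 0"
      by (rule fock.sum_fword_zero_pairing[OF v0 fin SL z js])
    moreover have "(\<Sum>is\<in>?S. c is * pairing (\<lambda>i j. of_int (A i j)) (\<lambda>i. \<Lambda> (coroot i)) js is)
        = (\<Sum>is\<in>?S. c is * pairing cartan_B ?lam js is)"
      by (intro sum.cong refl arg_cong2[where f = "(*)"] pair)
    ultimately show "(\<Sum>is\<in>?S. c is * pairing (\<lambda>i j. of_int (A i j)) (\<lambda>i. \<Lambda> (coroot i)) js is) = 0"
      by (rule trans[rotated])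
  qed
  have rel2: "(\<Sum>is\<in>?S. (\<lambda>s. c is * fock_word r is s)) = 0"
    if z: "(\<Sum>is\<in>?S. vscale (c is) (hw.fword is)) = 0" for c
  proof (rule fock_relation[OF fin, where n = "\<Sum>k<l. l - k"])
    show "set is \<subseteq> {..<l} \<and> length is = (\<Sum>k<l. l - k)" if "is \<in> ?S" for "is"
      using sl[OF that] len[OF that] by simp
    fix js :: "nat list" assume js: "set js \<subseteq> {..<l}" "length js = (\<Sum>k<l. l - k)"
    have jm: "set js \<subseteq> {..<m}" using js(1) assms(4) by auto
    have "(\<Sum>is\<in>?S. c is * pairing (\<lambda>i j. of_int (A i j)) (\<lambda>i. \<Lambda> (coroot i)) js is) = 0"
      by (rule hw.sum_fword_zero_pairing[OF hw_vector(1) fin SL z jm js(2)])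
    moreover have "(\<Sum>is\<in>?S. c is * pairing (\<lambda>i j. of_int (A i j)) (\<lambda>i. \<Lambda> (coroot i)) js is)
        = (\<Sum>is\<in>?S. c is * pairing cartan_B ?lam js is)"
      by (intro sum.cong refl arg_cong2[where f = "(*)"] pair)
    ultimately show "(\<Sum>is\<in>?S. c is * pairing cartan_B ?lam js is) = 0"
      by (rule trans[OF sym, rotated])
  qed
  have vsV: "vector_space vscale" by (rule V.vector_space_axioms)
  have vsF: "vector_space (\<lambda>(c::complex) (f::state \<Rightarrow> complex) x. c * f x)" by (rule fun_space.vector_space_axioms)
  have "V.dim (V.span (hw.fword ` ?S)) = fun_space.dim (fun_space.span (fock_word r ` ?S))"
  proof (rule antisym)
    show "V.dim (V.span (hw.fword ` ?S)) \<le> fun_space.dim (fun_space.span (fock_word r ` ?S))"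
      using rel1 by (rule dim_le_of_relations[OF vsV vsF fin])
    show "fun_space.dim (fun_space.span (fock_word r ` ?S)) \<le> V.dim (V.span (hw.fword ` ?S))"
      using rel2 by (rule dim_le_of_relations[OF vsF vsV fin])
  qed
  then show ?thesis unfolding wspace_span words using dim_fock_words[OF assms(3)] by simp
qed

end

section \<open>Pattern avoidance and the affine types\<close>

lemma avoiding_involutions_eq: "avoiding_involutions (Suc r) l = avoiders r {1..l}"
proof -
  have inv: "w permutes {1..l} \<and> w \<circ> w = id \<longleftrightarrow> involution_on {1..l} w" for w
  proof
    assume "w permutes {1..l} \<and> w \<circ> w = id"
    then show "involution_on {1..l} w"
      using permutes_in_image[of w "{1..l}"] unfolding involution_on_def permutes_def
      by (metis comp_apply id_apply)
  next
    assume "involution_on {1..l} w"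
    then show "w permutes {1..l} \<and> w \<circ> w = id"
      using involution_on_permutes involution_onD(2) by (auto simp: fun_eq_iff)
  qed
  have pat: "(\<exists>i. i \<in> {1..Suc r} \<rightarrow> {1..l} \<and> strict_mono_on {1..Suc r} i \<and>
      strict_antimono_on {1..Suc r} (\<lambda>a. w (i a))) \<longleftrightarrow> \<not> short_decreasing r {1..l} w" for w :: "nat \<Rightarrow> nat"
  proof
    assume "\<exists>i. i \<in> {1..Suc r} \<rightarrow> {1..l} \<and> strict_mono_on {1..Suc r} i \<and>
      strict_antimono_on {1..Suc r} (\<lambda>a. w (i a))"
    then obtain i where i: "i \<in> {1..Suc r} \<rightarrow> {1..l}" "strict_mono_on {1..Suc r} i"
      "strict_antimono_on {1..Suc r} (\<lambda>a. w (i a))" by blast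
    let ?D = "i ` {1..Suc r}"
    have inj: "inj_on i {1..Suc r}" using i(2) by (rule strict_mono_on_imp_inj_on)
    have "decreasing_on ?D w"
      unfolding decreasing_on_def
    proof (intro ballI impI)
      fix x y assume "x \<in> ?D" "y \<in> ?D" "x < y"
      then obtain a b where ab: "x = i a" "y = i b" "a \<in> {1..Suc r}" "b \<in> {1..Suc r}" by blast
      have "a < b"
      proof (rule ccontr)
        assume "\<not> a < b"
        then have "b = a \<or> b < a" by auto
        then have "i b \<le> i a" using ab i(2) by (auto simp: monotone_on_def intro: less_imp_le)
        then show False using \<open>x < y\<close> ab by simp
      qed
      then show "w y < w x" using ab i(3) by (simp add: monotone_on_def)
    qed
    moreover have "?D \<subseteq> {1..l}" using i(1) by auto
    moreover have "card ?D = Suc r" using card_image[OF inj] by simp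
    ultimately show "\<not> short_decreasing r {1..l} w" unfolding short_decreasing_def by (metis Suc_n_not_le_n)
  next
    assume "\<not> short_decreasing r {1..l} w"
    then obtain D where D: "D \<subseteq> {1..l}" "decreasing_on D w" "r < card D"
      by (auto simp: short_decreasing_def not_le)
    have finD: "finite D" using D(1) finite_subset by blast
    let ?xs = "sorted_list_of_set D"
    let ?i = "\<lambda>a. ?xs ! (a - 1)"
    have len: "length ?xs = card D" using finD by simp
    have mem: "?i a \<in> D" if "a \<in> {1..Suc r}" for a
      using nth_mem[of "a - 1" ?xs] that len D(3) finD by auto
    have mono: "?i a < ?i b" if "a \<in> {1..Suc r}" "b \<in> {1..Suc r}" "a < b" for a b
      using sorted_wrt_nth_less[OF strict_sorted_list_of_set[of D], of "a - 1" "b - 1"] that len D(3) by auto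
    have "?i \<in> {1..Suc r} \<rightarrow> {1..l}" using mem D(1) by blast
    moreover have "strict_mono_on {1..Suc r} ?i" using mono by (auto simp: monotone_on_def)
    moreover have "strict_antimono_on {1..Suc r} (\<lambda>a. w (?i a))"
      using mono mem D(2) unfolding monotone_on_def decreasing_on_def by blast
    ultimately show "\<exists>i. i \<in> {1..Suc r} \<rightarrow> {1..l} \<and> strict_mono_on {1..Suc r} i \<and>
      strict_antimono_on {1..Suc r} (\<lambda>a. w (i a))" by blast
  qed
  show ?thesis unfolding avoiding_involutions_def avoiders_def using inv pat by blast
qed

lemma check_cartan_interior:
  "i < l \<Longrightarrow> j < l \<Longrightarrow> l \<le> p div 2 \<Longrightarrow> of_int (check_cartan p i j) = cartan_B i j"
  by (auto simp: check_cartan_def cartan_B_def Let_def)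

lemma check_cartan_nonpos: "i \<noteq> j \<Longrightarrow> check_cartan p i j \<le> 0"
  by (auto simp: check_cartan_def Let_def)

lemma check_cartan_far: "j \<noteq> i \<Longrightarrow> j \<noteq> Suc i \<Longrightarrow> i \<noteq> Suc j \<Longrightarrow> check_cartan p i j = 0"
  by (auto simp: check_cartan_def Let_def)

text \<open>
  The coefficients \<open>l, l - 1, \<dots>, 1, 0, \<dots>\<close> are linear in the interior, so the Cartan integers annihilate
  them except at the vertex \<open>0\<close> and at the vertex \<open>l\<close> where the staircase ends.
\<close>

lemma staircase_coroot:
  assumes "1 \<le> l" "l \<le> p div 2" "i \<le> p div 2"
  shows "i = 0 \<Longrightarrow> (\<Sum>j<l. int (l - j) * check_cartan p i j) = 2"
    "i \<noteq> 0 \<Longrightarrow> (\<Sum>j<l. int (l - j) * check_cartan p i j) \<le> 0"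
proof -
  let ?u = "check_cartan p i (Suc i)" and ?v = "check_cartan p i (i - 1)"
  let ?T = "\<Sum>j<l. int (l - j) * check_cartan p i j"
  have "?T = (\<Sum>j<l. (if j = i then 2 * int (l - j) else 0) + (if j = Suc i then ?u * int (l - j) else 0)
      + (if j = i - 1 then (if i = 0 then 0 else ?v * int (l - j)) else 0))"
  proof (intro sum.cong refl)
    fix j
    consider "j = i" | "j = Suc i" | "i = Suc j" | "j \<noteq> i" "j \<noteq> Suc i" "i \<noteq> Suc j" by blast
    then show "int (l - j) * check_cartan p i j = (if j = i then 2 * int (l - j) else 0)
      + (if j = Suc i then ?u * int (l - j) else 0)
      + (if j = i - 1 then (if i = 0 then 0 else ?v * int (l - j)) else 0)"
    proof cases
      case 1 then show ?thesis by (cases i) (auto simp: check_cartan_def)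
    next
      case 4
      then have "i = 0 \<or> j \<noteq> i - 1" by (cases i) auto
      then show ?thesis using 4 check_cartan_far[of j i p] by auto
    qed auto
  qed
  also have "\<dots> = (if i < l then 2 * int (l - i) else 0) + (if Suc i < l then ?u * int (l - Suc i) else 0)
      + (if i - 1 < l \<and> i \<noteq> 0 then ?v * int (l - (i - 1)) else 0)"
    by (simp add: sum.distrib sum.delta)
  finally have T: "?T = (if i < l then 2 * int (l - i) else 0) + (if Suc i < l then ?u * int (l - Suc i) else 0)
      + (if i - 1 < l \<and> i \<noteq> 0 then ?v * int (l - (i - 1)) else 0)" .
  show "?T = 2" if "i = 0"
  proof (cases "l = 1")
    case True then show ?thesis using T that by simp
  next
    case False
    then have "?u = -2" using that assms by (auto simp: check_cartan_def Let_def)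
    then show ?thesis unfolding T using that False assms(1) by (simp add: of_nat_diff)
  qed
  show "?T \<le> 0" if i: "i \<noteq> 0"
  proof (cases "i < l")
    case True
    then have v: "?v = -1" using i assms by (auto simp: check_cartan_def Let_def)
    have u: "Suc i < l \<Longrightarrow> ?u = -1" using i assms by (auto simp: check_cartan_def Let_def)
    show ?thesis
    proof (cases "Suc i < l")
      case True
      then show ?thesis unfolding T using i v u by (simp add: of_nat_diff)
    next
      case False
      then have "l = Suc i" using \<open>i < l\<close> by simp
      then show ?thesis unfolding T using i v by (simp add: of_nat_diff)
    qed
  next
    case False
    have "?v \<le> 0" using i by (intro check_cartan_nonpos) auto
    then have v: "?v * int (l - (i - 1)) \<le> 0" by (intro mult_nonpos_nonneg) auto
    have T': "?T = (if i - 1 < l \<and> i \<noteq> 0 then ?v * int (l - (i - 1)) else 0)"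
      unfolding T using False by simp
    show ?thesis
    proof (cases "i - 1 < l \<and> i \<noteq> 0")
      case True
      show ?thesis unfolding T' if_P[OF True] by (rule v)
    next
      case False
      show ?thesis unfolding T' if_not_P[OF False] by (rule order_refl)
    qed
  qed
qed

lemma dual_space_iff:
  assumes "vector_space hscale"
  shows "\<mu> \<in> dual_space hscale \<longleftrightarrow> (\<forall>x y. \<mu> (x + y) = \<mu> x + \<mu> y) \<and> (\<forall>c x. \<mu> (hscale c x) = c * \<mu> x)"
proof -
  have "vector_space ((*) :: complex \<Rightarrow> complex \<Rightarrow> complex)"
    by unfold_locales (auto simp: algebra_simps)
  then show ?thesis using assms by (auto simp: dual_space_def Vector_Spaces.linear_iff)
qed

theorem theorem1p7:
  fixes p k :: nat
    and hscale :: "complex \<Rightarrow> 'h::ab_group_add \<Rightarrow> 'h"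
    and coroot :: "nat \<Rightarrow> 'h"
    and \<alpha> :: "nat \<Rightarrow> 'h \<Rightarrow> complex"
    and gscale :: "complex \<Rightarrow> 'g::ab_group_add \<Rightarrow> 'g"
    and bracket :: "'g \<Rightarrow> 'g \<Rightarrow> 'g"
    and cartan :: "'h \<Rightarrow> 'g"
    and e f :: "nat \<Rightarrow> 'g"
    and vscale :: "complex \<Rightarrow> 'v::ab_group_add \<Rightarrow> 'v"
    and act :: "'g \<Rightarrow> 'v \<Rightarrow> 'v"
    and \<Lambda>\<^sub>0 \<Lambda> :: "'h \<Rightarrow> complex"
    and \<gamma> :: "nat \<Rightarrow> 'h \<Rightarrow> complex"
  assumes "p \<ge> 2" and "k \<ge> 1"
    and "kac_moody_algebra hscale (p div 2 + 1) (check_cartan p) coroot \<alpha>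
           gscale bracket cartan e f"
    and "fundamental_weight hscale (p div 2 + 1) coroot 0 \<Lambda>\<^sub>0"
    and "\<Lambda> = (\<lambda>h. of_nat (k + 1) * \<Lambda>\<^sub>0 h)"
    and "irreducible_highest_weight_module hscale (p div 2 + 1) (check_cartan p) coroot \<alpha>
           gscale bracket cartan e f vscale act \<Lambda>"
    and "\<And>l h. \<gamma> l h = \<Lambda> h - (\<Sum>i<l. of_nat (l - i) * \<alpha> i h)"
  shows "\<forall>l. 1 \<le> l \<and> l \<le> p div 2 \<longrightarrow>
      \<gamma> l \<in> maximal_weights hscale cartan vscale act (check_null_root p \<alpha>)
              \<inter> dominant_integral hscale (p div 2 + 1) coroot \<and>
      vector_space.dim vscale (weight_space cartan vscale act (\<gamma> l))
        = card (avoiding_involutions (k + 2) l)"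
proof (intro allI impI, elim conjE)
  fix l assume l: "1 \<le> l" "l \<le> p div 2"
  let ?n = "p div 2"
  interpret irreducible_highest_weight_module hscale "?n + 1" "check_cartan p" coroot \<alpha>
    gscale bracket cartan e f vscale act \<Lambda> by fact
  have vsh: "vector_space hscale" by (rule R.vector_space_axioms)
  have \<Lambda>c: "\<Lambda> (coroot i) = (if i = 0 then of_nat (k + 1) else 0)" if "i \<le> ?n" for i
    using assms(4,5) that by (simp add: fundamental_weight_def)
  have \<gamma>: "\<gamma> l = (\<lambda>h. \<Lambda> h - (\<Sum>j<?n + 1. of_nat (l - j) * \<alpha> j h))"
  proof
    fix h
    have "(\<Sum>i<l. of_nat (l - i) * \<alpha> i h) = (\<Sum>j<?n + 1. of_nat (l - j) * \<alpha> j h)"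
      using l by (intro sum.mono_neutral_left) auto
    then show "\<gamma> l h = \<Lambda> h - (\<Sum>j<?n + 1. of_nat (l - j) * \<alpha> j h)" using assms(7) by simp
  qed
  have dim: "V.dim (wspace (\<gamma> l)) = card (avoiders (k + 1) {1..l})"
    using check_cartan_interior[OF _ _ l(2)] \<Lambda>c l by (intro dim_wspace[OF _ _ _ _ \<gamma>]) auto
  have "id \<in> avoiders (k + 1) {1..l}"
  proof -
    have "card D \<le> k + 1" if D: "decreasing_on D id" for D :: "nat set"
    proof -
      have "x = y" if "x \<in> D" "y \<in> D" for x y
        using D that by (cases x y rule: linorder_cases) (force simp: decreasing_on_def)+
      then have "D = {} \<or> (\<exists>x. D = {x})" by blast
      then show ?thesis by auto
    qed
    then show ?thesis by (auto simp: avoiders_def short_decreasing_def involution_on_def)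
  qed
  then have "card (avoiders (k + 1) {1..l}) \<noteq> 0"
    using finite_involutions[of "{1..l}" "short_decreasing (k + 1) {1..l}"] by (auto simp: avoiders_def)
  moreover have "V.dim {0} = card ({} :: 'v set)"
    by (rule V.dim_eq_card) (simp_all add: V.span_insert_0 V.independent_empty)
  ultimately have nz: "wspace (\<gamma> l) \<noteq> {0}" using dim by auto
  have dual: "\<gamma> l \<in> dual_space hscale"
  proof -
    have "\<Lambda>\<^sub>0 \<in> dual_space hscale" using assms(4) by (simp add: fundamental_weight_def)
    moreover have "\<alpha> j \<in> dual_space hscale" if "j < ?n + 1" for j using R.root_linear[OF that] .
    ultimately show ?thesis unfolding dual_space_iff[OF vsh] \<gamma> assms(5)
      by (simp add: algebra_simps sum.distrib sum_distrib_left)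
  qed
  have notw: "(\<lambda>h. \<gamma> l h + check_null_root p \<alpha> h) \<notin> weights hscale cartan vscale act"
  proof
    assume "(\<lambda>h. \<gamma> l h + check_null_root p \<alpha> h) \<in> weights hscale cartan vscale act"
    then obtain "is" where v: "set is \<subseteq> {..<?n + 1}" and w: "word_weight is = (\<lambda>h. \<gamma> l h + check_null_root p \<alpha> h)"
      using weights_lowered by blast
    let ?d = "\<lambda>j. if odd p \<and> j < ?n then 2 else 1 :: complex"
    have d: "check_null_root p \<alpha> h = (\<Sum>j<?n + 1. ?d j * \<alpha> j h)" for h
      unfolding check_null_root_def by (intro sum.cong) auto
    have "word_weight is = (\<lambda>h. \<Lambda> h - (\<Sum>j<?n + 1. (of_nat (l - j) - ?d j) * \<alpha> j h))"
    proof
      fix h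
      have arith: "a - b + c = a - (b - c)" for a b c :: complex by simp
      show "word_weight is h = \<Lambda> h - (\<Sum>j<?n + 1. (of_nat (l - j) - ?d j) * \<alpha> j h)"
        unfolding w \<gamma> d left_diff_distrib sum_subtractf by (rule arith)
    qed
    then have "\<forall>j<?n + 1. of_nat (count_list is j) = of_nat (l - j) - ?d j"
      by (rule iffD1[OF word_weight_eq_iff[OF v]])
    then have "of_nat (count_list is ?n) = of_nat (l - ?n) - ?d ?n" by simp
    \<comment> \<open>the last vertex does not occur in \<open>\<gamma> l\<close>, but has coefficient \<open>1\<close> in the null root\<close>
    then have "complex_of_nat (count_list is ?n) + 1 = 0" using l(2) by simp
    then have "complex_of_nat (Suc (count_list is ?n)) = 0" by (simp add: add.commute)
    then show False unfolding of_nat_eq_0_iff by simp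
  qed
  have dom: "\<gamma> l (coroot i) \<in> \<nat>" if "i < ?n + 1" for i
  proof -
    have i: "i \<le> ?n" using that by simp
    define T where "T = (\<Sum>j<l. int (l - j) * check_cartan p i j)"
    have "(\<Sum>j<l. of_nat (l - j) * \<alpha> j (coroot i)) = (\<Sum>j<l. of_nat (l - j) * of_int (check_cartan p i j))"
      using that l by (intro sum.cong refl) (simp add: R.root_coroot)
    also have "\<dots> = of_int T" unfolding T_def by simp
    finally have s: "\<gamma> l (coroot i) = \<Lambda> (coroot i) - of_int T"
      using assms(7)[of l "coroot i"] by (simp only:)
    show ?thesis
    proof (cases "i = 0")
      case True
      have "T = 2" unfolding T_def by (rule staircase_coroot(1)[OF l i True])
      then have "\<gamma> l (coroot i) = of_nat (k + 1) - 2" using s \<Lambda>c[OF i] True by simp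
      also have "\<dots> = of_nat (k - 1)" using assms(2) by (simp add: of_nat_diff)
      finally show ?thesis by simp
    next
      case False
      have "T \<le> 0" unfolding T_def by (rule staircase_coroot(2)[OF l i False])
      then have "(of_int T :: complex) = - of_nat (nat (- T))" by (simp add: of_nat_nat)
      then have "\<gamma> l (coroot i) = of_nat (nat (- T))" using s \<Lambda>c[OF i] False by simp
      then show ?thesis by simp
    qed
  qed
  show "\<gamma> l \<in> maximal_weights hscale cartan vscale act (check_null_root p \<alpha>)
              \<inter> dominant_integral hscale (?n + 1) coroot \<and>
      V.dim (wspace (\<gamma> l)) = card (avoiding_involutions (k + 2) l)"
    using dual nz notw dom dim avoiding_involutions_eq[of "k + 1" l]
    by (simp add: maximal_weights_def weights_def dominant_integral_def)
qed

end
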